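(* Let $N,\ell\in\mathbb{N}^*$ be such that $\ell\le N$, let $U_0\in H^N(\mathbb{R})\cap L^1(\mathbb{R})$ (componentwise), and let $U=(v,u,z,y,\phi,\theta,\eta)^T$ be the solution of the Cauchy problem $$\begin{cases} v_t-u_x-y-\theta=0,\\ u_t-k_1v_x=0,\\ z_t-y_x=0,\\ y_t-k_2z_x+k_1v+\gamma\eta_x=0,\\ \phi_t-\theta_x=0,\\ \theta_t-k_3\phi_x+k_1v=0,\\ \eta_t-k_4\eta_{xx}+\gamma y_x=0,\end{cases}\qquad x\in\mathbb{R},\ t>0,\qquad U(\cdot,0)=U_0 .$$ Then, for any $j\in\{0,\dots,N-\ell\}$, there exist $c_0,\tilde c_0>0$ such that, for any $t\in\mathbb{R}_+$: if $k_1=k_2=k_3$, $$\|\partial_x^jU(\cdot,t)\|_{L^2(\mathbb{R})}\le c_0(1+t)^{-1/8-j/4}\|U_0\|_{L^1(\mathbb{R})}+c_0e^{-\tilde c_0t}\|\partial_x^{j+\ell}U_0\|_{L^2(\mathbb{R})},$$ and if $k_1=k_2=k_3$ does not hold, $$\|\partial_x^jU(\cdot,t)\|_{L^2(\mathbb{R})}\le c_0(1+t)^{-1/8-j/4}\|U_0\|_{L^1(\mathbb{R})}+c_0(1+t)^{-\ell/4}\|\partial_x^{j+\ell}U_0\|_{L^2(\mathbb{R})}.$$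
   Context: $k_1,k_2,k_3,k_4,\gamma>0$ are constants; $\mathbb{N}^*$ is the set of positive integers and $\mathbb{R}_+=[0,\infty)$. The system is the first-order form (with $u=\varphi_t$, $y=\psi_t$, $\theta=w_t$, $v=\varphi_x+\psi+w$, $z=\psi_x$, $\phi=w_x$) of the laminated Timoshenko system with interfacial slip coupled to Fourier heat conduction acting through the second (rotation angle) equation. The solution $U$ is the one whose Fourier transform in $x$, $\widehat U(\xi,t)$, solves for each $\xi\in\mathbb{R}$ the linear ODE system obtained by replacing $\partial_x$ by $i\xi$, with initial value $\widehat U_0(\xi)$. Norms of vector-valued functions are the usual ones. *)

theory Defs
  imports "HOL-Analysis.Analysis"
begin

text \<open>Function spaces on the real line. Elements of \<open>L\<^sup>1\<close>, \<open>L\<^sup>2\<close> and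
  \<open>H\<^sup>N\<close> are given by Borel representatives; equality is meant almost everywhere.\<close>

definition in_L1 :: "(real \<Rightarrow> 'a::euclidean_space) \<Rightarrow> bool" where
  "in_L1 f \<longleftrightarrow> integrable lborel f"

definition L1_norm :: "(real \<Rightarrow> 'a::euclidean_space) \<Rightarrow> real" where
  "L1_norm f = (LINT x|lborel. norm (f x))"

definition in_L2 :: "(real \<Rightarrow> 'a::euclidean_space) \<Rightarrow> bool" where
  "in_L2 f \<longleftrightarrow> f \<in> borel_measurable lborel \<and> integrable lborel (\<lambda>x. (norm (f x))\<^sup>2)"

definition L2_norm :: "(real \<Rightarrow> 'a::euclidean_space) \<Rightarrow> real" where
  "L2_norm f = sqrt (LINT x|lborel. (norm (f x))\<^sup>2)"

definition test_function :: "(real \<Rightarrow> real) \<Rightarrow> bool" where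
  "test_function \<phi> \<longleftrightarrow>
     (\<forall>n x. (deriv ^^ n) \<phi> field_differentiable (at x)) \<and>
     (\<exists>R. \<forall>x. \<bar>x\<bar> > R \<longrightarrow> \<phi> x = 0)"

definition locally_integrable :: "(real \<Rightarrow> 'a::euclidean_space) \<Rightarrow> bool" where
  "locally_integrable f \<longleftrightarrow> (\<forall>R. set_integrable lborel {-R..R} f)"

definition is_weak_deriv ::
  "nat \<Rightarrow> (real \<Rightarrow> 'a::euclidean_space) \<Rightarrow> (real \<Rightarrow> 'a) \<Rightarrow> bool" where
  "is_weak_deriv n f g \<longleftrightarrow> locally_integrable f \<and> locally_integrable g \<and>
     (\<forall>\<phi>. test_function \<phi> \<longrightarrow>
        (LINT x|lborel. (deriv ^^ n) \<phi> x *\<^sub>R f x) =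
        (- 1) ^ n *\<^sub>R (LINT x|lborel. \<phi> x *\<^sub>R g x))"

text \<open>A weak derivative is unique up to a null set, so the choice of representative
  below is immaterial for membership in \<open>L\<^sup>2\<close> and for the norm.\<close>

definition weak_deriv ::
  "nat \<Rightarrow> (real \<Rightarrow> 'a::euclidean_space) \<Rightarrow> (real \<Rightarrow> 'a)" where
  "weak_deriv n f = (SOME g. is_weak_deriv n f g)"

definition in_sobolev :: "nat \<Rightarrow> (real \<Rightarrow> 'a::euclidean_space) \<Rightarrow> bool" where
  "in_sobolev N f \<longleftrightarrow> in_L2 f \<and>
     (\<forall>n\<le>N. is_weak_deriv n f (weak_deriv n f) \<and> in_L2 (weak_deriv n f))"

definition fourier :: "(real \<Rightarrow> complex ^ 'n) \<Rightarrow> real \<Rightarrow> complex ^ 'n" where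
  "fourier f \<xi> = (LINT x|lborel. cis (- (\<xi> * x)) *s f x)"

text \<open>The Fourier transform on \<open>L\<^sup>2\<close> (Plancherel), defined as a relation: \<open>g\<close> is the
  \<open>L\<^sup>2\<close> limit of the Fourier integrals of \<open>f\<close> truncated to \<open>{-R..R}\<close>.\<close>

definition has_L2_fourier ::
  "(real \<Rightarrow> complex ^ 'n) \<Rightarrow> (real \<Rightarrow> complex ^ 'n) \<Rightarrow> bool" where
  "has_L2_fourier f g \<longleftrightarrow> in_L2 f \<and> in_L2 g \<and>
     ((\<lambda>R. \<integral>\<^sup>+\<xi>. ennreal
         ((norm (g \<xi> - fourier (\<lambda>x. indicator {-R..R} x *\<^sub>R f x) \<xi>))\<^sup>2) \<partial>lborel)
       \<longlongrightarrow> 0) at_top"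

text \<open>The Fourier-transformed system at frequency \<open>\<xi>\<close>, obtained by replacing
  \<open>\<partial>\<^sub>x\<close> by \<open>\<i>\<xi>\<close>. The state \<open>(v, u, z, y, \<phi>, \<theta>, \<eta>)\<close> occupies the components
  \<open>1, \<dots>, 7\<close> in this order.\<close>

definition laminated_ode ::
  "real \<Rightarrow> real \<Rightarrow> real \<Rightarrow> real \<Rightarrow> real \<Rightarrow> real \<Rightarrow> (real \<Rightarrow> complex ^ 7) \<Rightarrow> bool" where
  "laminated_ode k1 k2 k3 k4 \<gamma> \<xi> W \<longleftrightarrow>
     continuous_on {0..} W \<and>
     (\<forall>t>0. let D = \<i> * complex_of_real \<xi>;
               v = W t $ 1; u = W t $ 2; z = W t $ 3; y = W t $ 4;
               \<phi> = W t $ 5; \<theta> = W t $ 6; \<eta> = W t $ 7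
       in
        ((\<lambda>s. W s $ 1) has_vector_derivative (D * u + y + \<theta>)) (at t) \<and>
        ((\<lambda>s. W s $ 2) has_vector_derivative (k1 * (D * v))) (at t) \<and>
        ((\<lambda>s. W s $ 3) has_vector_derivative (D * y)) (at t) \<and>
        ((\<lambda>s. W s $ 4) has_vector_derivative (k2 * (D * z) - k1 * v - \<gamma> * (D * \<eta>))) (at t) \<and>
        ((\<lambda>s. W s $ 5) has_vector_derivative (D * \<theta>)) (at t) \<and>
        ((\<lambda>s. W s $ 6) has_vector_derivative (k3 * (D * \<phi>) - k1 * v)) (at t) \<and>
        ((\<lambda>s. W s $ 7) has_vector_derivative (k4 * (D\<^sup>2 * \<eta>) - \<gamma> * (D * y))) (at t))"

text \<open>\<open>U t\<close> is the spatial profile of the solution at time \<open>t\<close>, and \<open>What \<xi> t\<close> is the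
  value of its Fourier transform at \<open>\<xi>\<close>.\<close>

definition laminated_solution ::
  "real \<Rightarrow> real \<Rightarrow> real \<Rightarrow> real \<Rightarrow> real \<Rightarrow>
   (real \<Rightarrow> complex ^ 7) \<Rightarrow> (real \<Rightarrow> real \<Rightarrow> complex ^ 7) \<Rightarrow> bool" where
  "laminated_solution k1 k2 k3 k4 \<gamma> U0 U \<longleftrightarrow>
     (\<exists>What. (\<forall>\<xi>. laminated_ode k1 k2 k3 k4 \<gamma> \<xi> (What \<xi>) \<and> What \<xi> 0 = fourier U0 \<xi>) \<and>
             (\<forall>t\<ge>0. has_L2_fourier (U t) (\<lambda>\<xi>. What \<xi> t)))"

end

theory Submission
  imports Defs "HOL-Probability.Probability" "HOL-Real_Asymp.Real_Asymp"
begin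

text \<open>
  On the Fourier side the energy is dissipated only through \<open>\<eta>\<close>, at the rate \<open>\<xi>\<^sup>2 |\<eta>|\<^sup>2\<close>. Call a quadratic
  quantity controlled if it is bounded by this dissipation, plus the time derivative of a quadratic
  functional, plus an arbitrarily small multiple of \<open>\<lambda>(\<xi>) |W|\<^sup>2\<close>. Multipliers propagate control from
  \<open>\<eta>\<close> to \<open>y\<close> and then to the other components; once \<open>\<lambda>(\<xi>) |W|\<^sup>2\<close> itself is controlled, a
  Lyapunov functional gives the decay \<open>|W(\<xi>, t)|\<^sup>2 \<le> C exp (- c \<lambda>(\<xi>) t) |W(\<xi>, 0)|\<^sup>2\<close>. This works with
  \<open>\<lambda> = \<xi>\<^sup>4\<close> for small \<open>\<xi>\<close>, and for large \<open>\<xi>\<close> with \<open>\<lambda> = 1\<close> if the three wave speeds agree and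
  \<open>\<lambda> = \<xi>\<^sup>-\<^sup>4\<close> otherwise.

  To return to physical space, two inequalities are needed instead of the full Plancherel theorem:
  \<open>\<xi>\<^sup>m\<close> times the transform of \<open>U\<^sub>0\<close> is bounded in \<open>L\<^sup>2\<close> by the weak derivative (by mollification), and
  a function whose transform \<open>g\<close> has \<open>\<xi>\<^sup>j g\<close> in \<open>L\<^sup>2\<close> has a weak derivative bounded by it (by duality
  with test functions and completeness of \<open>L\<^sup>2\<close>).
\<close>

section \<open>Controlled quantities\<close>

text \<open>The small multiple of \<open>\<lambda> |W|^2\<close> is what lets the chain of estimates
  close: a cross term with a component not yet controlled is split by Young's inequality, and the
  uncontrolled half is charged to that multiple. If \<open>a^2 |l|^2\<close> is controlled and
  \<open>\<lambda> = \<mu>^2\<close>, a term \<open>c (l \<bullet> m)\<close> is harmless once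
  \<open>c = O(a \<mu>)\<close>. Most steps thus reduce to comparing powers of \<open>\<xi>\<close>,
  and frequency ranges are encoded as filters so that asymptotic reasoning settles them. The
  exponents come from the worst terms. At low frequency \<open>\<eta>\<close> meets \<open>v\<close>
  without a factor \<open>\<xi>\<close> when \<open>y\<close> is estimated, which costs
  \<open>\<xi>^4\<close>. At high frequency with different speeds, terms of order
  \<open>\<xi>\<close>, such as the one between \<open>v\<close> and \<open>\<phi>\<close>, no
  longer cancel, which costs \<open>\<xi>^-4\<close>. In between, frequencies fill a compact set
  away from 0, where the state is observable from \<open>\<eta>\<close> and
  \<open>\<lambda> = 1\<close>. The rates in time are square roots: the integral of
  \<open>\<xi>^(2j) exp(-c \<xi>^4 t)\<close> over low frequencies decays like
  \<open>t^(-(2j+1)/4)\<close>, and at high frequency \<open>2l\<close> powers of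
  \<open>|\<xi>|\<close> buy a factor \<open>(1+t)^(-l/2)\<close> for the squared norm.\<close>

lemma exhaust_7:
  fixes x :: 7
  shows "x = 1 \<or> x = 2 \<or> x = 3 \<or> x = 4 \<or> x = 5 \<or> x = 6 \<or> x = 7"
proof (induct x)
  case (of_int z)
  then have "0 \<le> z" and "z < 7" by simp_all
  then have "z = 0 \<or> z = 1 \<or> z = 2 \<or> z = 3 \<or> z = 4 \<or> z = 5 \<or> z = 6" by arith
  then show ?case by auto
qed

lemma sum_7: "sum f (UNIV::7 set) = f 1 + f 2 + f 3 + f 4 + f 5 + f 6 + f 7"
proof -
  have U: "(UNIV::7 set) = {1, 2, 3, 4, 5, 6, 7}"
    using exhaust_7 by auto
  show ?thesis unfolding U by (simp add: algebra_simps)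
qed

lemma norm_vec7: "(norm (w :: complex ^ 7))\<^sup>2 = w$1 \<bullet> w$1 + w$2 \<bullet> w$2 + w$3 \<bullet> w$3
    + w$4 \<bullet> w$4 + w$5 \<bullet> w$5 + w$6 \<bullet> w$6 + w$7 \<bullet> w$7"
  by (simp add: power2_norm_eq_inner inner_vec_def sum_7)

locale laminated =
  fixes k1 k2 k3 k4 \<gamma> :: real
  assumes k: "k1 > 0" "k2 > 0" "k3 > 0" "k4 > 0" "\<gamma> > 0"
begin

abbreviation ode :: "real \<Rightarrow> (real \<Rightarrow> complex ^ 7) \<Rightarrow> bool" where
  "ode \<equiv> laminated_ode k1 k2 k3 k4 \<gamma>"

text \<open>A relation between two functions of frequency and state, rather than a derivative of a
  trajectory: derivatives of multipliers can then be computed by rules alone, and the same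
  functional serves every solution. Only positive times are concerned, as in the differential
  equation.\<close>

definition der :: "(real \<Rightarrow> complex ^ 7 \<Rightarrow> 'b::real_normed_vector) \<Rightarrow> (real \<Rightarrow> complex ^ 7 \<Rightarrow> 'b) \<Rightarrow> bool" where
  "der F G \<longleftrightarrow> (\<forall>\<xi> W t. ode \<xi> W \<longrightarrow> t > 0 \<longrightarrow>
     ((\<lambda>s. F \<xi> (W s)) has_vector_derivative G \<xi> (W t)) (at t))"

lemma der_nth:
  "der (\<lambda>\<xi> w. w$1) (\<lambda>\<xi> w. (\<i>*\<xi>) * w$2 + w$4 + w$6)"
  "der (\<lambda>\<xi> w. w$2) (\<lambda>\<xi> w. k1 * ((\<i>*\<xi>) * w$1))"
  "der (\<lambda>\<xi> w. w$3) (\<lambda>\<xi> w. (\<i>*\<xi>) * w$4)"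
  "der (\<lambda>\<xi> w. w$4) (\<lambda>\<xi> w. k2 * ((\<i>*\<xi>) * w$3) - k1 * w$1 - \<gamma> * ((\<i>*\<xi>) * w$7))"
  "der (\<lambda>\<xi> w. w$5) (\<lambda>\<xi> w. (\<i>*\<xi>) * w$6)"
  "der (\<lambda>\<xi> w. w$6) (\<lambda>\<xi> w. k3 * ((\<i>*\<xi>) * w$5) - k1 * w$1)"
  "der (\<lambda>\<xi> w. w$7) (\<lambda>\<xi> w. k4 * ((\<i>*\<xi>)\<^sup>2 * w$7) - \<gamma> * ((\<i>*\<xi>) * w$4))"
  unfolding der_def laminated_ode_def Let_def by blast+

lemma der_add: "der F F' \<Longrightarrow> der G G' \<Longrightarrow> der (\<lambda>\<xi> w. F \<xi> w + G \<xi> w) (\<lambda>\<xi> w. F' \<xi> w + G' \<xi> w)"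
  unfolding der_def by (auto intro!: derivative_intros)

lemma der_diff: "der F F' \<Longrightarrow> der G G' \<Longrightarrow> der (\<lambda>\<xi> w. F \<xi> w - G \<xi> w) (\<lambda>\<xi> w. F' \<xi> w - G' \<xi> w)"
  unfolding der_def by (auto intro!: derivative_intros)

lemma der_cmult:
  fixes F :: "real \<Rightarrow> complex ^ 7 \<Rightarrow> 'b::real_normed_algebra"
  shows "der F F' \<Longrightarrow> der (\<lambda>\<xi> w. c \<xi> * F \<xi> w) (\<lambda>\<xi> w. c \<xi> * F' \<xi> w)"
  unfolding der_def by (auto intro!: derivative_intros)

lemma der_inner:
  fixes F G :: "real \<Rightarrow> complex ^ 7 \<Rightarrow> 'b::real_inner"
  shows "der F F' \<Longrightarrow> der G G' \<Longrightarrow>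
    der (\<lambda>\<xi> w. F \<xi> w \<bullet> G \<xi> w) (\<lambda>\<xi> w. F \<xi> w \<bullet> G' \<xi> w + F' \<xi> w \<bullet> G \<xi> w)"
  unfolding der_def has_vector_derivative_def
  by (intro allI impI, rule has_derivative_eq_rhs[OF has_derivative_inner], blast, blast)
     (auto simp: algebra_simps)

lemma der_eq: "der F G \<Longrightarrow> (\<And>\<xi> w. G \<xi> w = G' \<xi> w) \<Longrightarrow> der F G'"
  unfolding der_def by simp

lemmas der_intros = der_nth der_add der_diff der_cmult der_inner

text \<open>The terms on the right without a definite sign cancel or are absorbed when the
  multipliers are combined.\<close>

lemma der_multipliers:
  "der (\<lambda>\<xi> w. (\<i> * w$7) \<bullet> w$4)
    (\<lambda>\<xi> w. \<gamma> * \<xi> * (w$4 \<bullet> w$4) - k4 * \<xi>\<^sup>2 * ((\<i> * w$7) \<bullet> w$4) + k2 * \<xi> * (w$7 \<bullet> w$3)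
      - k1 * ((\<i> * w$7) \<bullet> w$1) - \<gamma> * \<xi> * (w$7 \<bullet> w$7))"
  "der (\<lambda>\<xi> w. (\<i> * w$4) \<bullet> w$3)
    (\<lambda>\<xi> w. - k2 * \<xi> * (w$3 \<bullet> w$3) - k1 * ((\<i> * w$1) \<bullet> w$3) + \<gamma> * \<xi> * (w$7 \<bullet> w$3) + \<xi> * (w$4 \<bullet> w$4))"
  "der (\<lambda>\<xi> w. w$1 \<bullet> w$4)
    (\<lambda>\<xi> w. \<xi> * ((\<i> * w$2) \<bullet> w$4) + w$4 \<bullet> w$4 + w$6 \<bullet> w$4 - k2 * \<xi> * ((\<i> * w$1) \<bullet> w$3)
      - k1 * (w$1 \<bullet> w$1) - \<gamma> * \<xi> * (w$1 \<bullet> (\<i> * w$7)))"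
  "der (\<lambda>\<xi> w. w$2 \<bullet> w$3) (\<lambda>\<xi> w. k1 * \<xi> * ((\<i> * w$1) \<bullet> w$3) - \<xi> * ((\<i> * w$2) \<bullet> w$4))"
  "der (\<lambda>\<xi> w. (\<i> * w$1) \<bullet> w$2)
    (\<lambda>\<xi> w. - \<xi> * (w$2 \<bullet> w$2) + (\<i> * w$4) \<bullet> w$2 + (\<i> * w$6) \<bullet> w$2 + k1 * \<xi> * (w$1 \<bullet> w$1))"
  "der (\<lambda>\<xi> w. w$1 \<bullet> w$6)
    (\<lambda>\<xi> w. \<xi> * ((\<i> * w$2) \<bullet> w$6) + w$4 \<bullet> w$6 + w$6 \<bullet> w$6 - k3 * \<xi> * ((\<i> * w$1) \<bullet> w$5)
      - k1 * (w$1 \<bullet> w$1))"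
  "der (\<lambda>\<xi> w. w$2 \<bullet> w$5) (\<lambda>\<xi> w. k1 * \<xi> * ((\<i> * w$1) \<bullet> w$5) - \<xi> * ((\<i> * w$2) \<bullet> w$6))"
  "der (\<lambda>\<xi> w. (\<i> * w$6) \<bullet> w$5)
    (\<lambda>\<xi> w. - k3 * \<xi> * (w$5 \<bullet> w$5) - k1 * ((\<i> * w$1) \<bullet> w$5) + \<xi> * (w$6 \<bullet> w$6))"
  by (rule der_eq, (rule der_intros)+, simp add: inner_complex_def power2_eq_square algebra_simps)+

text \<open>The weights \<open>k1\<close>, \<open>k2\<close>, \<open>k3\<close> symmetrise the
  system: the coupling terms become skew and drop out of the derivative, which leaves only heat
  dissipation.\<close>

definition energy :: "complex ^ 7 \<Rightarrow> real" where
  "energy w = k1 * (w$1 \<bullet> w$1) + w$2 \<bullet> w$2 + k2 * (w$3 \<bullet> w$3) + w$4 \<bullet> w$4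
    + k3 * (w$5 \<bullet> w$5) + w$6 \<bullet> w$6 + w$7 \<bullet> w$7"

lemma der_energy: "der (\<lambda>\<xi> w. energy w) (\<lambda>\<xi> w. - 2 * k4 * \<xi>\<^sup>2 * (w$7 \<bullet> w$7))"
  unfolding energy_def
  by (rule der_eq, (rule der_intros)+, simp add: inner_complex_def power2_eq_square algebra_simps)

lemma energy_bounds:
  obtains m M where "m > 0" "M > 0" "\<And>w. m * (norm w)\<^sup>2 \<le> energy w" "\<And>w. energy w \<le> M * (norm w)\<^sup>2"
proof
  let ?m = "min (min k1 k2) (min k3 1)" and ?M = "max (max k1 k2) (max k3 1)"
  show "?m > 0" "?M > 0" using k by auto
  have m: "?m \<le> k1" "?m \<le> k2" "?m \<le> k3" "?m \<le> 1" "k1 \<le> ?M" "k2 \<le> ?M" "k3 \<le> ?M" "1 \<le> ?M"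
    by auto
  have E: "energy w = k1 * (w$1 \<bullet> w$1) + 1 * (w$2 \<bullet> w$2) + k2 * (w$3 \<bullet> w$3) + 1 * (w$4 \<bullet> w$4)
    + k3 * (w$5 \<bullet> w$5) + 1 * (w$6 \<bullet> w$6) + 1 * (w$7 \<bullet> w$7)" for w
    by (simp add: energy_def)
  show "?m * (norm w)\<^sup>2 \<le> energy w" for w
    unfolding norm_vec7 E distrib_left by (intro add_mono mult_right_mono m inner_ge_zero)
  show "energy w \<le> ?M * (norm w)\<^sup>2" for w
    unfolding norm_vec7 E distrib_left by (intro add_mono mult_right_mono m inner_ge_zero)
qed

text \<open>The filter \<open>Fl\<close> selects the frequency range, and \<open>\<lambda> = \<mu>\<^sup>2\<close>; below, \<open>good Fl \<mu> a l\<close> means that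
  \<open>a\<^sup>2 |l|\<^sup>2\<close> is controlled.\<close>

definition ctrl :: "real filter \<Rightarrow> (real \<Rightarrow> real) \<Rightarrow> (real \<Rightarrow> complex ^ 7 \<Rightarrow> real) \<Rightarrow> bool" where
  "ctrl Fl \<mu> X \<longleftrightarrow> (\<forall>\<epsilon>>0. \<exists>C F G. der F G \<and> (\<forall>\<^sub>F \<xi> in Fl. \<forall>w. \<bar>F \<xi> w\<bar> \<le> C * (norm w)\<^sup>2 \<and>
     X \<xi> w \<le> G \<xi> w + C * \<xi>\<^sup>2 * (w$7 \<bullet> w$7) + \<epsilon> * (\<mu> \<xi> * norm w)\<^sup>2))"

definition good :: "real filter \<Rightarrow> (real \<Rightarrow> real) \<Rightarrow> (real \<Rightarrow> real) \<Rightarrow> (real \<Rightarrow> complex ^ 7 \<Rightarrow> complex) \<Rightarrow> bool" where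
  "good Fl \<mu> a l \<longleftrightarrow> ctrl Fl \<mu> (\<lambda>\<xi> w. (a \<xi>)\<^sup>2 * (l \<xi> w \<bullet> l \<xi> w))"

definition bd :: "real filter \<Rightarrow> (real \<Rightarrow> complex ^ 7 \<Rightarrow> complex) \<Rightarrow> bool" where
  "bd Fl l \<longleftrightarrow> (\<exists>M. \<forall>\<^sub>F \<xi> in Fl. \<forall>w. norm (l \<xi> w) \<le> M * norm w)"

definition qbd :: "real filter \<Rightarrow> (real \<Rightarrow> complex ^ 7 \<Rightarrow> real) \<Rightarrow> bool" where
  "qbd Fl F \<longleftrightarrow> (\<exists>M. \<forall>\<^sub>F \<xi> in Fl. \<forall>w. \<bar>F \<xi> w\<bar> \<le> M * (norm w)\<^sup>2)"

text \<open>Half of the admissible error pays for the explicit \<open>\<delta>\<close>-term and half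
  for the error already present. This is the place where leftovers of Young's inequality
  disappear.\<close>

lemma ctrl_limit:
  assumes "\<And>\<delta>. \<delta> > 0 \<Longrightarrow> ctrl Fl \<mu> (\<lambda>\<xi> w. X \<xi> w - \<delta> * (\<mu> \<xi> * norm w)\<^sup>2)"
  shows "ctrl Fl \<mu> X"
  unfolding ctrl_def
proof (intro allI impI)
  fix \<epsilon> :: real assume "\<epsilon> > 0"
  then have e: "\<epsilon>/2 > 0" by simp
  obtain C F G where "der F G" "(\<forall>\<^sub>F \<xi> in Fl. \<forall>w. \<bar>F \<xi> w\<bar> \<le> C * (norm w)\<^sup>2 \<and>
     X \<xi> w - \<epsilon>/2 * (\<mu> \<xi> * norm w)\<^sup>2 \<le> G \<xi> w + C * \<xi>\<^sup>2 * (w$7 \<bullet> w$7) + \<epsilon>/2 * (\<mu> \<xi> * norm w)\<^sup>2)"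
    using assms[OF e] e unfolding ctrl_def by blast
  then show "\<exists>C F G. der F G \<and> (\<forall>\<^sub>F \<xi> in Fl. \<forall>w. \<bar>F \<xi> w\<bar> \<le> C * (norm w)\<^sup>2 \<and>
     X \<xi> w \<le> G \<xi> w + C * \<xi>\<^sup>2 * (w$7 \<bullet> w$7) + \<epsilon> * (\<mu> \<xi> * norm w)\<^sup>2)"
    by (intro exI[of _ C] exI[of _ F] exI[of _ G] conjI) (auto elim!: eventually_mono simp: algebra_simps)
qed

lemma ctrl_mono:
  assumes "ctrl Fl \<mu> Y" "\<forall>\<^sub>F \<xi> in Fl. \<forall>w. X \<xi> w \<le> Y \<xi> w"
  shows "ctrl Fl \<mu> X"
  unfolding ctrl_def
proof (intro allI impI)
  fix \<epsilon> :: real assume "\<epsilon> > 0"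
  then obtain C F G where 1: "der F G" "(\<forall>\<^sub>F \<xi> in Fl. \<forall>w. \<bar>F \<xi> w\<bar> \<le> C * (norm w)\<^sup>2 \<and>
     Y \<xi> w \<le> G \<xi> w + C * \<xi>\<^sup>2 * (w$7 \<bullet> w$7) + \<epsilon> * (\<mu> \<xi> * norm w)\<^sup>2)"
    using assms(1) unfolding ctrl_def by meson
  show "\<exists>C F G. der F G \<and> (\<forall>\<^sub>F \<xi> in Fl. \<forall>w. \<bar>F \<xi> w\<bar> \<le> C * (norm w)\<^sup>2 \<and>
     X \<xi> w \<le> G \<xi> w + C * \<xi>\<^sup>2 * (w$7 \<bullet> w$7) + \<epsilon> * (\<mu> \<xi> * norm w)\<^sup>2)"
    using 1(1) eventually_conj[OF 1(2) assms(2)]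
    by (intro exI[of _ C] exI[of _ F] exI[of _ G] conjI) (auto elim!: eventually_mono dest!: spec intro: order.trans[of "X _ _" "Y _ _"])
qed

lemma ctrl_add:
  assumes "ctrl Fl \<mu> X" "ctrl Fl \<mu> Y"
  shows "ctrl Fl \<mu> (\<lambda>\<xi> w. X \<xi> w + Y \<xi> w)"
  unfolding ctrl_def
proof (intro allI impI)
  fix \<epsilon> :: real assume "\<epsilon> > 0"
  then have e: "\<epsilon>/2 > 0" by simp
  obtain C F G where 1: "der F G" "(\<forall>\<^sub>F \<xi> in Fl. \<forall>w. \<bar>F \<xi> w\<bar> \<le> C * (norm w)\<^sup>2 \<and>
     X \<xi> w \<le> G \<xi> w + C * \<xi>\<^sup>2 * (w$7 \<bullet> w$7) + \<epsilon>/2 * (\<mu> \<xi> * norm w)\<^sup>2)"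
    using assms(1) e unfolding ctrl_def by meson
  obtain C' F' G' where 2: "der F' G'" "(\<forall>\<^sub>F \<xi> in Fl. \<forall>w. \<bar>F' \<xi> w\<bar> \<le> C' * (norm w)\<^sup>2 \<and>
     Y \<xi> w \<le> G' \<xi> w + C' * \<xi>\<^sup>2 * (w$7 \<bullet> w$7) + \<epsilon>/2 * (\<mu> \<xi> * norm w)\<^sup>2)"
    using assms(2) e unfolding ctrl_def by meson
  show "\<exists>C F G. der F G \<and> (\<forall>\<^sub>F \<xi> in Fl. \<forall>w. \<bar>F \<xi> w\<bar> \<le> C * (norm w)\<^sup>2 \<and>
     X \<xi> w + Y \<xi> w \<le> G \<xi> w + C * \<xi>\<^sup>2 * (w$7 \<bullet> w$7) + \<epsilon> * (\<mu> \<xi> * norm w)\<^sup>2)"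
  proof (intro exI conjI)
    show "der (\<lambda>\<xi> w. F \<xi> w + F' \<xi> w) (\<lambda>\<xi> w. G \<xi> w + G' \<xi> w)" by (intro der_add 1 2)
    show "\<forall>\<^sub>F \<xi> in Fl. \<forall>w. \<bar>F \<xi> w + F' \<xi> w\<bar> \<le> (C + C') * (norm w)\<^sup>2 \<and>
       X \<xi> w + Y \<xi> w \<le> G \<xi> w + G' \<xi> w + (C + C') * \<xi>\<^sup>2 * (w$7 \<bullet> w$7) + \<epsilon> * (\<mu> \<xi> * norm w)\<^sup>2"
      using eventually_conj[OF 1(2) 2(2)]
    proof eventually_elim
      case (elim \<xi>)
      show ?case
      proof
        fix w
        have "\<bar>F \<xi> w\<bar> \<le> C * (norm w)\<^sup>2" "\<bar>F' \<xi> w\<bar> \<le> C' * (norm w)\<^sup>2"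
         "X \<xi> w \<le> G \<xi> w + C * \<xi>\<^sup>2 * (w$7 \<bullet> w$7) + \<epsilon>/2 * (\<mu> \<xi> * norm w)\<^sup>2"
         "Y \<xi> w \<le> G' \<xi> w + C' * \<xi>\<^sup>2 * (w$7 \<bullet> w$7) + \<epsilon>/2 * (\<mu> \<xi> * norm w)\<^sup>2"
          using elim by auto
        then show "\<bar>F \<xi> w + F' \<xi> w\<bar> \<le> (C + C') * (norm w)\<^sup>2 \<and>
       X \<xi> w + Y \<xi> w \<le> G \<xi> w + G' \<xi> w + (C + C') * \<xi>\<^sup>2 * (w$7 \<bullet> w$7) + \<epsilon> * (\<mu> \<xi> * norm w)\<^sup>2"
          by (auto simp: algebra_simps)
      qed
    qed
  qed
qed

lemma ctrl_der:
  assumes "der F G" "qbd Fl F"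
  shows "ctrl Fl \<mu> G"
  unfolding ctrl_def
proof (intro allI impI)
  fix \<epsilon> :: real assume e: "\<epsilon> > 0"
  obtain M where M: "\<forall>\<^sub>F \<xi> in Fl. \<forall>w. \<bar>F \<xi> w\<bar> \<le> M * (norm w)\<^sup>2" using assms(2) unfolding qbd_def by blast
  show "\<exists>C F Ga. der F Ga \<and> (\<forall>\<^sub>F \<xi> in Fl. \<forall>w. \<bar>F \<xi> w\<bar> \<le> C * (norm w)\<^sup>2 \<and>
     G \<xi> w \<le> Ga \<xi> w + C * \<xi>\<^sup>2 * (w$7 \<bullet> w$7) + \<epsilon> * (\<mu> \<xi> * norm w)\<^sup>2)"
  proof (intro exI conjI)
    show "der F G" by fact
    \<comment> \<open>One constant bounds the functional and also multiplies the dissipation, so it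
      must be non-negative; hence \<open>max M 0\<close>.\<close>
    show "\<forall>\<^sub>F \<xi> in Fl. \<forall>w. \<bar>F \<xi> w\<bar> \<le> max M 0 * (norm w)\<^sup>2 \<and>
     G \<xi> w \<le> G \<xi> w + max M 0 * \<xi>\<^sup>2 * (w$7 \<bullet> w$7) + \<epsilon> * (\<mu> \<xi> * norm w)\<^sup>2"
      using M
    proof eventually_elim
      case (elim \<xi>)
      have "M * (norm w)\<^sup>2 \<le> max M 0 * (norm w)\<^sup>2" for w :: "complex ^ 7"
        by (intro mult_right_mono) auto
      with elim show ?case using e by (smt (verit) inner_ge_zero mult_nonneg_nonneg zero_le_power2)
    qed
  qed
qed

lemma ctrl_small:
  assumes "\<And>\<epsilon>. \<epsilon> > 0 \<Longrightarrow> \<forall>\<^sub>F \<xi> in Fl. \<forall>w. X \<xi> w \<le> \<epsilon> * (\<mu> \<xi> * norm w)\<^sup>2"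
  shows "ctrl Fl \<mu> X"
  unfolding ctrl_def
proof (intro allI impI)
  fix \<epsilon> :: real assume e: "\<epsilon> > 0"
  have "der (\<lambda>\<xi> w. 0::real) (\<lambda>\<xi> w. 0)" by (auto simp: der_def)
  then show "\<exists>C F G. der F G \<and> (\<forall>\<^sub>F \<xi> in Fl. \<forall>w. \<bar>F \<xi> w\<bar> \<le> C * (norm w)\<^sup>2 \<and>
     X \<xi> w \<le> G \<xi> w + C * \<xi>\<^sup>2 * (w$7 \<bullet> w$7) + \<epsilon> * (\<mu> \<xi> * norm w)\<^sup>2)"
    using assms[OF e] by (intro exI[of _ 0] exI[of _ "\<lambda>\<xi> w. 0"]) auto
qed

lemma ctrl_0: "ctrl Fl \<mu> (\<lambda>\<xi> w. 0)"
  by (rule ctrl_small) simp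

lemma ctrl_cmult:
  assumes "ctrl Fl \<mu> X" "c \<ge> 0"
  shows "ctrl Fl \<mu> (\<lambda>\<xi> w. c * X \<xi> w)"
proof (cases "c = 0")
  case True then show ?thesis by (simp add: ctrl_0)
next
  case False
  then have c: "c > 0" using assms by simp
  show ?thesis unfolding ctrl_def
  proof (intro allI impI)
    fix \<epsilon> :: real assume "\<epsilon> > 0"
    then have e: "\<epsilon> / c > 0" using c by simp
    obtain C F G where 1: "der F G" "(\<forall>\<^sub>F \<xi> in Fl. \<forall>w. \<bar>F \<xi> w\<bar> \<le> C * (norm w)\<^sup>2 \<and>
       X \<xi> w \<le> G \<xi> w + C * \<xi>\<^sup>2 * (w$7 \<bullet> w$7) + \<epsilon>/c * (\<mu> \<xi> * norm w)\<^sup>2)"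
      using assms(1) e unfolding ctrl_def by meson
    show "\<exists>C F G. der F G \<and> (\<forall>\<^sub>F \<xi> in Fl. \<forall>w. \<bar>F \<xi> w\<bar> \<le> C * (norm w)\<^sup>2 \<and>
       c * X \<xi> w \<le> G \<xi> w + C * \<xi>\<^sup>2 * (w$7 \<bullet> w$7) + \<epsilon> * (\<mu> \<xi> * norm w)\<^sup>2)"
    proof (intro exI conjI)
      show "der (\<lambda>\<xi> w. c * F \<xi> w) (\<lambda>\<xi> w. c * G \<xi> w)" by (intro der_cmult 1)
      show "\<forall>\<^sub>F \<xi> in Fl. \<forall>w. \<bar>c * F \<xi> w\<bar> \<le> (c * C) * (norm w)\<^sup>2 \<and>
         c * X \<xi> w \<le> c * G \<xi> w + c * C * \<xi>\<^sup>2 * (w$7 \<bullet> w$7) + \<epsilon> * (\<mu> \<xi> * norm w)\<^sup>2"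
        using 1(2)
      proof eventually_elim
        case (elim \<xi>)
        show ?case
        proof
          fix w
          have "\<bar>F \<xi> w\<bar> \<le> C * (norm w)\<^sup>2"
           "X \<xi> w \<le> G \<xi> w + C * \<xi>\<^sup>2 * (w$7 \<bullet> w$7) + \<epsilon>/c * (\<mu> \<xi> * norm w)\<^sup>2"
            using elim by auto
          then have "c * \<bar>F \<xi> w\<bar> \<le> c * (C * (norm w)\<^sup>2)"
            "c * X \<xi> w \<le> c * (G \<xi> w + C * \<xi>\<^sup>2 * (w$7 \<bullet> w$7) + \<epsilon>/c * (\<mu> \<xi> * norm w)\<^sup>2)"
            using c by (auto intro: mult_left_mono)
          then show "\<bar>c * F \<xi> w\<bar> \<le> (c * C) * (norm w)\<^sup>2 \<and>
         c * X \<xi> w \<le> c * G \<xi> w + c * C * \<xi>\<^sup>2 * (w$7 \<bullet> w$7) + \<epsilon> * (\<mu> \<xi> * norm w)\<^sup>2"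
            using c by (auto simp: abs_mult algebra_simps)
        qed
      qed
    qed
  qed
qed

text \<open>Completing the square gives
  \<open>C |A| |B| \<le> C^2/(4\<delta>) A^2 + \<delta> B^2\<close> for
  \<open>B = \<mu> |w|\<close>. The first summand is controlled by assumption, the second is
  absorbed because \<open>\<delta>\<close> is arbitrary.\<close>

lemma ctrl_sq_prod:
  assumes A: "ctrl Fl \<mu> (\<lambda>\<xi> w. (A \<xi> w)\<^sup>2)"
    and Z: "\<forall>\<^sub>F \<xi> in Fl. \<forall>w. Z \<xi> w \<le> C * \<bar>A \<xi> w\<bar> * \<bar>\<mu> \<xi> * norm w\<bar>"
  shows "ctrl Fl \<mu> Z"
proof (rule ctrl_limit)
  fix \<delta> :: real assume d: "\<delta> > 0"
  show "ctrl Fl \<mu> (\<lambda>\<xi> w. Z \<xi> w - \<delta> * (\<mu> \<xi> * norm w)\<^sup>2)"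
  proof (rule ctrl_mono[OF ctrl_cmult[OF A]])
    show "0 \<le> C\<^sup>2 / (4 * \<delta>)" using d by simp
    show "\<forall>\<^sub>F \<xi> in Fl. \<forall>w. Z \<xi> w - \<delta> * (\<mu> \<xi> * norm w)\<^sup>2 \<le> C\<^sup>2 / (4 * \<delta>) * (A \<xi> w)\<^sup>2"
      using Z
    proof eventually_elim
      case (elim \<xi>)
      show ?case
      proof
        fix w
        have "0 \<le> \<delta> * (C / (2 * \<delta>) * \<bar>A \<xi> w\<bar> - \<bar>\<mu> \<xi> * norm w\<bar>)\<^sup>2" using d by simp
        also have "\<dots> = C\<^sup>2 / (4 * \<delta>) * (A \<xi> w)\<^sup>2 - C * \<bar>A \<xi> w\<bar> * \<bar>\<mu> \<xi> * norm w\<bar> + \<delta> * (\<mu> \<xi> * norm w)\<^sup>2"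
          using d by (simp add: power2_diff power_mult_distrib power_divide) (simp add: field_simps power2_eq_square)
        finally show "Z \<xi> w - \<delta> * (\<mu> \<xi> * norm w)\<^sup>2 \<le> C\<^sup>2 / (4 * \<delta>) * (A \<xi> w)\<^sup>2" using elim[rule_format, of w] by linarith
      qed
    qed
  qed
qed

section \<open>Sizes of linear forms and of their products\<close>

lemma bd_nth: "bd Fl (\<lambda>\<xi> w. w $ i)"
  unfolding bd_def by (rule exI[of _ 1]) (auto intro!: always_eventually Finite_Cartesian_Product.norm_nth_le)

lemma bd_cmult:
  assumes "bd Fl l" "(\<lambda>\<xi>. norm (c \<xi>)) \<in> O[Fl](\<lambda>_. 1)"
  shows "bd Fl (\<lambda>\<xi> w. c \<xi> * l \<xi> w)"
proof -
  obtain M where M: "\<forall>\<^sub>F \<xi> in Fl. \<forall>w. norm (l \<xi> w) \<le> M * norm w" using assms unfolding bd_def by blast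
  obtain B where B: "B > 0" "\<forall>\<^sub>F \<xi> in Fl. norm (norm (c \<xi>)) \<le> B * norm (1::real)" using landau_o.bigE[OF assms(2)] by blast
  show ?thesis unfolding bd_def
  proof (rule exI[of _ "B * M"])
    show "\<forall>\<^sub>F \<xi> in Fl. \<forall>w. norm (c \<xi> * l \<xi> w) \<le> B * M * norm w"
      using eventually_conj[OF M B(2)]
    proof eventually_elim
      case (elim \<xi>)
      then show ?case using B(1)
        by (auto simp: norm_mult mult.assoc intro!: mult_mono)
    qed
  qed
qed

lemma bd_add:
  assumes "bd Fl l" "bd Fl m"
  shows "bd Fl (\<lambda>\<xi> w. l \<xi> w + m \<xi> w)"
proof -
  obtain M where M: "\<forall>\<^sub>F \<xi> in Fl. \<forall>w. norm (l \<xi> w) \<le> M * norm w" using assms unfolding bd_def by blast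
  obtain N where N: "\<forall>\<^sub>F \<xi> in Fl. \<forall>w. norm (m \<xi> w) \<le> N * norm w" using assms unfolding bd_def by blast
  show ?thesis unfolding bd_def
    using eventually_conj[OF M N]
    by (intro exI[of _ "M + N"]) (auto elim!: eventually_mono simp: distrib_right intro!: norm_triangle_le add_mono)
qed

lemma bd_diff:
  assumes "bd Fl l" "bd Fl m"
  shows "bd Fl (\<lambda>\<xi> w. l \<xi> w - m \<xi> w)"
  using bd_add[OF assms(1) bd_cmult[OF assms(2), of "\<lambda>_. -1"]] by simp

lemma inner_bound: "a \<bullet> b \<le> norm a * norm b" "\<bar>a \<bullet> b\<bar> \<le> norm a * norm b" for a b :: complex
  by (auto simp: norm_cauchy_schwarz Cauchy_Schwarz_ineq2)

lemma qbd_inner: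
  assumes "bd Fl l" "bd Fl m" "c \<in> O[Fl](\<lambda>_. 1)"
  shows "qbd Fl (\<lambda>\<xi> w. c \<xi> * (l \<xi> w \<bullet> m \<xi> w))"
proof -
  obtain M where M: "\<forall>\<^sub>F \<xi> in Fl. \<forall>w. norm (l \<xi> w) \<le> M * norm w" using assms unfolding bd_def by blast
  obtain N where N: "\<forall>\<^sub>F \<xi> in Fl. \<forall>w. norm (m \<xi> w) \<le> N * norm w" using assms unfolding bd_def by blast
  obtain B where B: "B > 0" "\<forall>\<^sub>F \<xi> in Fl. norm (c \<xi>) \<le> B * norm (1::real)" using landau_o.bigE[OF assms(3)] by blast
  show ?thesis unfolding qbd_def
  proof (rule exI[of _ "B * M * N"])
    show "\<forall>\<^sub>F \<xi> in Fl. \<forall>w. \<bar>c \<xi> * (l \<xi> w \<bullet> m \<xi> w)\<bar> \<le> B * M * N * (norm w)\<^sup>2"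
      using eventually_conj[OF eventually_conj[OF M N] B(2)]
    proof eventually_elim
      case (elim \<xi>)
      show ?case
      proof
        fix w
        have "\<bar>l \<xi> w \<bullet> m \<xi> w\<bar> \<le> norm (l \<xi> w) * norm (m \<xi> w)" by (rule inner_bound)
        also have "\<dots> \<le> (M * norm w) * (N * norm w)"
          using elim by (intro mult_mono) (auto intro: order_trans[OF norm_ge_zero])
        finally have "\<bar>c \<xi>\<bar> * \<bar>l \<xi> w \<bullet> m \<xi> w\<bar> \<le> B * ((M * norm w) * (N * norm w))"
          using elim B(1) by (intro mult_mono) auto
        then show "\<bar>c \<xi> * (l \<xi> w \<bullet> m \<xi> w)\<bar> \<le> B * M * N * (norm w)\<^sup>2"
          by (simp add: abs_mult power2_eq_square algebra_simps)
      qed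
    qed
  qed
qed

lemma qbd_add: "qbd Fl F \<Longrightarrow> qbd Fl G \<Longrightarrow> qbd Fl (\<lambda>\<xi> w. F \<xi> w + G \<xi> w)"
  unfolding qbd_def
proof (elim exE)
  fix M N assume M: "\<forall>\<^sub>F \<xi> in Fl. \<forall>w. \<bar>F \<xi> w\<bar> \<le> M * (norm w)\<^sup>2"
    and N: "\<forall>\<^sub>F \<xi> in Fl. \<forall>w. \<bar>G \<xi> w\<bar> \<le> N * (norm w)\<^sup>2"
  show "\<exists>M. \<forall>\<^sub>F \<xi> in Fl. \<forall>w. \<bar>F \<xi> w + G \<xi> w\<bar> \<le> M * (norm w)\<^sup>2"
  proof (intro exI)
    show "\<forall>\<^sub>F \<xi> in Fl. \<forall>w. \<bar>F \<xi> w + G \<xi> w\<bar> \<le> (M + N) * (norm w)\<^sup>2"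
      using M N
    proof eventually_elim
      case (elim \<xi>)
      then show ?case unfolding distrib_right by (blast intro: order_trans[OF abs_triangle_ineq] add_mono)
    qed
  qed
qed

text \<open>The basic absorption rule: \<open>c (l \<bullet> m)\<close> is at most a multiple of the
  product of \<open>a |l|\<close>, whose square is controlled, and \<open>\<mu> |w|\<close>, whose
  square is the reference quantity. Nothing is asked of \<open>m\<close> beyond boundedness, so it
  may be a component about which nothing is known yet.\<close>

lemma ctrl_inner:
  assumes g: "good Fl \<mu> a l" and m: "bd Fl m" and c: "c \<in> O[Fl](\<lambda>\<xi>. a \<xi> * \<mu> \<xi>)"
  shows "ctrl Fl \<mu> (\<lambda>\<xi> w. c \<xi> * (l \<xi> w \<bullet> m \<xi> w))"
    and "ctrl Fl \<mu> (\<lambda>\<xi> w. c \<xi> * (m \<xi> w \<bullet> l \<xi> w))"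
proof -
  obtain M where M: "\<forall>\<^sub>F \<xi> in Fl. \<forall>w. norm (m \<xi> w) \<le> M * norm w" using m unfolding bd_def by blast
  obtain B where B: "B > 0" "\<forall>\<^sub>F \<xi> in Fl. norm (c \<xi>) \<le> B * norm (a \<xi> * \<mu> \<xi>)" using landau_o.bigE[OF c] by blast
  show "ctrl Fl \<mu> (\<lambda>\<xi> w. c \<xi> * (l \<xi> w \<bullet> m \<xi> w))"
  proof (rule ctrl_sq_prod[of _ _ "\<lambda>\<xi> w. a \<xi> * norm (l \<xi> w)" _ "B * M"])
    show "ctrl Fl \<mu> (\<lambda>\<xi> w. (a \<xi> * norm (l \<xi> w))\<^sup>2)"
      using g unfolding good_def by (simp add: power_mult_distrib power2_norm_eq_inner)
    show "\<forall>\<^sub>F \<xi> in Fl. \<forall>w. c \<xi> * (l \<xi> w \<bullet> m \<xi> w) \<le> B * M * \<bar>a \<xi> * norm (l \<xi> w)\<bar> * \<bar>\<mu> \<xi> * norm w\<bar>"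
      using M B(2)
    proof eventually_elim
      case (elim \<xi>)
      show ?case
      proof
        fix w
        have "c \<xi> * (l \<xi> w \<bullet> m \<xi> w) \<le> \<bar>c \<xi>\<bar> * \<bar>l \<xi> w \<bullet> m \<xi> w\<bar>"
          by (metis abs_ge_self abs_mult)
        also have "\<bar>l \<xi> w \<bullet> m \<xi> w\<bar> \<le> norm (l \<xi> w) * norm (m \<xi> w)" by (rule inner_bound)
        also have "\<dots> \<le> norm (l \<xi> w) * (M * norm w)"
          using elim by (intro mult_left_mono) auto
        finally have "c \<xi> * (l \<xi> w \<bullet> m \<xi> w) \<le> \<bar>c \<xi>\<bar> * (norm (l \<xi> w) * (M * norm w))"
          by (simp add: mult_left_mono)
        also have "\<dots> \<le> (B * norm (a \<xi> * \<mu> \<xi>)) * (norm (l \<xi> w) * (M * norm w))"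
          using elim order_trans[OF norm_ge_zero elim(1)[rule_format, of w]]
          by (intro mult_right_mono mult_nonneg_nonneg[OF norm_ge_zero]) auto
        finally show "c \<xi> * (l \<xi> w \<bullet> m \<xi> w) \<le> B * M * \<bar>a \<xi> * norm (l \<xi> w)\<bar> * \<bar>\<mu> \<xi> * norm w\<bar>"
          by (simp add: abs_mult mult_ac)
      qed
    qed
  qed
  then show "ctrl Fl \<mu> (\<lambda>\<xi> w. c \<xi> * (m \<xi> w \<bullet> l \<xi> w))" by (simp add: inner_commute)
qed

text \<open>Handles products of two components neither of which is controlled: a coefficient of
  lower order than \<open>\<mu>^2\<close> needs no functional at all.\<close>

lemma ctrl_inner_small:
  assumes "bd Fl l" "bd Fl m" "c \<in> o[Fl](\<lambda>\<xi>. (\<mu> \<xi>)\<^sup>2)"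
  shows "ctrl Fl \<mu> (\<lambda>\<xi> w. c \<xi> * (l \<xi> w \<bullet> m \<xi> w))"
proof (rule ctrl_small)
  fix \<epsilon> :: real assume e: "\<epsilon> > 0"
  obtain M where M: "\<forall>\<^sub>F \<xi> in Fl. \<forall>w. norm (l \<xi> w) \<le> M * norm w" using assms unfolding bd_def by blast
  obtain N where N: "\<forall>\<^sub>F \<xi> in Fl. \<forall>w. norm (m \<xi> w) \<le> N * norm w" using assms unfolding bd_def by blast
  define B where "B = \<bar>M\<bar> * \<bar>N\<bar> + 1"
  have B: "B > 0" unfolding B_def by (simp add: add_nonneg_pos)
  have "\<forall>\<^sub>F \<xi> in Fl. norm (c \<xi>) \<le> (\<epsilon> / B) * norm ((\<mu> \<xi>)\<^sup>2)"
    by (rule landau_o.smallD[OF assms(3)]) (use e B in simp)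
  then show "\<forall>\<^sub>F \<xi> in Fl. \<forall>w. c \<xi> * (l \<xi> w \<bullet> m \<xi> w) \<le> \<epsilon> * (\<mu> \<xi> * norm w)\<^sup>2"
    using M N
  proof eventually_elim
    case (elim \<xi>)
    show ?case
    proof
      fix w
      have "\<bar>l \<xi> w \<bullet> m \<xi> w\<bar> \<le> norm (l \<xi> w) * norm (m \<xi> w)" by (rule inner_bound)
      also have "\<dots> \<le> (M * norm w) * (N * norm w)"
        using elim by (intro mult_mono) (auto intro: order_trans[OF norm_ge_zero])
      also have "\<dots> = M * N * (norm w)\<^sup>2" by (simp add: power2_eq_square)
      also have "\<dots> \<le> B * (norm w)\<^sup>2" unfolding B_def
        using abs_ge_self[of "M * N"]
        by (intro mult_right_mono) (simp_all add: abs_mult)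
      finally have "\<bar>l \<xi> w \<bullet> m \<xi> w\<bar> \<le> B * (norm w)\<^sup>2" .
      then have "\<bar>c \<xi>\<bar> * \<bar>l \<xi> w \<bullet> m \<xi> w\<bar> \<le> (\<epsilon> / B * (\<mu> \<xi>)\<^sup>2) * (B * (norm w)\<^sup>2)"
        using elim B e by (intro mult_mono) auto
      also have "\<dots> = \<epsilon> * (\<mu> \<xi> * norm w)\<^sup>2" using B by (simp add: power_mult_distrib)
      finally show "c \<xi> * (l \<xi> w \<bullet> m \<xi> w) \<le> \<epsilon> * (\<mu> \<xi> * norm w)\<^sup>2"
        by (metis abs_ge_self abs_mult order_trans)
    qed
  qed
qed

text \<open>The starting point of every chain: this quantity is the dissipation itself, so the zero
  functional with constant 1 suffices.\<close>

lemma good_7: "good Fl \<mu> (\<lambda>\<xi>. \<xi>) (\<lambda>\<xi> w. w$7)"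
  unfolding good_def ctrl_def
proof (intro allI impI)
  fix \<epsilon> :: real assume e: "\<epsilon> > 0"
  have "der (\<lambda>\<xi> w. 0::real) (\<lambda>\<xi> w. 0)" by (auto simp: der_def)
  then show "\<exists>C F G. der F G \<and> (\<forall>\<^sub>F \<xi> in Fl. \<forall>w. \<bar>F \<xi> w\<bar> \<le> C * (norm w)\<^sup>2 \<and>
     \<xi>\<^sup>2 * (w$7 \<bullet> w$7) \<le> G \<xi> w + C * \<xi>\<^sup>2 * (w$7 \<bullet> w$7) + \<epsilon> * (\<mu> \<xi> * norm w)\<^sup>2)"
    using e by (intro exI[of _ 1] exI[of _ "\<lambda>\<xi> w. 0"]) auto
qed

lemma good_cmult:
  assumes g: "good Fl \<mu> a l" and c: "(\<lambda>\<xi>. b \<xi> * norm (c \<xi>)) \<in> O[Fl](a)"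
  shows "good Fl \<mu> b (\<lambda>\<xi> w. c \<xi> * l \<xi> w)"
proof -
  obtain B where B: "B > 0" "\<forall>\<^sub>F \<xi> in Fl. norm (b \<xi> * norm (c \<xi>)) \<le> B * norm (a \<xi>)" using landau_o.bigE[OF c] by blast
  show ?thesis unfolding good_def
  proof (rule ctrl_mono[OF ctrl_cmult[OF g[unfolded good_def], of "B\<^sup>2"]])
    show "\<forall>\<^sub>F \<xi> in Fl. \<forall>w. (b \<xi>)\<^sup>2 * ((c \<xi> * l \<xi> w) \<bullet> (c \<xi> * l \<xi> w)) \<le> B\<^sup>2 * ((a \<xi>)\<^sup>2 * (l \<xi> w \<bullet> l \<xi> w))"
      using B(2)
    proof eventually_elim
      case (elim \<xi>)
      show ?case
      proof
        fix w
        have "(\<bar>b \<xi>\<bar> * norm (c \<xi>))\<^sup>2 \<le> (B * \<bar>a \<xi>\<bar>)\<^sup>2" using elim by (intro power_mono) (auto simp: abs_mult)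
        then have "(b \<xi>)\<^sup>2 * (norm (c \<xi>))\<^sup>2 * (norm (l \<xi> w))\<^sup>2 \<le> B\<^sup>2 * (a \<xi>)\<^sup>2 * (norm (l \<xi> w))\<^sup>2"
          by (intro mult_right_mono) (simp_all add: power_mult_distrib)
        then show "(b \<xi>)\<^sup>2 * ((c \<xi> * l \<xi> w) \<bullet> (c \<xi> * l \<xi> w)) \<le> B\<^sup>2 * ((a \<xi>)\<^sup>2 * (l \<xi> w \<bullet> l \<xi> w))"
          by (simp add: power2_norm_eq_inner[symmetric] norm_mult power_mult_distrib mult_ac)
      qed
    qed
  qed simp
qed

lemma good_mono:
  assumes "good Fl \<mu> a l" "b \<in> O[Fl](a)"
  shows "good Fl \<mu> b l"
  using good_cmult[OF assms(1), of b "\<lambda>_. 1"] assms(2) by simp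

lemma good_add:
  assumes "good Fl \<mu> a l" "good Fl \<mu> a m"
  shows "good Fl \<mu> a (\<lambda>\<xi> w. l \<xi> w + m \<xi> w)"
  unfolding good_def
proof (rule ctrl_mono[OF ctrl_add[OF ctrl_cmult[OF assms(1)[unfolded good_def], of 2] ctrl_cmult[OF assms(2)[unfolded good_def], of 2]]])
  show "\<forall>\<^sub>F \<xi> in Fl. \<forall>w. (a \<xi>)\<^sup>2 * ((l \<xi> w + m \<xi> w) \<bullet> (l \<xi> w + m \<xi> w))
     \<le> 2 * ((a \<xi>)\<^sup>2 * (l \<xi> w \<bullet> l \<xi> w)) + 2 * ((a \<xi>)\<^sup>2 * (m \<xi> w \<bullet> m \<xi> w))"
  proof (intro always_eventually allI)
    fix \<xi> w
    have "0 \<le> (a \<xi>)\<^sup>2 * ((l \<xi> w - m \<xi> w) \<bullet> (l \<xi> w - m \<xi> w))" by simp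
    then show "(a \<xi>)\<^sup>2 * ((l \<xi> w + m \<xi> w) \<bullet> (l \<xi> w + m \<xi> w))
     \<le> 2 * ((a \<xi>)\<^sup>2 * (l \<xi> w \<bullet> l \<xi> w)) + 2 * ((a \<xi>)\<^sup>2 * (m \<xi> w \<bullet> m \<xi> w))"
      by (simp add: inner_add inner_diff inner_commute algebra_simps)
  qed
qed simp_all

lemma good_diff:
  assumes "good Fl \<mu> a l" "good Fl \<mu> a m"
  shows "good Fl \<mu> a (\<lambda>\<xi> w. l \<xi> w - m \<xi> w)"
  using good_add[OF assms(1) good_cmult[OF assms(2), of a "\<lambda>_. -1"]] by simp

text \<open>The multiplier method as one rule. The derivative of a bounded functional is controlled
  for free, so only the remainder \<open>Y\<close> needs an argument; in the applications
  \<open>Y\<close> collects the terms of \<open>G\<close> that have to be cancelled, and the last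
  premise is then an algebraic identity.\<close>

lemma good_step:
  assumes "der F G" "qbd Fl F" "ctrl Fl \<mu> Y" "C \<ge> 0"
    and "\<forall>\<^sub>F \<xi> in Fl. \<forall>w. (a \<xi>)\<^sup>2 * (l \<xi> w \<bullet> l \<xi> w) \<le> C * (G \<xi> w + Y \<xi> w)"
  shows "good Fl \<mu> a l"
  unfolding good_def
  by (rule ctrl_mono[OF ctrl_cmult[OF ctrl_add[OF ctrl_der[OF assms(1,2)] assms(3)] assms(4)] assms(5)])

subsection \<open>Low frequencies\<close>

lemma ctrl_norm:
  assumes "good Fl \<mu> \<mu> (\<lambda>\<xi> w. w$1)" "good Fl \<mu> \<mu> (\<lambda>\<xi> w. w$2)" "good Fl \<mu> \<mu> (\<lambda>\<xi> w. w$3)"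
    "good Fl \<mu> \<mu> (\<lambda>\<xi> w. w$4)" "good Fl \<mu> \<mu> (\<lambda>\<xi> w. w$5)" "good Fl \<mu> \<mu> (\<lambda>\<xi> w. w$6)"
    "good Fl \<mu> \<mu> (\<lambda>\<xi> w. w$7)"
  shows "ctrl Fl \<mu> (\<lambda>\<xi> w. (\<mu> \<xi> * norm w)\<^sup>2)"
  using assms unfolding good_def power_mult_distrib norm_vec7 distrib_left
  by (intro ctrl_add)

lemma good_const: "good Fl \<mu> a l \<Longrightarrow> good Fl \<mu> a (\<lambda>\<xi> w. c * l \<xi> w)"
  by (erule good_cmult) (simp add: mult.commute)

lemma bd_const: "bd Fl l \<Longrightarrow> bd Fl (\<lambda>\<xi> w. c * l \<xi> w)"
  by (erule bd_cmult) simp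

lemma bd_low: "bd (at 0) l \<Longrightarrow> bd (at 0) (\<lambda>\<xi> w. \<i> * \<xi> * l \<xi> w)"
  by (erule bd_cmult) (simp add: norm_mult, real_asymp)

lemmas bd_intros = bd_nth bd_add bd_diff bd_low bd_const

abbreviation good_low :: "(real \<Rightarrow> complex ^ 7 \<Rightarrow> complex) \<Rightarrow> bool" where
  "good_low \<equiv> good (at 0) (\<lambda>\<xi>. \<xi>\<^sup>2) (\<lambda>\<xi>. \<xi>\<^sup>2)"

lemma good_low_\<eta>: "good_low (\<lambda>\<xi> w. w$7)"
  by (rule good_mono[OF good_7]) real_asymp

text \<open>The power \<open>\<xi>^3\<close> is forced by the term between \<open>\<eta>\<close> and
  \<open>v\<close>, which carries no \<open>\<xi>\<close> of its own: from weight
  \<open>\<xi>\<close> for \<open>\<eta>\<close> and \<open>\<mu> = \<xi>^2\<close>, only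
  coefficients of order \<open>\<xi>^3\<close> are absorbed. The same factor turns
  \<open>\<gamma> \<xi> |y|^2\<close> into the target of order \<open>\<xi>^4\<close>.\<close>

lemma good_low_y: "good_low (\<lambda>\<xi> w. w$4)"
proof (rule good_step[OF der_cmult[OF der_multipliers(1), of "\<lambda>\<xi>. \<xi>^3"], where C = "1/\<gamma>" and
    Y = "\<lambda>\<xi> w. (k4 * \<xi>^5) * ((\<i> * w$7) \<bullet> w$4) + (- k2 * \<xi>^4) * (w$7 \<bullet> w$3)
      + (k1 * \<xi>^3) * ((\<i> * w$7) \<bullet> w$1) + (\<gamma> * \<xi>^4) * (w$7 \<bullet> w$7)"], goal_cases)
  case 1
  show ?case by (intro qbd_inner bd_intros) real_asymp
next
  case 2
  show ?case
    by (intro ctrl_add ctrl_inner(1)[OF good_7] ctrl_inner(1)[OF good_const[OF good_7]] bd_nth; real_asymp)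
next
  case 4
  show ?case using k
    by (intro always_eventually allI) (simp add: divide_simps, simp add: algebra_simps eval_nat_numeral)
qed (use k in auto)

text \<open>Every error term either contains \<open>y\<close>, already known with weight
  \<open>\<xi>^2\<close>, or carries the extra factor \<open>\<xi>\<close> that makes it negligible
  against \<open>\<xi>^4\<close>.\<close>

lemma good_low_v: "good_low (\<lambda>\<xi> w. w$1)"
proof (rule good_step[OF der_cmult[OF der_multipliers(3), of "\<lambda>\<xi>. - (\<xi>^4)"], where C = "1/k1" and
    Y = "\<lambda>\<xi> w. \<xi>^5 * ((\<i> * w$2) \<bullet> w$4) + \<xi>^4 * (w$4 \<bullet> w$4) + \<xi>^4 * (w$6 \<bullet> w$4)
      + (- k2 * \<xi>^5) * ((\<i> * w$1) \<bullet> w$3) + (- \<gamma> * \<xi>^5) * (w$1 \<bullet> (\<i> * w$7))"], goal_cases)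
  case 1
  show ?case by (intro qbd_inner bd_intros) real_asymp
next
  case 2
  show ?case
    by (intro ctrl_add ctrl_inner(2)[OF good_low_y] bd_intros; (intro ctrl_inner_small bd_intros)?; real_asymp)
next
  case 4
  show ?case using k
    by (intro always_eventually allI) (simp add: divide_simps, simp add: algebra_simps eval_nat_numeral)
qed (use k in auto)

lemma good_low_\<theta>: "good_low (\<lambda>\<xi> w. w$6)"
proof (rule good_step[OF der_cmult[OF der_multipliers(6), of "\<lambda>\<xi>. \<xi>^4"], where C = 1 and
    Y = "\<lambda>\<xi> w. (- (\<xi>^5)) * ((\<i> * w$2) \<bullet> w$6) + (- (\<xi>^4)) * (w$4 \<bullet> w$6)
      + (k3 * \<xi>^5) * ((\<i> * w$1) \<bullet> w$5) + (k1 * \<xi>^4) * (w$1 \<bullet> w$1)"], goal_cases)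
  case 1
  show ?case by (intro qbd_inner bd_intros) real_asymp
next
  case 2
  show ?case
    by (intro ctrl_add ctrl_inner(1)[OF good_low_y] ctrl_inner(1)[OF good_low_v] bd_intros;
        (intro ctrl_inner_small bd_intros)?; real_asymp)
next
  case 4
  show ?case using k
    by (intro always_eventually allI) (simp add: algebra_simps eval_nat_numeral)
qed auto

text \<open>Subtracting the equation of \<open>\<theta>\<close> from that of \<open>y\<close>
  cancels \<open>k1 v\<close>. Tested separately, either equation would leave \<open>v\<close> with
  a coefficient of order \<open>\<xi>^3\<close>, more than the order \<open>\<xi>^4\<close>
  available for it.\<close>

lemma good_low_q: "good_low (\<lambda>\<xi> w. k2 * w$3 - k3 * w$5)"
proof -
  have *: "der (\<lambda>\<xi> w. (w$4 - w$6) \<bullet> (\<i> * (k2 * w$3 - k3 * w$5)))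
     (\<lambda>\<xi> w. \<xi> * ((k2 * w$3 - k3 * w$5) \<bullet> (k2 * w$3 - k3 * w$5)) - \<gamma> * \<xi> * (w$7 \<bullet> (k2 * w$3 - k3 * w$5))
        - \<xi> * ((w$4 - w$6) \<bullet> (k2 * w$4 - k3 * w$6)))"
    by (rule der_eq, (rule der_intros)+, simp add: inner_complex_def power2_eq_square algebra_simps)
  show ?thesis
  proof (rule good_step[OF der_cmult[OF *, of "\<lambda>\<xi>. \<xi>^3"], where C = 1 and
      Y = "\<lambda>\<xi> w. (\<gamma> * \<xi>^4) * (w$7 \<bullet> (k2 * w$3 - k3 * w$5)) + \<xi>^4 * ((w$4 - w$6) \<bullet> (k2 * w$4 - k3 * w$6))"], goal_cases)
    case 1
    show ?case by (intro qbd_inner bd_intros) real_asymp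
  next
    case 2
    show ?case
      by (intro ctrl_add ctrl_inner(1)[OF good_low_\<eta>] ctrl_inner(1)[OF good_diff[OF good_low_y good_low_\<theta>]] bd_intros;
          real_asymp)
  next
    case 4
    show ?case
      by (intro always_eventually allI) (simp add: algebra_simps eval_nat_numeral)
  qed auto
qed

text \<open>The slow variables at low frequency: \<open>\<eta> + \<gamma>z\<close>, \<open>u + i\<xi>(y + \<theta>)/2\<close> and \<open>z + \<phi> - i\<xi>v\<close> have
  derivatives of size \<open>\<xi>\<^sup>2\<close>.\<close>

lemma good_low_u: "good_low (\<lambda>\<xi> w. w$2)"
proof -
  \<comment> \<open>This is \<open>(k2 + k3)(\<eta> + \<gamma> z) - \<gamma> k3 (z + \<phi> - i\<xi>
    v)\<close>: the combination of slow variables made only of components already controlled. Its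
    derivative contains \<open>- \<gamma> k3 \<xi>^2 u\<close>, which is why it is paired with the
    slow variable built from \<open>u\<close>.\<close>
  let ?e = "\<lambda>\<xi> (w :: complex ^ 7). (k2 + k3) * w$7 + \<gamma> * (k2 * w$3 - k3 * w$5) + (\<gamma> * k3) * (\<i> * complex_of_real \<xi> * w$1)"
  let ?u = "\<lambda>\<xi> (w :: complex ^ 7). w$2 + 1/2 * (\<i> * complex_of_real \<xi> * (w$4 + w$6))"
  let ?r = "\<lambda>(w :: complex ^ 7). k2 * w$3 + k3 * w$5 - \<gamma> * w$7"
  have *: "der (\<lambda>\<xi> w. ?e \<xi> w \<bullet> ?u \<xi> w)
     (\<lambda>\<xi> w. - ((k2 + k3) * k4) * \<xi>\<^sup>2 * (w$7 \<bullet> ?u \<xi> w) - \<gamma> * k3 * \<xi>\<^sup>2 * (w$2 \<bullet> ?u \<xi> w) - 1/2 * \<xi>\<^sup>2 * (?e \<xi> w \<bullet> ?r w))"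
    by (rule der_eq, (rule der_intros)+, simp add: inner_complex_def power2_eq_square field_simps)
  have e: "good_low ?e"
    by (intro good_add good_const good_low_q good_low_\<eta> good_cmult[OF good_low_v])
       (simp add: norm_mult, real_asymp)
  show ?thesis
  proof (rule good_step[OF der_cmult[OF *, of "\<lambda>\<xi>. - (\<xi>^2)"], where C = "1/(\<gamma> * k3)" and
      Y = "\<lambda>\<xi> w. (- ((k2 + k3) * k4) * \<xi>^4) * (w$7 \<bullet> ?u \<xi> w) + (- 1/2 * \<xi>^4) * (?e \<xi> w \<bullet> ?r w)
        + (- \<gamma> * k3 / 2 * \<xi>^5) * (w$2 \<bullet> (\<i> * (w$4 + w$6)))"], goal_cases)
    case 1
    show ?case by (intro qbd_inner bd_intros) real_asymp
  next
    case 2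
    show ?case
      by (intro ctrl_add ctrl_inner(1)[OF good_low_\<eta>] ctrl_inner(1)[OF e] bd_intros;
         (intro ctrl_inner_small bd_intros)?; real_asymp)
  next
    case 4
    show ?case using k
      by (intro always_eventually allI)
         (simp add: divide_simps inner_complex_def, simp add: field_simps eval_nat_numeral)
  qed (use k in auto)
qed

lemma good_low_z\<phi>: "good_low (\<lambda>\<xi> w. w$3)" "good_low (\<lambda>\<xi> w. w$5)"
proof -
  let ?u = "\<lambda>\<xi> (w :: complex ^ 7). w$2 + 1/2 * (\<i> * complex_of_real \<xi> * (w$4 + w$6))"
  let ?r = "\<lambda>(w :: complex ^ 7). k2 * w$3 + k3 * w$5"
  let ?s = "\<lambda>(w :: complex ^ 7). w$3 + w$5"
  let ?q = "\<lambda>(w :: complex ^ 7). k2 * w$3 - k3 * w$5"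
  let ?\<zeta> = "\<lambda>\<xi> (w :: complex ^ 7). w$3 + w$5 - \<i> * complex_of_real \<xi> * w$1"
  have *: "der (\<lambda>\<xi> w. ?u \<xi> w \<bullet> ?\<zeta> \<xi> w)
     (\<lambda>\<xi> w. - 1/2 * \<xi>\<^sup>2 * ((?r w - \<gamma> * w$7) \<bullet> ?\<zeta> \<xi> w) + \<xi>\<^sup>2 * (?u \<xi> w \<bullet> w$2))"
    by (rule der_eq, (rule der_intros)+, simp add: inner_complex_def power2_eq_square field_simps)
  have s: "good_low (\<lambda>\<xi> w. ?s w)"
  \<comment> \<open>The constants come from \<open>k2 z + k3 \<phi> = 2 k2 k3/(k2 + k3) s + (k2 -
    k3)/(k2 + k3) q\<close>, where \<open>s = z + \<phi>\<close> and
    \<open>q = k2 z - k3 \<phi>\<close>. The \<open>q\<close>-part is already controlled, and half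
    of the \<open>s\<close>-part gives the reciprocal of \<open>C\<close>.\<close>
  proof (rule good_step[OF der_cmult[OF *, of "\<lambda>\<xi>. - (\<xi>^2)"], where C = "(k2 + k3) / (k2 * k3)" and
      Y = "\<lambda>\<xi> w. (\<gamma>/2 * \<xi>^4) * (w$7 \<bullet> ?\<zeta> \<xi> w) + \<xi>^4 * (?u \<xi> w \<bullet> w$2)
        + (1/2 * \<xi>^5) * (?r w \<bullet> (\<i> * w$1)) + (- (k2 - k3) / (2 * (k2 + k3)) * \<xi>^4) * (?q w \<bullet> ?s w)"], goal_cases)
    case 1
    show ?case by (intro qbd_inner bd_intros) real_asymp
  next
    case 2
    show ?case
      by (intro ctrl_add ctrl_inner(1)[OF good_low_\<eta>] ctrl_inner(2)[OF good_low_u] ctrl_inner(1)[OF good_low_q] bd_intros;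
         (intro ctrl_inner_small bd_intros)?; real_asymp)
  next
    case 4
    have "k2 + k3 \<noteq> 0" using k by auto
    then show ?case using k
      by (intro always_eventually allI)
         (simp add: divide_simps inner_complex_def, simp add: field_simps eval_nat_numeral)
  qed (use k in auto)
  have k0: "complex_of_real k2 + complex_of_real k3 \<noteq> 0"
    using k by (metis add_pos_pos less_irrefl of_real_add of_real_eq_0_iff)
  have "good_low (\<lambda>\<xi> w. 1 / (k2 + k3) * (k3 * ?s w + ?q w))" "good_low (\<lambda>\<xi> w. 1 / (k2 + k3) * (k2 * ?s w - ?q w))"
    by (intro good_const good_add good_diff s good_low_q)+
  moreover have "(\<lambda>w. 1 / (k2 + k3) * (k3 * ?s w + ?q w)) = (\<lambda>w. w$3)"
    "(\<lambda>w. 1 / (k2 + k3) * (k2 * ?s w - ?q w)) = (\<lambda>w. w$5)"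
    using k0 by (auto simp: fun_eq_iff field_simps)
  ultimately show "good_low (\<lambda>\<xi> w. w$3)" "good_low (\<lambda>\<xi> w. w$5)" by auto
qed

lemma ctrl_low: "ctrl (at 0) (\<lambda>\<xi>. \<xi>\<^sup>2) (\<lambda>\<xi> w. (\<xi>\<^sup>2 * norm w)\<^sup>2)"
  by (intro ctrl_norm good_low_\<eta> good_low_y good_low_v good_low_\<theta> good_low_u good_low_z\<phi>)

subsection \<open>High frequencies\<close>

lemma eventually_high: "\<forall>\<^sub>F \<xi> in sup at_top at_bot. 1 \<le> \<bar>\<xi>::real\<bar>"
  unfolding eventually_sup
  by (intro conjI eventually_mono[OF eventually_ge_at_top[of "1::real"]]
      eventually_mono[OF eventually_le_at_bot[of "-1::real"]]) auto

lemma eventually_nonzero: "\<forall>\<^sub>F \<xi> in sup at_top at_bot. \<xi> \<noteq> (0::real)"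
  by (rule eventually_mono[OF eventually_high]) auto

section \<open>High frequencies with equal wave speeds\<close>

context
  assumes eq: "k1 = k2" "k2 = k3"
begin

abbreviation good_high :: "(real \<Rightarrow> complex ^ 7 \<Rightarrow> complex) \<Rightarrow> bool" where
  "good_high \<equiv> good (sup at_top at_bot) (\<lambda>\<xi>. 1) (\<lambda>\<xi>. 1)"

lemma good_high_\<eta>: "good_high (\<lambda>\<xi> w. w$7)"
  by (rule good_mono[OF good_7], rule landau_o.big.sup; real_asymp)

lemma good_high_y: "good_high (\<lambda>\<xi> w. w$4)"
proof (rule good_step[OF der_cmult[OF der_multipliers(1), of "\<lambda>\<xi>. 1/\<xi>"], where C = "1/\<gamma>" and
    Y = "\<lambda>\<xi> w. (k4 * \<xi>) * ((\<i> * w$7) \<bullet> w$4) + (- k2) * (w$7 \<bullet> w$3)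
      + (k1 / \<xi>) * ((\<i> * w$7) \<bullet> w$1) + \<gamma> * (w$7 \<bullet> w$7)"], goal_cases)
  case 1
  show ?case by (intro qbd_inner bd_intros landau_o.big.sup; real_asymp)
next
  case 2
  show ?case
    by (intro ctrl_add ctrl_inner(1)[OF good_7] ctrl_inner(1)[OF good_const[OF good_7]] bd_nth landau_o.big.sup; real_asymp)
next
  case 4
  show ?case using eventually_nonzero by (rule eventually_mono) (use k in \<open>simp add: field_simps eval_nat_numeral\<close>)
qed (use k in auto)

lemma good_high_z: "good_high (\<lambda>\<xi> w. w$3)"
proof (rule good_step[OF der_cmult[OF der_multipliers(2), of "\<lambda>\<xi>. - 1/\<xi>"], where C = "1/k2" and
    Y = "\<lambda>\<xi> w. (- k1 / \<xi>) * ((\<i> * w$1) \<bullet> w$3) + \<gamma> * (w$7 \<bullet> w$3) + 1 * (w$4 \<bullet> w$4)"], goal_cases)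
  case 1
  show ?case by (intro qbd_inner bd_intros landau_o.big.sup; real_asymp)
next
  case 2
  show ?case
    by (intro ctrl_add ctrl_inner(1)[OF good_high_\<eta>] ctrl_inner(1)[OF good_high_y] bd_nth;
      (intro ctrl_inner_small bd_intros)?; (rule landau_o.big.sup landau_o.small.sup)?; real_asymp)
next
  case 4
  show ?case using eventually_nonzero by (rule eventually_mono) (use k in \<open>simp add: field_simps eval_nat_numeral\<close>)
qed (use k in auto)

text \<open>The multipliers \<open>v \<bullet> y\<close> and \<open>u \<bullet> z\<close> are added
  because each has terms of order \<open>\<xi>\<close> that cannot be absorbed. Those between
  \<open>u\<close> and \<open>y\<close> cancel identically, those between \<open>v\<close> and
  \<open>z\<close> cancel because \<open>k1 = k2\<close>.\<close>

lemma good_high_v: "good_high (\<lambda>\<xi> w. w$1)"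
proof (rule good_step[OF der_cmult[OF der_add[OF der_multipliers(3,4)], of "\<lambda>\<xi>. - 1"], where C = "1/k1" and
    Y = "\<lambda>\<xi> w. 1 * (w$4 \<bullet> w$4) + 1 * (w$6 \<bullet> w$4) + (- \<gamma> * \<xi>) * (w$1 \<bullet> (\<i> * w$7))"], goal_cases)
  case 1
  show ?case unfolding distrib_left by (intro qbd_add qbd_inner bd_intros landau_o.big.sup; real_asymp)
next
  case 2
  show ?case
    by (intro ctrl_add ctrl_inner(2)[OF good_const[OF good_7]] ctrl_inner(2)[OF good_high_y] bd_nth landau_o.big.sup; real_asymp)
next
  case 4
  show ?case using k eq by (intro always_eventually allI) (simp add: field_simps)
qed (use k in auto)

lemma good_high_u: "good_high (\<lambda>\<xi> w. w$2)"
proof (rule good_step[OF der_cmult[OF der_multipliers(5), of "\<lambda>\<xi>. - 1/\<xi>"], where C = 1 and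
    Y = "\<lambda>\<xi> w. (1/\<xi>) * ((\<i> * w$4 + \<i> * w$6) \<bullet> w$2) + k1 * (w$1 \<bullet> w$1)"], goal_cases)
  case 1
  show ?case by (intro qbd_inner bd_intros landau_o.big.sup; real_asymp)
next
  case 2
  show ?case
    by (intro ctrl_add ctrl_inner(1)[OF good_high_v] bd_nth;
      (intro ctrl_inner_small bd_intros)?; (rule landau_o.big.sup landau_o.small.sup)?; real_asymp)
next
  case 4
  show ?case using eventually_nonzero by (rule eventually_mono) (use k in \<open>simp add: field_simps inner_add_left\<close>)
qed (use k in auto)

text \<open>The same cancellation for the other wave pair: terms between \<open>u\<close> and
  \<open>\<theta>\<close> cancel identically, those between \<open>v\<close> and
  \<open>\<phi>\<close> because \<open>k1 = k3\<close>.\<close>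

lemma good_high_\<theta>: "good_high (\<lambda>\<xi> w. w$6)"
proof (rule good_step[OF der_cmult[OF der_add[OF der_multipliers(6,7)], of "\<lambda>\<xi>. 1"], where C = "1" and
    Y = "\<lambda>\<xi> w. (- 1) * (w$4 \<bullet> w$6) + k1 * (w$1 \<bullet> w$1)"], goal_cases)
  case 1
  show ?case unfolding distrib_left by (intro qbd_add qbd_inner bd_intros landau_o.big.sup; real_asymp)
next
  case 2
  show ?case
    by (intro ctrl_add ctrl_inner(1)[OF good_high_v] ctrl_inner(1)[OF good_high_y] bd_nth landau_o.big.sup; real_asymp)
next
  case 4
  show ?case using k eq by (intro always_eventually allI) (simp add: field_simps)
qed (use k in auto)

lemma good_high_\<phi>: "good_high (\<lambda>\<xi> w. w$5)"
proof (rule good_step[OF der_cmult[OF der_multipliers(8), of "\<lambda>\<xi>. - 1/\<xi>"], where C = "1/k3" and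
    Y = "\<lambda>\<xi> w. (- k1 / \<xi>) * ((\<i> * w$1) \<bullet> w$5) + 1 * (w$6 \<bullet> w$6)"], goal_cases)
  case 1
  show ?case by (intro qbd_inner bd_intros landau_o.big.sup; real_asymp)
next
  case 2
  show ?case
    by (intro ctrl_add ctrl_inner(1)[OF good_high_\<theta>] bd_nth;
      (intro ctrl_inner_small bd_intros)?; (rule landau_o.big.sup landau_o.small.sup)?; real_asymp)
next
  case 4
  show ?case using eventually_nonzero by (rule eventually_mono) (use k in \<open>simp add: field_simps eval_nat_numeral\<close>)
qed (use k in auto)

lemma ctrl_high_equal: "ctrl (sup at_top at_bot) (\<lambda>\<xi>. 1) (\<lambda>\<xi> w. (1 * norm w)\<^sup>2)"
  by (intro ctrl_norm good_high_\<eta> good_high_y good_high_v good_high_\<theta> good_high_u good_high_z good_high_\<phi>)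

end

section \<open>High frequencies with unequal wave speeds\<close>

lemma young: "a * b \<le> \<delta> * a\<^sup>2 + 1 / (4 * \<delta>) * b\<^sup>2" if "\<delta> > 0" for a b \<delta> :: real
proof -
  have "0 \<le> \<delta> * (a - b / (2 * \<delta>))\<^sup>2" using that by simp
  also have "\<dots> = \<delta> * a\<^sup>2 + 1 / (4 * \<delta>) * b\<^sup>2 - a * b"
    using that by (simp add: power2_diff power_divide field_simps power2_eq_square)
  finally show ?thesis by simp
qed

lemma ii_inner: "(\<i> * x) \<bullet> (\<i> * x) = x \<bullet> x"
  by (simp add: inner_complex_def)

lemma young_inner:
  fixes x y :: complex
  assumes "\<delta> > 0"
  shows "c * d * (x \<bullet> y) \<le> \<delta> * (c\<^sup>2 * (x \<bullet> x)) + 1 / (4 * \<delta>) * (d\<^sup>2 * (y \<bullet> y))"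
proof -
  have "c * d * (x \<bullet> y) \<le> \<bar>c\<bar> * \<bar>d\<bar> * \<bar>x \<bullet> y\<bar>" by (metis abs_ge_self abs_mult)
  also have "\<dots> \<le> \<bar>c\<bar> * \<bar>d\<bar> * (norm x * norm y)" by (intro mult_left_mono inner_bound) simp
  also have "\<dots> = (\<bar>c\<bar> * norm x) * (\<bar>d\<bar> * norm y)" by simp
  also have "\<dots> \<le> \<delta> * (\<bar>c\<bar> * norm x)\<^sup>2 + 1 / (4 * \<delta>) * (\<bar>d\<bar> * norm y)\<^sup>2" by (rule young[OF assms])
  finally show ?thesis by (simp add: power_mult_distrib power2_norm_eq_inner)
qed

text \<open>Resolves a circular dependence: \<open>P\<close> costs an arbitrarily small amount of
  \<open>Z\<close>, while \<open>Z\<close> costs a fixed multiple of \<open>P\<close> and of the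
  reference quantity. Inserting the second estimate in the first leaves at most half of
  \<open>P\<close> on the right.\<close>

lemma ctrl_absorb:
  assumes A: "\<And>\<delta>. \<delta> > 0 \<Longrightarrow> ctrl Fl \<mu> (\<lambda>\<xi> w. P \<xi> w - \<delta> * Z \<xi> w)"
    and B: "ctrl Fl \<mu> (\<lambda>\<xi> w. Z \<xi> w - C * P \<xi> w - C * (\<mu> \<xi> * norm w)\<^sup>2)" "C > 0"
    and P: "\<And>\<xi> w. P \<xi> w \<ge> 0"
  shows "ctrl Fl \<mu> P"
proof (rule ctrl_limit)
  fix \<epsilon> :: real assume e: "\<epsilon> > 0"
  \<comment> \<open>The bound \<open>\<delta> C \<le> 1/2\<close> allows absorption into
    \<open>P\<close>; doubling to undo that absorption requires
    \<open>2 \<delta> C \<le> \<epsilon>\<close> for the reference term.\<close>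
  define \<delta> where "\<delta> = min (1/2) (\<epsilon>/2) / C"
  have d: "\<delta> > 0" "\<delta> * C \<le> 1/2" "2 * (\<delta> * C) \<le> \<epsilon>" using e B by (auto simp: \<delta>_def)
  show "ctrl Fl \<mu> (\<lambda>\<xi> w. P \<xi> w - \<epsilon> * (\<mu> \<xi> * norm w)\<^sup>2)"
  proof (rule ctrl_mono[OF ctrl_cmult[OF ctrl_add[OF A[OF d(1)] ctrl_cmult[OF B(1), of \<delta>]], of 2]])
    show "\<forall>\<^sub>F \<xi> in Fl. \<forall>w. P \<xi> w - \<epsilon> * (\<mu> \<xi> * norm w)\<^sup>2
       \<le> 2 * (P \<xi> w - \<delta> * Z \<xi> w + \<delta> * (Z \<xi> w - C * P \<xi> w - C * (\<mu> \<xi> * norm w)\<^sup>2))"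
    proof (intro always_eventually allI)
      fix \<xi> w
      have "(\<delta> * C) * P \<xi> w \<le> 1/2 * P \<xi> w" by (intro mult_right_mono d P)
      moreover have "2 * (\<delta> * C) * (\<mu> \<xi> * norm w)\<^sup>2 \<le> \<epsilon> * (\<mu> \<xi> * norm w)\<^sup>2" by (intro mult_right_mono d) simp
      ultimately show "P \<xi> w - \<epsilon> * (\<mu> \<xi> * norm w)\<^sup>2
       \<le> 2 * (P \<xi> w - \<delta> * Z \<xi> w + \<delta> * (Z \<xi> w - C * P \<xi> w - C * (\<mu> \<xi> * norm w)\<^sup>2))"
        by (simp add: algebra_simps)
    qed
  qed (use d in auto)
qed

abbreviation good_weak :: "(real \<Rightarrow> real) \<Rightarrow> (real \<Rightarrow> complex ^ 7 \<Rightarrow> complex) \<Rightarrow> bool" where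
  "good_weak \<equiv> good (sup at_top at_bot) (\<lambda>\<xi>. 1 / \<xi>\<^sup>2)"

lemma norm_nth_inner_le: "(w::complex^7) $ i \<bullet> w $ i \<le> (norm w)\<^sup>2"
  by (metis power2_norm_eq_inner Finite_Cartesian_Product.norm_nth_le norm_ge_zero power_mono)

text \<open>The product of \<open>\<eta>\<close> and \<open>z\<close> has a coefficient of order 1,
  beyond the order \<open>1/\<xi>\<close> that weight \<open>\<xi>\<close> for \<open>\<eta>\<close>
  and \<open>\<mu> = 1/\<xi>^2\<close> can absorb. It is split against
  \<open>\<xi>^-2 |z|^2\<close>, which in turn is estimated by \<open>|y|^2\<close> and the
  reference quantity. The weight 1 for \<open>y\<close> is stronger than the final weight
  \<open>1/\<xi>^2\<close>; the estimate of \<open>v\<close> depends on it.\<close>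

lemma good_weak_y: "good_weak (\<lambda>\<xi>. 1) (\<lambda>\<xi> w. w$4)"
  unfolding good_def
proof (rule ctrl_absorb[where Z = "\<lambda>\<xi> w. (1/\<xi>)\<^sup>2 * (w$3 \<bullet> w$3)" and C = "2 / k2 + (k1/k2)\<^sup>2"])
  fix \<delta> :: real assume d: "\<delta> > 0"
  \<comment> \<open>The three summands pay for the products of \<open>\<eta>\<close> with
    \<open>y\<close>, with \<open>z\<close> and with itself, all doubled because half of
    \<open>|y|^2\<close> is absorbed on the left.\<close>
  let ?C = "(k4/\<gamma>)\<^sup>2 + (k2/\<gamma>)\<^sup>2/\<delta> + 2"
  have arith: "Y - \<delta> * Z \<le> 2 * (G + (V + (P + Q + 2 * X)))"
    if "A \<le> 1/2 * P + 1/2 * Y" "B \<le> 1/2 * Q + \<delta>/2 * Z" "e \<le> X" "Y = G + V + e + A + B" "0 \<le> P" "0 \<le> Q" "0 \<le> e"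
    for Y Z G V P Q X A B e :: real
    using that by (simp add: distrib_left)
  show "ctrl (sup at_top at_bot) (\<lambda>\<xi>. 1 / \<xi>\<^sup>2) (\<lambda>\<xi> w. 1\<^sup>2 * (w$4 \<bullet> w$4) - \<delta> * ((1/\<xi>)\<^sup>2 * (w$3 \<bullet> w$3)))"
  proof (rule ctrl_mono[OF ctrl_cmult[OF ctrl_add[OF ctrl_der[OF der_cmult[OF der_multipliers(1), of "\<lambda>\<xi>. 1/(\<gamma>*\<xi>)"]]
      ctrl_add[OF ctrl_inner(1)[OF good_const[OF good_7, where c = "\<i>"], of _ "\<lambda>\<xi> w. w$1" "\<lambda>\<xi>. k1/(\<gamma>*\<xi>)"]
       ctrl_cmult[OF good_7[unfolded good_def], where c = ?C]]], where c = 2]], goal_cases)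
    case 6
    from eventually_high show ?case
    proof eventually_elim
      case (elim \<xi>)
      then have x: "\<xi> \<noteq> 0" "1 \<le> \<xi>\<^sup>2" using one_le_power[of "\<bar>\<xi>\<bar>" 2] by auto
      show ?case
      proof
        fix w :: "complex ^ 7"
        have 1: "k4/\<gamma> * \<xi> * ((\<i> * w$7) \<bullet> w$4) \<le> 1/2 * ((k4/\<gamma> * \<xi>)\<^sup>2 * ((\<i> * w$7) \<bullet> (\<i> * w$7))) + 1/2 * (w$4 \<bullet> w$4)"
          using young_inner[of "1/2" "k4/\<gamma> * \<xi>" 1 "\<i> * w$7" "w$4"] by simp
        have 2: "- (k2/\<gamma>) * (w$7 \<bullet> w$3) \<le> 1/2 * ((k2/\<gamma>)\<^sup>2 / \<delta> * (\<xi>\<^sup>2 * (w$7 \<bullet> w$7))) + \<delta>/2 * ((1/\<xi>)\<^sup>2 * (w$3 \<bullet> w$3))"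
          using young_inner[of "\<delta>/2" "1/\<xi>" "- k2/\<gamma> * \<xi>" "w$3" "w$7"] x d
          by (simp add: power_mult_distrib power_divide inner_commute mult_ac)
        have 3: "w$7 \<bullet> w$7 \<le> \<xi>\<^sup>2 * (w$7 \<bullet> w$7)" using mult_right_mono[OF x(2), of "w$7 \<bullet> w$7"] by simp
        have 4: "(\<i> * w$7) \<bullet> (\<i> * w$7) = w$7 \<bullet> w$7" by (simp add: inner_complex_def)
        have 5: "w$4 \<bullet> w$4 = 1/(\<gamma>*\<xi>) * (\<gamma> * \<xi> * (w$4 \<bullet> w$4) - k4 * \<xi>\<^sup>2 * ((\<i> * w$7) \<bullet> w$4) + k2 * \<xi> * (w$7 \<bullet> w$3)
            - k1 * ((\<i> * w$7) \<bullet> w$1) - \<gamma> * \<xi> * (w$7 \<bullet> w$7)) + k1/(\<gamma>*\<xi>) * ((\<i> * w$7) \<bullet> w$1)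
            + w$7 \<bullet> w$7 + k4/\<gamma> * \<xi> * ((\<i> * w$7) \<bullet> w$4) + - (k2/\<gamma>) * (w$7 \<bullet> w$3)"
          using x k by (simp add: field_simps power2_eq_square)
        have 6: "?C * (\<xi>\<^sup>2 * (w$7 \<bullet> w$7)) = (k4/\<gamma> * \<xi>)\<^sup>2 * (w$7 \<bullet> w$7) + (k2/\<gamma>)\<^sup>2 / \<delta> * (\<xi>\<^sup>2 * (w$7 \<bullet> w$7)) + 2 * (\<xi>\<^sup>2 * (w$7 \<bullet> w$7))"
          by (simp add: algebra_simps power_mult_distrib power_divide)
        have p: "0 \<le> (k4/\<gamma> * \<xi>)\<^sup>2 * (w$7 \<bullet> w$7)" "0 \<le> (k2/\<gamma>)\<^sup>2 / \<delta> * (\<xi>\<^sup>2 * (w$7 \<bullet> w$7))" "0 \<le> w$7 \<bullet> w$7"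
          using d by auto
        show "1\<^sup>2 * (w$4 \<bullet> w$4) - \<delta> * ((1/\<xi>)\<^sup>2 * (w$3 \<bullet> w$3)) \<le> 2 * (1/(\<gamma>*\<xi>) * (\<gamma> * \<xi> * (w$4 \<bullet> w$4) - k4 * \<xi>\<^sup>2 * ((\<i> * w$7) \<bullet> w$4) + k2 * \<xi> * (w$7 \<bullet> w$3)
            - k1 * ((\<i> * w$7) \<bullet> w$1) - \<gamma> * \<xi> * (w$7 \<bullet> w$7)) + (k1/(\<gamma>*\<xi>) * ((\<i> * w$7) \<bullet> w$1) + ?C * (\<xi>\<^sup>2 * (w$7 \<bullet> w$7))))"
          unfolding 6 one_power2 mult_1_left by (rule arith[OF 1[unfolded 4] 2 3 5 p])
      qed
    qed
  qed (use d in \<open>(insert k, (intro qbd_inner bd_intros landau_o.big.sup; real_asymp)) | simp\<close>)+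
next
  have arith: "Z - (2/k2 + c) * Y - (2/k2 + c) * N \<le> 2 * (G + I)"
    if "H \<le> 1/2 * T + 1/2 * Z" "J \<le> 1 * (1/k2 * Y)" "T \<le> c * N" "Z = G + I + J + H" "0 \<le> 2/k2 * N" "0 \<le> c * Y"
    for Z Y N G I H J T c :: real
  proof -
    have "Z \<le> 2 * (G + I) + T + 2 * J" using that(1,4) by argo
    then show ?thesis using that(2,3,5,6) by (simp add: distrib_right)
  qed
  show "ctrl (sup at_top at_bot) (\<lambda>\<xi>. 1 / \<xi>\<^sup>2) (\<lambda>\<xi> w. (1/\<xi>)\<^sup>2 * (w$3 \<bullet> w$3)
     - (2 / k2 + (k1/k2)\<^sup>2) * (1\<^sup>2 * (w$4 \<bullet> w$4)) - (2 / k2 + (k1/k2)\<^sup>2) * (1 / \<xi>\<^sup>2 * norm w)\<^sup>2)"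
  proof (rule ctrl_mono[OF ctrl_cmult[OF ctrl_add[OF ctrl_der[OF der_cmult[OF der_multipliers(2), of "\<lambda>\<xi>. -1/(k2*\<xi>^3)"]]
      ctrl_inner(1)[OF good_7, of _ "\<lambda>\<xi> w. w$3" "\<lambda>\<xi>. \<gamma>/(k2*\<xi>^2)"]], where c = 2]], goal_cases)
    case 5
    from eventually_high show ?case
    proof eventually_elim
      case (elim \<xi>)
      then have x: "\<xi> \<noteq> 0" "1 \<le> \<xi>\<^sup>2" using one_le_power[of "\<bar>\<xi>\<bar>" 2] by auto
      show ?case
      proof
        fix w :: "complex ^ 7"
        have 1: "- (k1/k2) / \<xi>^3 * ((\<i> * w$1) \<bullet> w$3) \<le> 1/2 * ((k1/k2/\<xi>\<^sup>2)\<^sup>2 * (w$1 \<bullet> w$1)) + 1/2 * ((1/\<xi>)\<^sup>2 * (w$3 \<bullet> w$3))"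
          using young_inner[of "1/2" "- (k1/k2) / \<xi>\<^sup>2" "1/\<xi>" "\<i> * w$1" "w$3"] by (simp add: ii_inner eval_nat_numeral)
        have 2: "1/\<xi>\<^sup>2 * (1/k2 * (w$4 \<bullet> w$4)) \<le> 1 * (1/k2 * (w$4 \<bullet> w$4))"
          using x k by (intro mult_right_mono) auto
        have 3: "(k1/k2/\<xi>\<^sup>2)\<^sup>2 * (w$1 \<bullet> w$1) \<le> (k1/k2/\<xi>\<^sup>2)\<^sup>2 * (norm w)\<^sup>2"
          by (intro mult_left_mono norm_nth_inner_le) simp
        have 4: "(1/\<xi>)\<^sup>2 * (w$3 \<bullet> w$3) = - 1/(k2*\<xi>^3) * (- k2 * \<xi> * (w$3 \<bullet> w$3) - k1 * ((\<i> * w$1) \<bullet> w$3) + \<gamma> * \<xi> * (w$7 \<bullet> w$3) + \<xi> * (w$4 \<bullet> w$4))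
           + \<gamma>/(k2*\<xi>^2) * (w$7 \<bullet> w$3) + 1/\<xi>\<^sup>2 * (1/k2 * (w$4 \<bullet> w$4)) + - (k1/k2) / \<xi>^3 * ((\<i> * w$1) \<bullet> w$3)"
          using x k by (simp add: field_simps eval_nat_numeral)
        have 5: "0 \<le> 2/k2 * (1 / \<xi>\<^sup>2 * norm w)\<^sup>2" "0 \<le> (k1/k2)\<^sup>2 * (w$4 \<bullet> w$4)" using k by auto
        have 6: "(k1/k2/\<xi>\<^sup>2)\<^sup>2 * (norm w)\<^sup>2 = (k1/k2)\<^sup>2 * (1 / \<xi>\<^sup>2 * norm w)\<^sup>2"
          by (simp add: power_mult_distrib power_divide)
        show "(1/\<xi>)\<^sup>2 * (w$3 \<bullet> w$3)
           - (2 / k2 + (k1/k2)\<^sup>2) * (1\<^sup>2 * (w$4 \<bullet> w$4)) - (2 / k2 + (k1/k2)\<^sup>2) * (1 / \<xi>\<^sup>2 * norm w)\<^sup>2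
           \<le> 2 * (- 1/(k2*\<xi>^3) * (- k2 * \<xi> * (w$3 \<bullet> w$3) - k1 * ((\<i> * w$1) \<bullet> w$3) + \<gamma> * \<xi> * (w$7 \<bullet> w$3) + \<xi> * (w$4 \<bullet> w$4))
            + \<gamma>/(k2*\<xi>^2) * (w$7 \<bullet> w$3))"
          unfolding one_power2 mult_1_left by (rule arith[OF 1 2 3[unfolded 6] 4 5])
      qed
    qed
  qed (use k in \<open>(insert k, (intro qbd_inner bd_intros landau_o.big.sup; real_asymp)) | simp\<close>)+
qed (use k in \<open>auto intro!: add_pos_nonneg\<close>)

text \<open>Weighting the multiplier \<open>u \<bullet> z\<close> by \<open>k2/k1\<close> restores
  the cancellation between \<open>v\<close> and \<open>z\<close>; the price is a surviving term
  between \<open>u\<close> and \<open>y\<close>. Full control of \<open>y\<close> lets it be split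
  against \<open>\<xi>^-2 |u|^2\<close>, and that quantity is bounded back by
  \<open>\<xi>^-2 |v|^2\<close> and the reference quantity.\<close>

lemma good_weak_v: "good_weak (\<lambda>\<xi>. 1/\<xi>) (\<lambda>\<xi> w. w$1)"
  unfolding good_def
proof (rule ctrl_absorb[where Z = "\<lambda>\<xi> w. (1/\<xi>)\<^sup>2 * (w$2 \<bullet> w$2)" and C = "2 * k1 + 1"])
  fix \<delta> :: real assume d: "\<delta> > 0"
  \<comment> \<open>The coefficient left over from the weighted cancellation; it vanishes exactly
    when \<open>k1 = k2\<close>.\<close>
  let ?a = "(1 - k2/k1) / k1"
  let ?C = "1 / (4 * \<delta>) * ?a\<^sup>2"
  show "ctrl (sup at_top at_bot) (\<lambda>\<xi>. 1 / \<xi>\<^sup>2) (\<lambda>\<xi> w. (1/\<xi>)\<^sup>2 * (w$1 \<bullet> w$1) - \<delta> * ((1/\<xi>)\<^sup>2 * (w$2 \<bullet> w$2)))"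
  proof (rule ctrl_mono[OF ctrl_add[OF ctrl_der[OF der_cmult[OF
        der_add[OF der_multipliers(3) der_cmult[OF der_multipliers(4), of "\<lambda>\<xi>. k2/k1"]], of "\<lambda>\<xi>. - (1/(k1*\<xi>\<^sup>2))"]]
      ctrl_add[OF ctrl_inner(1)[OF good_weak_y, of "\<lambda>\<xi> w. w$4 + w$6" "\<lambda>\<xi>. 1/(k1*\<xi>\<^sup>2)"]
       ctrl_add[OF ctrl_inner(1)[OF good_const[OF good_7, where c = "\<i>"], of _ "\<lambda>\<xi> w. w$1" "\<lambda>\<xi>. -\<gamma>/(k1*\<xi>)"]
         ctrl_cmult[OF good_weak_y[unfolded good_def], where c = ?C]]]]], goal_cases)
    case 1
    show ?case unfolding distrib_left mult.assoc[symmetric]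
      by (insert k, (intro qbd_add qbd_inner bd_intros landau_o.big.sup; real_asymp))
  next
    case 7
    from eventually_high show ?case
    proof eventually_elim
      case (elim \<xi>)
      then have x: "\<xi> \<noteq> 0" by auto
      show ?case
      proof
        fix w :: "complex ^ 7"
        have 1: "1/\<xi> * ?a * ((\<i> * w$2) \<bullet> w$4) \<le> \<delta> * ((1/\<xi>)\<^sup>2 * (w$2 \<bullet> w$2)) + ?C * (1\<^sup>2 * (w$4 \<bullet> w$4))"
          using young_inner[of \<delta> "1/\<xi>" ?a "\<i> * w$2" "w$4"] d by (simp add: ii_inner)
        have 4: "(1/\<xi>)\<^sup>2 * (w$1 \<bullet> w$1) = - (1/(k1*\<xi>\<^sup>2)) * (\<xi> * ((\<i> * w$2) \<bullet> w$4) + w$4 \<bullet> w$4 + w$6 \<bullet> w$4 - k2 * \<xi> * ((\<i> * w$1) \<bullet> w$3)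
            - k1 * (w$1 \<bullet> w$1) - \<gamma> * \<xi> * (w$1 \<bullet> (\<i> * w$7)) + k2/k1 * (k1 * \<xi> * ((\<i> * w$1) \<bullet> w$3) - \<xi> * ((\<i> * w$2) \<bullet> w$4)))
            + (1/(k1*\<xi>\<^sup>2) * (w$4 \<bullet> (w$4 + w$6)) + -\<gamma>/(k1*\<xi>) * ((\<i> * w$7) \<bullet> w$1)) + 1/\<xi> * ?a * ((\<i> * w$2) \<bullet> w$4)"
          using x k by (simp add: inner_add_right inner_commute field_simps eval_nat_numeral)
        show "(1/\<xi>)\<^sup>2 * (w$1 \<bullet> w$1) - \<delta> * ((1/\<xi>)\<^sup>2 * (w$2 \<bullet> w$2)) \<le> - (1/(k1*\<xi>\<^sup>2)) * (\<xi> * ((\<i> * w$2) \<bullet> w$4) + w$4 \<bullet> w$4 + w$6 \<bullet> w$4 - k2 * \<xi> * ((\<i> * w$1) \<bullet> w$3)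
            - k1 * (w$1 \<bullet> w$1) - \<gamma> * \<xi> * (w$1 \<bullet> (\<i> * w$7)) + k2/k1 * (k1 * \<xi> * ((\<i> * w$1) \<bullet> w$3) - \<xi> * ((\<i> * w$2) \<bullet> w$4)))
            + (1/(k1*\<xi>\<^sup>2) * (w$4 \<bullet> (w$4 + w$6)) + (-\<gamma>/(k1*\<xi>) * ((\<i> * w$7) \<bullet> w$1) + ?C * (1\<^sup>2 * (w$4 \<bullet> w$4))))"
          using 1 4 by linarith
      qed
    qed
  qed (use d in \<open>(insert k, (intro qbd_inner bd_intros landau_o.big.sup; real_asymp)) | simp\<close>)+
next
  have arith: "Z - (2 * k1 + 1) * P - (2 * k1 + 1) * N \<le> 2 * (G + I)"
    if "H \<le> 1/2 * T + 1/2 * Z" "T \<le> N" "Z = G + I + H + k1 * P" "0 \<le> k1 * N" "0 \<le> P"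
    for Z P N G I H T :: real
  proof -
    have "Z \<le> 2 * (G + I) + T + 2 * (k1 * P)" using that(1,3) by argo
    then show ?thesis using that by (simp add: distrib_right)
  qed
  show "ctrl (sup at_top at_bot) (\<lambda>\<xi>. 1 / \<xi>\<^sup>2) (\<lambda>\<xi> w. (1/\<xi>)\<^sup>2 * (w$2 \<bullet> w$2)
     - (2 * k1 + 1) * ((1/\<xi>)\<^sup>2 * (w$1 \<bullet> w$1)) - (2 * k1 + 1) * (1 / \<xi>\<^sup>2 * norm w)\<^sup>2)"
  proof (rule ctrl_mono[OF ctrl_cmult[OF ctrl_add[OF ctrl_der[OF der_cmult[OF der_multipliers(5), of "\<lambda>\<xi>. - (1/\<xi>^3)"]]
      ctrl_inner(1)[OF good_const[OF good_weak_y, where c = "\<i>"], of "\<lambda>\<xi> w. w$2" "\<lambda>\<xi>. 1/\<xi>^3"]], where c = 2]], goal_cases)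
    case 5
    from eventually_high show ?case
    proof eventually_elim
      case (elim \<xi>)
      then have x: "\<xi> \<noteq> 0" by auto
      show ?case
      proof
        fix w :: "complex ^ 7"
        have 1: "1/\<xi>^3 * ((\<i> * w$6) \<bullet> w$2) \<le> 1/2 * ((1/\<xi>\<^sup>2)\<^sup>2 * (w$6 \<bullet> w$6)) + 1/2 * ((1/\<xi>)\<^sup>2 * (w$2 \<bullet> w$2))"
          using young_inner[of "1/2" "1 / \<xi>\<^sup>2" "1/\<xi>" "\<i> * w$6" "w$2"] by (simp add: ii_inner eval_nat_numeral)
        have 3: "(1/\<xi>\<^sup>2)\<^sup>2 * (w$6 \<bullet> w$6) \<le> (1/\<xi>\<^sup>2)\<^sup>2 * (norm w)\<^sup>2"
          by (intro mult_left_mono norm_nth_inner_le) simp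
        have 4: "(1/\<xi>)\<^sup>2 * (w$2 \<bullet> w$2) = - (1/\<xi>^3) * (- \<xi> * (w$2 \<bullet> w$2) + (\<i> * w$4) \<bullet> w$2 + (\<i> * w$6) \<bullet> w$2 + k1 * \<xi> * (w$1 \<bullet> w$1))
           + 1/\<xi>^3 * ((\<i> * w$4) \<bullet> w$2) + 1/\<xi>^3 * ((\<i> * w$6) \<bullet> w$2) + k1 * ((1/\<xi>)\<^sup>2 * (w$1 \<bullet> w$1))"
          using x k by (simp add: field_simps eval_nat_numeral)
        have 5: "0 \<le> k1 * (1 / \<xi>\<^sup>2 * norm w)\<^sup>2" "0 \<le> (1/\<xi>)\<^sup>2 * (w$1 \<bullet> w$1)" using k by auto
        have 6: "(1/\<xi>\<^sup>2)\<^sup>2 * (norm w)\<^sup>2 = (1 / \<xi>\<^sup>2 * norm w)\<^sup>2"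
          by (simp add: power_mult_distrib power_divide)
        show "(1/\<xi>)\<^sup>2 * (w$2 \<bullet> w$2)
           - (2 * k1 + 1) * ((1/\<xi>)\<^sup>2 * (w$1 \<bullet> w$1)) - (2 * k1 + 1) * (1 / \<xi>\<^sup>2 * norm w)\<^sup>2
           \<le> 2 * (- (1/\<xi>^3) * (- \<xi> * (w$2 \<bullet> w$2) + (\<i> * w$4) \<bullet> w$2 + (\<i> * w$6) \<bullet> w$2 + k1 * \<xi> * (w$1 \<bullet> w$1))
            + 1/\<xi>^3 * ((\<i> * w$4) \<bullet> w$2))"
          by (rule arith[OF 1 3[unfolded 6] 4 5])
      qed
    qed
  qed (use k in \<open>(insert k, (intro qbd_inner bd_intros landau_o.big.sup; real_asymp)) | simp\<close>)+
qed (use k in auto)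

lemma good_weak_u: "good_weak (\<lambda>\<xi>. 1/\<xi>\<^sup>2) (\<lambda>\<xi> w. w$2)"
proof (rule good_step[OF der_cmult[OF der_multipliers(5), of "\<lambda>\<xi>. - (1/\<xi>^5)"], where C = 1 and
    Y = "\<lambda>\<xi> w. (1/\<xi>^5) * ((\<i> * w$4 + \<i> * w$6) \<bullet> w$2) + (k1/\<xi>^4) * (w$1 \<bullet> w$1)"], goal_cases)
  case 1
  show ?case by (intro qbd_inner bd_intros landau_o.big.sup; real_asymp)
next
  case 2
  show ?case
    by (intro ctrl_add ctrl_inner(1)[OF good_weak_v] bd_nth;
      (intro ctrl_inner_small bd_intros)?; (rule landau_o.big.sup landau_o.small.sup)?; real_asymp)
next
  case 4
  show ?case using eventually_nonzero by (rule eventually_mono) (use k in \<open>simp add: field_simps inner_add_left eval_nat_numeral\<close>)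
qed (use k in auto)

text \<open>The terms between \<open>u\<close> and \<open>\<theta>\<close> cancel, but
  \<open>k1 - k3\<close> leaves a product of \<open>v\<close> and \<open>\<phi>\<close> with
  coefficient of order \<open>\<xi>^-3\<close>. With weight \<open>1/\<xi>\<close> for
  \<open>v\<close> and \<open>\<mu> = 1/\<xi>^2\<close> this is exactly the admissible order, so the
  loss \<open>\<xi>^-4\<close> is what this term requires.\<close>

lemma good_weak_\<theta>: "good_weak (\<lambda>\<xi>. 1/\<xi>\<^sup>2) (\<lambda>\<xi> w. w$6)"
proof (rule good_step[OF der_cmult[OF der_add[OF der_multipliers(6,7)], of "\<lambda>\<xi>. 1/\<xi>^4"], where C = "1" and
    Y = "\<lambda>\<xi> w. (- (1/\<xi>^4)) * (w$4 \<bullet> w$6) + (k1/\<xi>^4) * (w$1 \<bullet> w$1)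
      + (-(k1 - k3)/\<xi>^3) * ((\<i> * w$1) \<bullet> w$5)"], goal_cases)
  case 1
  show ?case unfolding distrib_left by (intro qbd_add qbd_inner bd_intros landau_o.big.sup; real_asymp)
next
  case 2
  show ?case
    by (intro ctrl_add ctrl_inner(1)[OF good_weak_v] ctrl_inner(1)[OF good_const[OF good_weak_v]]
       ctrl_inner(1)[OF good_weak_y] bd_nth landau_o.big.sup; real_asymp)
next
  case 4
  show ?case using eventually_nonzero by (rule eventually_mono) (use k in \<open>simp add: field_simps eval_nat_numeral\<close>)
qed (use k in auto)

lemma good_weak_\<phi>: "good_weak (\<lambda>\<xi>. 1/\<xi>\<^sup>2) (\<lambda>\<xi> w. w$5)"
proof (rule good_step[OF der_cmult[OF der_multipliers(8), of "\<lambda>\<xi>. - (1/\<xi>^5)"], where C = "1/k3" and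
    Y = "\<lambda>\<xi> w. (- k1 / \<xi>^5) * ((\<i> * w$1) \<bullet> w$5) + (1/\<xi>^4) * (w$6 \<bullet> w$6)"], goal_cases)
  case 1
  show ?case by (intro qbd_inner bd_intros landau_o.big.sup; real_asymp)
next
  case 2
  show ?case
    by (intro ctrl_add ctrl_inner(1)[OF good_weak_\<theta>] ctrl_inner(1)[OF good_const[OF good_weak_v]] bd_nth landau_o.big.sup; real_asymp)
next
  case 4
  show ?case using eventually_nonzero by (rule eventually_mono) (use k in \<open>simp add: field_simps eval_nat_numeral\<close>)
qed (use k in auto)

lemma good_weak_z: "good_weak (\<lambda>\<xi>. 1/\<xi>\<^sup>2) (\<lambda>\<xi> w. w$3)"
proof (rule good_step[OF der_cmult[OF der_multipliers(2), of "\<lambda>\<xi>. - (1/\<xi>^5)"], where C = "1/k2" and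
    Y = "\<lambda>\<xi> w. (- k1 / \<xi>^5) * ((\<i> * w$1) \<bullet> w$3) + (\<gamma>/\<xi>^4) * (w$7 \<bullet> w$3) + (1/\<xi>^4) * (w$4 \<bullet> w$4)"], goal_cases)
  case 1
  show ?case by (intro qbd_inner bd_intros landau_o.big.sup; real_asymp)
next
  case 2
  show ?case
    by (intro ctrl_add ctrl_inner(1)[OF good_7] ctrl_inner(1)[OF good_weak_y]
       ctrl_inner(1)[OF good_const[OF good_weak_v]] bd_nth landau_o.big.sup; real_asymp)
next
  case 4
  show ?case using eventually_nonzero by (rule eventually_mono) (use k in \<open>simp add: field_simps eval_nat_numeral\<close>)
qed (use k in auto)

lemma ctrl_high: "ctrl (sup at_top at_bot) (\<lambda>\<xi>. 1/\<xi>\<^sup>2) (\<lambda>\<xi> w. (1/\<xi>\<^sup>2 * norm w)\<^sup>2)"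
  by (intro ctrl_norm good_weak_u good_weak_z good_weak_\<theta> good_weak_\<phi> good_mono[OF good_weak_y]
    good_mono[OF good_weak_v] good_mono[OF good_7] landau_o.big.sup; real_asymp)

subsection \<open>Intermediate frequencies\<close>

lemma good_cong:
  assumes "good Fl \<mu> a l" "\<forall>\<^sub>F \<xi> in Fl. \<forall>w. l \<xi> w = l' \<xi> w"
  shows "good Fl \<mu> a l'"
  unfolding good_def
  by (rule ctrl_mono[OF assms(1)[unfolded good_def]]) (use assms(2) in \<open>auto elim: eventually_mono\<close>)

text \<open>If \<open>l\<close> is controlled by the dissipation and \<open>l' = p + r\<close> with \<open>r\<close> controlled, then so is \<open>p\<close>:
  test the equation for \<open>l\<close> with \<open>p\<close>.\<close>

lemma good_derivative:
  assumes l: "good Fl (\<lambda>_. 1) (\<lambda>_. 1) l" "der l (\<lambda>\<xi> w. p \<xi> w + r \<xi> w)" "der p s"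
    and r: "good Fl (\<lambda>_. 1) (\<lambda>_. 1) r" and bd: "bd Fl l" "bd Fl p" "bd Fl s"
  shows "good Fl (\<lambda>_. 1) (\<lambda>_. 1) p"
proof (rule good_step[OF der_cmult[OF der_inner[OF l(2,3)], of "\<lambda>_. 1"], where C = 1 and
    Y = "\<lambda>\<xi> w. - 1 * (l \<xi> w \<bullet> s \<xi> w) + - 1 * (r \<xi> w \<bullet> p \<xi> w)"], goal_cases)
  case 1
  show ?case by (intro qbd_inner bd) simp
next
  case 2
  show ?case by (intro ctrl_add ctrl_inner(1)[OF l(1)] ctrl_inner(1)[OF r] bd) simp_all
qed (auto simp: inner_add_left)

context
  fixes a b :: real and S
  assumes a: "0 < a" and S: "S = {a..b} \<union> {-b..-a}"
begin

lemma bigo_mid: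
  fixes c :: "real \<Rightarrow> 'a::real_normed_vector"
  assumes "continuous_on S c"
  shows "(\<lambda>\<xi>. norm (c \<xi>)) \<in> O[principal S](\<lambda>_. 1)"
proof -
  have "compact S" unfolding S by (intro compact_Un compact_Icc)
  then have "bounded (c ` S)" using compact_continuous_image[OF assms] compact_imp_bounded by blast
  then obtain B where "\<forall>x\<in>S. norm (c x) \<le> B" unfolding bounded_iff by auto
  then show ?thesis by (intro bigoI[of _ B]) (auto simp: eventually_principal)
qed

lemma nonzero_mid: "\<xi> \<in> S \<Longrightarrow> \<xi> \<noteq> 0"
  using a by (auto simp: S)

abbreviation "good_mid \<equiv> good (principal S) (\<lambda>_. 1) (\<lambda>_. 1)"

lemma good_mid_cmult: "good_mid l \<Longrightarrow> continuous_on S c \<Longrightarrow> good_mid (\<lambda>\<xi> w. c \<xi> * l \<xi> w)"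
  by (erule good_cmult) (simp add: bigo_mid)

lemma good_mid_cancel:
  assumes "good_mid (\<lambda>\<xi> w. c \<xi> * l \<xi> w)" "continuous_on S c" "\<And>\<xi>. \<xi> \<in> S \<Longrightarrow> c \<xi> \<noteq> 0"
  shows "good_mid l"
  by (rule good_cong[OF good_mid_cmult[OF assms(1), of "\<lambda>\<xi>. 1 / c \<xi>"]])
     (use assms in \<open>auto intro!: continuous_intros simp: eventually_principal\<close>)

lemma bd_mid: "bd (principal S) l \<Longrightarrow> continuous_on S c \<Longrightarrow> bd (principal S) (\<lambda>\<xi> w. c \<xi> * l \<xi> w)"
  by (erule bd_cmult) (rule bigo_mid)

lemmas bd_mid_intros = bd_nth bd_add bd_diff bd_mid

text \<open>Observability of the whole state from \<open>\<eta>\<close>: each differentiation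
  exposes one new linear form, in turn \<open>y\<close>, \<open>k2 D z - k1 v\<close>,
  \<open>D u + \<theta>\<close> and so on, with \<open>D = i\<xi>\<close>. On \<open>S\<close> all
  coefficients are bounded, and the only factors to be divided out are non-zero constants times
  powers of \<open>\<xi>\<close>, so no weight is lost.\<close>

lemma ctrl_mid: "ctrl (principal S) (\<lambda>_. 1) (\<lambda>\<xi> w. (1 * norm w)\<^sup>2)"
proof -
  let ?D = "\<lambda>\<xi>. \<i> * complex_of_real \<xi>"
  have 7: "good_mid (\<lambda>\<xi> w. w$7)"
  proof (rule good_mono[OF good_7], rule bigoI)
    show "\<forall>\<^sub>F \<xi> in principal S. norm (1::real) \<le> 1 / a * norm \<xi>"
      unfolding eventually_principal using a by (auto simp: S field_simps)
  qed
  have "good_mid (\<lambda>\<xi> w. - \<gamma> * ?D \<xi> * w$4)"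
  proof (rule good_derivative[OF 7])
    show "der (\<lambda>\<xi> w. w$7) (\<lambda>\<xi> w. - \<gamma> * ?D \<xi> * w$4 + k4 * (?D \<xi>)\<^sup>2 * w$7)"
      by (rule der_eq[OF der_nth(7)]) simp
    show "der (\<lambda>\<xi> w. - \<gamma> * ?D \<xi> * w$4) (\<lambda>\<xi> w. - \<gamma> * ?D \<xi> * (k2 * (?D \<xi> * w$3) - k1 * w$1 - \<gamma> * (?D \<xi> * w$7)))"
      by (intro der_intros)
    show "good_mid (\<lambda>\<xi> w. k4 * (?D \<xi>)\<^sup>2 * w$7)"
      by (intro good_mid_cmult 7 continuous_intros)
  qed (intro bd_mid_intros continuous_intros)+
  then have 4: "good_mid (\<lambda>\<xi> w. w$4)"
    by (rule good_mid_cancel) (use k nonzero_mid in \<open>auto intro!: continuous_intros\<close>)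
  have p1: "good_mid (\<lambda>\<xi> w. k2 * ?D \<xi> * w$3 - k1 * w$1)"
  proof (rule good_derivative[OF 4])
    show "der (\<lambda>\<xi> w. w$4) (\<lambda>\<xi> w. (k2 * ?D \<xi> * w$3 - k1 * w$1) + (- \<gamma> * ?D \<xi>) * w$7)"
      by (rule der_eq[OF der_nth(4)]) simp
    show "der (\<lambda>\<xi> w. k2 * ?D \<xi> * w$3 - k1 * w$1)
      (\<lambda>\<xi> w. k2 * ?D \<xi> * (?D \<xi> * w$4) - k1 * (?D \<xi> * w$2 + w$4 + w$6))"
      by (intro der_intros)
    show "good_mid (\<lambda>\<xi> w. - \<gamma> * ?D \<xi> * w$7)"
      by (intro good_mid_cmult 7 continuous_intros)
  qed (intro bd_mid_intros continuous_intros)+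
  have "good_mid (\<lambda>\<xi> w. - k1 * (?D \<xi> * w$2 + w$6))"
  proof (rule good_derivative[OF p1])
    show "der (\<lambda>\<xi> w. k2 * ?D \<xi> * w$3 - k1 * w$1)
      (\<lambda>\<xi> w. - k1 * (?D \<xi> * w$2 + w$6) + (k2 * ?D \<xi> * ?D \<xi> - k1) * w$4)"
      by (rule der_eq, (rule der_intros)+) (simp add: algebra_simps)
    show "der (\<lambda>\<xi> w. - k1 * (?D \<xi> * w$2 + w$6)) (\<lambda>\<xi> w. - k1 * (?D \<xi> * (k1 * (?D \<xi> * w$1)) + (k3 * (?D \<xi> * w$5) - k1 * w$1)))"
      by (intro der_intros)
    show "good_mid (\<lambda>\<xi> w. (k2 * ?D \<xi> * ?D \<xi> - k1) * w$4)"
      by (intro good_mid_cmult 4 continuous_intros)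
  qed (intro bd_mid_intros continuous_intros)+
  then have p2: "good_mid (\<lambda>\<xi> w. ?D \<xi> * w$2 + w$6)"
    by (rule good_mid_cancel) (use k in auto)
  have zero: "good_mid (\<lambda>\<xi> w. 0 * w$7)" by (rule good_const[OF 7])
  have p3: "good_mid (\<lambda>\<xi> w. (k1 * ?D \<xi> * ?D \<xi> - k1) * w$1 + k3 * ?D \<xi> * w$5)"
  proof (rule good_derivative[OF p2 _ _ zero])
    show "der (\<lambda>\<xi> w. ?D \<xi> * w$2 + w$6) (\<lambda>\<xi> w. (k1 * ?D \<xi> * ?D \<xi> - k1) * w$1 + k3 * ?D \<xi> * w$5 + 0 * w$7)"
      by (rule der_eq, (rule der_intros)+) (simp add: algebra_simps)
    show "der (\<lambda>\<xi> w. (k1 * ?D \<xi> * ?D \<xi> - k1) * w$1 + k3 * ?D \<xi> * w$5)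
       (\<lambda>\<xi> w. (k1 * ?D \<xi> * ?D \<xi> - k1) * (?D \<xi> * w$2 + w$4 + w$6) + k3 * ?D \<xi> * (?D \<xi> * w$6))"
      by (intro der_intros)
  qed (intro bd_mid_intros continuous_intros)+
  \<comment> \<open>Here the chain breaks open: in the derivative of the previous form
    \<open>u\<close> occurs only through \<open>D u + \<theta>\<close>, which is already controlled,
    so \<open>\<theta>\<close> is left by itself.\<close>
  have "good_mid (\<lambda>\<xi> w. k3 * ?D \<xi> * ?D \<xi> * w$6)"
  proof (rule good_derivative[OF p3])
    show "der (\<lambda>\<xi> w. (k1 * ?D \<xi> * ?D \<xi> - k1) * w$1 + k3 * ?D \<xi> * w$5)
       (\<lambda>\<xi> w. k3 * ?D \<xi> * ?D \<xi> * w$6 + (k1 * ?D \<xi> * ?D \<xi> - k1) * (?D \<xi> * w$2 + w$6 + w$4))"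
      by (rule der_eq, (rule der_intros)+) (simp add: algebra_simps)
    show "der (\<lambda>\<xi> w. k3 * ?D \<xi> * ?D \<xi> * w$6) (\<lambda>\<xi> w. k3 * ?D \<xi> * ?D \<xi> * (k3 * (?D \<xi> * w$5) - k1 * w$1))"
      by (intro der_intros)
    show "good_mid (\<lambda>\<xi> w. (k1 * ?D \<xi> * ?D \<xi> - k1) * (?D \<xi> * w$2 + w$6 + w$4))"
      by (intro good_mid_cmult good_add[OF p2 4] continuous_intros)
  qed (intro bd_mid_intros continuous_intros)+
  then have 6: "good_mid (\<lambda>\<xi> w. w$6)"
    by (rule good_mid_cancel) (use k nonzero_mid in \<open>auto intro!: continuous_intros\<close>)
  have "good_mid (\<lambda>\<xi> w. ?D \<xi> * w$2)"
    by (rule good_cong[OF good_diff[OF p2 6]]) simp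
  then have 2: "good_mid (\<lambda>\<xi> w. w$2)"
    by (rule good_mid_cancel) (use k nonzero_mid in \<open>auto intro!: continuous_intros\<close>)
  have p4: "good_mid (\<lambda>\<xi> w. k3 * ?D \<xi> * w$5 - k1 * w$1)"
  proof (rule good_derivative[OF 6 _ _ zero])
    show "der (\<lambda>\<xi> w. w$6) (\<lambda>\<xi> w. k3 * ?D \<xi> * w$5 - k1 * w$1 + 0 * w$7)"
      by (rule der_eq[OF der_nth(6)]) simp
    show "der (\<lambda>\<xi> w. k3 * ?D \<xi> * w$5 - k1 * w$1)
      (\<lambda>\<xi> w. k3 * ?D \<xi> * (?D \<xi> * w$6) - k1 * (?D \<xi> * w$2 + w$4 + w$6))"
      by (intro der_intros)
  qed (intro bd_mid_intros continuous_intros)+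
  have "good_mid (\<lambda>\<xi> w. k1 * ?D \<xi> * ?D \<xi> * w$1)"
    by (rule good_cong[OF good_diff[OF p3 p4]]) (simp add: algebra_simps)
  then have 1: "good_mid (\<lambda>\<xi> w. w$1)"
    by (rule good_mid_cancel) (use k nonzero_mid in \<open>auto intro!: continuous_intros\<close>)
  have "good_mid (\<lambda>\<xi> w. k3 * ?D \<xi> * w$5)"
    by (rule good_cong[OF good_add[OF p4 good_const[OF 1, where c = k1]]]) simp
  then have 5: "good_mid (\<lambda>\<xi> w. w$5)"
    by (rule good_mid_cancel) (use k nonzero_mid in \<open>auto intro!: continuous_intros\<close>)
  have "good_mid (\<lambda>\<xi> w. k2 * ?D \<xi> * w$3)"
    by (rule good_cong[OF good_add[OF p1 good_const[OF 1, where c = k1]]]) simp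
  then have 3: "good_mid (\<lambda>\<xi> w. w$3)"
    by (rule good_mid_cancel) (use k nonzero_mid in \<open>auto intro!: continuous_intros\<close>)
  show ?thesis by (intro ctrl_norm 1 2 3 4 5 6 7)
qed

end

subsection \<open>Decay of the Fourier transform\<close>

text \<open>The Lyapunov functional is a large multiple of the energy minus the functional
  \<open>F\<close> that comes with the control. Choosing the small multiple as \<open>1/2\<close>
  leaves half of \<open>\<lambda> |W|^2\<close> as genuine decay.\<close>

lemma decay_of_ctrl:
  assumes "ctrl Fl \<mu> (\<lambda>\<xi> w. (\<mu> \<xi> * norm w)\<^sup>2)"
  obtains C c where "C > 0" "c > 0" "\<forall>\<^sub>F \<xi> in Fl. \<forall>W t. ode \<xi> W \<longrightarrow> t \<ge> 0 \<longrightarrow>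
    (norm (W t))\<^sup>2 \<le> C * exp (- c * (\<mu> \<xi>)\<^sup>2 * t) * (norm (W 0))\<^sup>2"
proof -
  obtain C0 F G where FG: "der F G" and ev: "\<forall>\<^sub>F \<xi> in Fl. \<forall>w. \<bar>F \<xi> w\<bar> \<le> C0 * (norm w)\<^sup>2 \<and>
     (\<mu> \<xi> * norm w)\<^sup>2 \<le> G \<xi> w + C0 * \<xi>\<^sup>2 * (w$7 \<bullet> w$7) + 1/2 * (\<mu> \<xi> * norm w)\<^sup>2"
    using assms[unfolded ctrl_def, rule_format, OF half_gt_zero[OF zero_less_one]] by blast
  obtain m M where mM: "m > 0" "M > 0" "\<And>w. m * (norm w)\<^sup>2 \<le> energy w" "\<And>w. energy w \<le> M * (norm w)\<^sup>2"
    using energy_bounds by blast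
  \<comment> \<open>The first summand makes \<open>K energy - F\<close> dominate the squared norm;
    the second makes the energy dissipation \<open>2 k4 K\<close> outweigh the constant
    \<open>C0\<close> in the control.\<close>
  define K where "K = (\<bar>C0\<bar> + 1) / m + \<bar>C0\<bar> / (2 * k4)"
  define B where "B = K * M + \<bar>C0\<bar> + 1"
  have K: "K > 0" unfolding K_def using mM k by (intro add_pos_nonneg) auto
  have B: "B \<ge> 1" unfolding B_def using K mM by simp
  have K1: "K * m \<ge> \<bar>C0\<bar> + 1" unfolding K_def using mM k by (simp add: field_simps)
  have K2: "2 * k4 * K \<ge> C0"
  proof -
    have "C0 \<le> 2 * k4 * (\<bar>C0\<bar> / (2 * k4))" using k by simp
    also have "\<dots> \<le> 2 * k4 * K" unfolding K_def using mM k by (intro mult_left_mono) auto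
    finally show ?thesis .
  qed
  define L where "L \<xi> w = K * energy w - F \<xi> w" for \<xi> w
  have dL: "der L (\<lambda>\<xi> w. K * (- 2 * k4 * \<xi>\<^sup>2 * (w$7 \<bullet> w$7)) - G \<xi> w)"
    unfolding L_def by (intro der_diff der_cmult der_energy FG)
  define c where "c = 1 / (2 * B)"
  have c: "c > 0" unfolding c_def using B by simp
  have "\<forall>\<^sub>F \<xi> in Fl. \<forall>W t. ode \<xi> W \<longrightarrow> t \<ge> 0 \<longrightarrow>
    (norm (W t))\<^sup>2 \<le> B * exp (- c * (\<mu> \<xi>)\<^sup>2 * t) * (norm (W 0))\<^sup>2"
    using ev
  proof eventually_elim
    case (elim \<xi>)
    have lower: "(norm w)\<^sup>2 \<le> L \<xi> w" for w
    proof -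
      have "(\<bar>C0\<bar> + 1) * (norm w)\<^sup>2 \<le> K * m * (norm w)\<^sup>2" by (intro mult_right_mono K1) simp
      also have "\<dots> \<le> K * energy w" using mM(3)[of w] K by simp
      finally have "(\<bar>C0\<bar> + 1) * (norm w)\<^sup>2 \<le> K * energy w" .
      moreover have "F \<xi> w \<le> C0 * (norm w)\<^sup>2" using elim[rule_format, of w] by linarith
      moreover have "C0 * (norm w)\<^sup>2 \<le> \<bar>C0\<bar> * (norm w)\<^sup>2" by (intro mult_right_mono) auto
      ultimately show ?thesis unfolding L_def by (simp add: distrib_right)
    qed
    have upper: "L \<xi> w \<le> B * (norm w)\<^sup>2" for w
    proof -
      have "K * energy w \<le> K * (M * (norm w)\<^sup>2)" using mM(4)[of w] K by simp
      moreover have "- F \<xi> w \<le> C0 * (norm w)\<^sup>2" using elim[rule_format, of w] by linarith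
      moreover have "C0 * (norm w)\<^sup>2 \<le> \<bar>C0\<bar> * (norm w)\<^sup>2" by (intro mult_right_mono) auto
      moreover have "0 \<le> (norm w)\<^sup>2" by simp
      ultimately show ?thesis unfolding L_def B_def distrib_right mult.assoc mult_1_left by linarith
    qed
    have diss: "K * (- 2 * k4 * \<xi>\<^sup>2 * (w$7 \<bullet> w$7)) - G \<xi> w \<le> - (c * (\<mu> \<xi>)\<^sup>2) * L \<xi> w" for w
    proof -
      have "c * (\<mu> \<xi>)\<^sup>2 * L \<xi> w \<le> c * (\<mu> \<xi>)\<^sup>2 * (B * (norm w)\<^sup>2)" using upper[of w] c by (intro mult_left_mono) auto
      also have "\<dots> = 1/2 * (\<mu> \<xi> * norm w)\<^sup>2" unfolding c_def using B by (simp add: power_mult_distrib)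
      finally have 1: "c * (\<mu> \<xi>)\<^sup>2 * L \<xi> w \<le> 1/2 * (\<mu> \<xi> * norm w)\<^sup>2" .
      have "C0 * (\<xi>\<^sup>2 * (w$7 \<bullet> w$7)) \<le> 2 * k4 * K * (\<xi>\<^sup>2 * (w$7 \<bullet> w$7))" by (intro mult_right_mono K2) simp
      moreover have "(\<mu> \<xi> * norm w)\<^sup>2 \<le> G \<xi> w + C0 * \<xi>\<^sup>2 * (w$7 \<bullet> w$7) + 1/2 * (\<mu> \<xi> * norm w)\<^sup>2"
        using elim by blast
      ultimately show ?thesis using 1 by (simp add: mult_ac)
    qed
    show ?case
    proof (intro allI impI)
      fix W and t :: real assume W: "ode \<xi> W" and t: "t \<ge> 0"
      show "(norm (W t))\<^sup>2 \<le> B * exp (- c * (\<mu> \<xi>)\<^sup>2 * t) * (norm (W 0))\<^sup>2"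
      proof (cases "t = 0")
        case True
        then show ?thesis using mult_right_mono[OF B, of "(norm (W 0))\<^sup>2"] by simp
      next
        case False
        define r where "r = c * (\<mu> \<xi>)\<^sup>2"
        \<comment> \<open>The equation holds only at positive times, so the decay is first proved
          from a starting time \<open>s > 0\<close>. The initial value enters afterwards, by letting
          \<open>s\<close> tend to 0 and using continuity there.\<close>
        have step: "(norm (W t))\<^sup>2 \<le> B * exp (- r * (t - s)) * (norm (W s))\<^sup>2" if s: "0 < s" "s \<le> t" for s
        proof -
          have "\<exists>y. ((\<lambda>\<tau>. exp (r * \<tau>) * L \<xi> (W \<tau>)) has_real_derivative y) (at x) \<and> y \<le> 0" if "s \<le> x" "x \<le> t" for x
          proof -
            have "x > 0" using that s by simp
            then have "((\<lambda>\<tau>. L \<xi> (W \<tau>)) has_real_derivative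
                (K * (- 2 * k4 * \<xi>\<^sup>2 * (W x$7 \<bullet> W x$7)) - G \<xi> (W x))) (at x)" (is "(_ has_real_derivative ?d) _")
              using dL W unfolding der_def has_real_derivative_iff_has_vector_derivative by blast
            then have "((\<lambda>\<tau>. exp (r * \<tau>) * L \<xi> (W \<tau>)) has_real_derivative
               (exp (r * x) * (?d + r * L \<xi> (W x)))) (at x)"
              by (auto intro!: derivative_eq_intros simp: algebra_simps)
            moreover have "exp (r * x) * (?d + r * L \<xi> (W x)) \<le> 0"
              using diss[of "W x"] unfolding r_def by (intro mult_nonneg_nonpos) auto
            ultimately show ?thesis by blast
          qed
          from DERIV_nonpos_imp_nonincreasing[OF s(2) this]
          have "exp (r * t) * L \<xi> (W t) \<le> exp (r * s) * L \<xi> (W s)" .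
          then have "L \<xi> (W t) \<le> exp (r * s) * L \<xi> (W s) / exp (r * t)"
            by (simp add: field_simps)
          also have "\<dots> = exp (- r * (t - s)) * L \<xi> (W s)"
            by (simp add: exp_diff[symmetric] field_simps exp_minus) (simp add: exp_diff exp_minus field_simps)
          also have "\<dots> \<le> exp (- r * (t - s)) * (B * (norm (W s))\<^sup>2)" using upper by simp
          finally show ?thesis using lower[of "W t"] by (simp add: mult_ac)
        qed
        have "(W \<longlongrightarrow> W 0) (at 0 within {0..})"
          using W unfolding laminated_ode_def continuous_on_def by auto
        then have W0: "(W \<longlongrightarrow> W 0) (at_right 0)" by (rule tendsto_within_subset) auto
        have "((\<lambda>s. B * exp (- r * (t - s)) * (norm (W s))\<^sup>2) \<longlongrightarrow> B * exp (- r * (t - 0)) * (norm (W 0))\<^sup>2) (at_right 0)"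
          by (intro tendsto_intros W0)
        moreover have "\<forall>\<^sub>F s in at_right 0. (norm (W t))\<^sup>2 \<le> B * exp (- r * (t - s)) * (norm (W s))\<^sup>2"
          unfolding eventually_at_right_field using t False step by (intro exI[of _ t]) simp
        ultimately have "(norm (W t))\<^sup>2 \<le> B * exp (- r * (t - 0)) * (norm (W 0))\<^sup>2"
          by (intro tendsto_lowerbound) auto
        then show ?thesis unfolding r_def by simp
      qed
    qed
  qed
  with B c show thesis by (intro that[of B c]) auto
qed

text \<open>With \<open>\<mu> = 0\<close> the decay factor is 1, and the filter \<open>top\<close>
  makes the bound hold at every frequency, including 0, which the filter \<open>at 0\<close> leaves
  out.\<close>

lemma energy_nonincreasing:
  obtains C where "C > 0" "\<And>\<xi> W t. ode \<xi> W \<Longrightarrow> t \<ge> 0 \<Longrightarrow>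
    (norm (W t))\<^sup>2 \<le> C * (norm (W 0))\<^sup>2"
proof -
  have "ctrl top (\<lambda>_. 0) (\<lambda>\<xi> w. (0 * norm w)\<^sup>2)" by (simp add: ctrl_0)
  then show thesis
  proof (rule decay_of_ctrl, goal_cases)
    case (1 C c)
    then show thesis by (intro that[of C]) simp_all
  qed
qed

text \<open>Control near 0 and near infinity leaves a compact set of frequencies away from 0,
  covered by the intermediate estimate, and the point 0, where the rate \<open>\<xi>^4\<close>
  vanishes and boundedness is enough. Constants are added and rates minimised; the thresholds need
  not be compared with 1, because on \<open>|\<xi>| \<le> 1\<close> every other rate is at least
  \<open>\<xi>^4\<close>, and on \<open>|\<xi>| \<ge> 1\<close> at least
  \<open>1/\<xi>^4\<close>.\<close>

lemma fourier_decay: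
  obtains C c where "C > 0" "c > 0"
    "\<And>\<xi> W t. ode \<xi> W \<Longrightarrow> t \<ge> 0 \<Longrightarrow> \<bar>\<xi>\<bar> \<le> 1 \<Longrightarrow>
       (norm (W t))\<^sup>2 \<le> C * exp (- c * \<xi>^4 * t) * (norm (W 0))\<^sup>2"
    "\<And>\<xi> W t. ode \<xi> W \<Longrightarrow> t \<ge> 0 \<Longrightarrow> 1 \<le> \<bar>\<xi>\<bar> \<Longrightarrow>
       (norm (W t))\<^sup>2 \<le> C * exp (- c * (1 / \<xi>^4) * t) * (norm (W 0))\<^sup>2"
    "\<And>\<xi> W t. k1 = k2 \<Longrightarrow> k2 = k3 \<Longrightarrow> ode \<xi> W \<Longrightarrow> t \<ge> 0 \<Longrightarrow> 1 \<le> \<bar>\<xi>\<bar> \<Longrightarrow>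
       (norm (W t))\<^sup>2 \<le> C * exp (- c * t) * (norm (W 0))\<^sup>2"
proof -
  obtain C0 where C0: "C0 > 0" "\<And>\<xi> W t. ode \<xi> W \<Longrightarrow> t \<ge> 0 \<Longrightarrow>
    (norm (W t))\<^sup>2 \<le> C0 * (norm (W 0))\<^sup>2" by (rule energy_nonincreasing) (rule that)
  obtain C1 c1 where 1: "C1 > 0" "c1 > 0" "\<forall>\<^sub>F \<xi> in at 0. \<forall>W t. ode \<xi> W \<longrightarrow> t \<ge> 0 \<longrightarrow>
    (norm (W t))\<^sup>2 \<le> C1 * exp (- c1 * (\<xi>\<^sup>2)\<^sup>2 * t) * (norm (W 0))\<^sup>2"
    using decay_of_ctrl[OF ctrl_low] by blast
  then obtain d where d: "d > 0" "\<And>\<xi> W t. \<xi> \<noteq> 0 \<Longrightarrow> \<bar>\<xi>\<bar> < d \<Longrightarrow> ode \<xi> W \<Longrightarrow> t \<ge> 0 \<Longrightarrow>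
    (norm (W t))\<^sup>2 \<le> C1 * exp (- c1 * (\<xi>\<^sup>2)\<^sup>2 * t) * (norm (W 0))\<^sup>2"
    unfolding eventually_at by (auto simp: dist_real_def)
  obtain C2 c2 where 2: "C2 > 0" "c2 > 0" "\<forall>\<^sub>F \<xi> in sup at_top at_bot. \<forall>W t. ode \<xi> W \<longrightarrow> t \<ge> 0 \<longrightarrow>
    (norm (W t))\<^sup>2 \<le> C2 * exp (- c2 * (1/\<xi>\<^sup>2)\<^sup>2 * t) * (norm (W 0))\<^sup>2"
    using decay_of_ctrl[OF ctrl_high] by blast
  have "\<exists>C>0. \<exists>c>0. k1 = k2 \<longrightarrow> k2 = k3 \<longrightarrow> (\<forall>\<^sub>F \<xi> in sup at_top at_bot. \<forall>W t. ode \<xi> W \<longrightarrow> t \<ge> 0 \<longrightarrow>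
    (norm (W t))\<^sup>2 \<le> C * exp (- c * 1\<^sup>2 * t) * (norm (W 0))\<^sup>2)"
  proof (cases "k1 = k2 \<and> k2 = k3")
    case True
    then have "k1 = k2" "k2 = k3" by auto
    from decay_of_ctrl[OF ctrl_high_equal[OF this]] show ?thesis by blast
  next
    case False
    then show ?thesis by (intro exI[of _ "1::real"] conjI) simp_all
  qed
  then obtain C3 c3 where 3: "C3 > 0" "c3 > 0" "k1 = k2 \<longrightarrow> k2 = k3 \<longrightarrow> (\<forall>\<^sub>F \<xi> in sup at_top at_bot. \<forall>W t. ode \<xi> W \<longrightarrow> t \<ge> 0 \<longrightarrow>
    (norm (W t))\<^sup>2 \<le> C3 * exp (- c3 * 1\<^sup>2 * t) * (norm (W 0))\<^sup>2)" by blast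
  have ex: "\<exists>R. \<forall>\<xi>. R \<le> \<bar>\<xi>\<bar> \<longrightarrow> P \<xi>" if "\<forall>\<^sub>F \<xi> in sup at_top at_bot. P \<xi>" for P :: "real \<Rightarrow> bool"
  proof -
    have P: "eventually P at_top" "eventually P at_bot" using that by (auto simp: eventually_sup)
    obtain x where x: "\<And>z. x \<le> z \<Longrightarrow> P z" using P(1) unfolding eventually_at_top_linorder by auto
    obtain y where y: "\<And>z. z \<le> y \<Longrightarrow> P z" using P(2) unfolding eventually_at_bot_linorder by auto
    have "P \<xi>" if "\<bar>x\<bar> + \<bar>y\<bar> \<le> \<bar>\<xi>\<bar>" for \<xi>
    proof (cases "\<xi> \<ge> 0")
      case True
      then show ?thesis using that by (intro x) linarith
    next
      case False
      then show ?thesis using that by (intro y) linarith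
    qed
    then show ?thesis by blast
  qed
  obtain R where R: "\<And>\<xi> W t. R \<le> \<bar>\<xi>\<bar> \<Longrightarrow> ode \<xi> W \<Longrightarrow> t \<ge> 0 \<Longrightarrow>
    (norm (W t))\<^sup>2 \<le> C2 * exp (- c2 * (1/\<xi>\<^sup>2)\<^sup>2 * t) * (norm (W 0))\<^sup>2"
    using ex[OF 2(3)] by blast
  obtain R' where R': "\<And>\<xi> W t. k1 = k2 \<Longrightarrow> k2 = k3 \<Longrightarrow> R' \<le> \<bar>\<xi>\<bar> \<Longrightarrow> ode \<xi> W \<Longrightarrow> t \<ge> 0 \<Longrightarrow>
    (norm (W t))\<^sup>2 \<le> C3 * exp (- c3 * 1\<^sup>2 * t) * (norm (W 0))\<^sup>2"
  proof (cases "k1 = k2 \<and> k2 = k3")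
    case True
    then show ?thesis using ex 3(3) that by blast
  next
    case False
    then show ?thesis by (intro that) simp
  qed
  define Q where "Q = max R R'"
  obtain C4 c4 where 4: "C4 > 0" "c4 > 0" "\<And>\<xi> W t. d \<le> \<bar>\<xi>\<bar> \<Longrightarrow> \<bar>\<xi>\<bar> \<le> Q \<Longrightarrow> ode \<xi> W \<Longrightarrow> t \<ge> 0 \<Longrightarrow>
    (norm (W t))\<^sup>2 \<le> C4 * exp (- c4 * 1\<^sup>2 * t) * (norm (W 0))\<^sup>2"
  proof (rule decay_of_ctrl[OF ctrl_mid[OF d(1) refl, of Q]], goal_cases)
    case (1 C c)
    have mem: "\<xi> \<in> {d..Q} \<union> {- Q..- d}" if "d \<le> \<bar>\<xi>\<bar>" "\<bar>\<xi>\<bar> \<le> Q" for \<xi>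
      using that by (auto simp: abs_if split: if_splits)
    show ?case
    proof (rule 1(1)[OF 1(2,3)])
      fix \<xi> W and t :: real
      assume "d \<le> \<bar>\<xi>\<bar>" "\<bar>\<xi>\<bar> \<le> Q" "ode \<xi> W" "t \<ge> 0"
      then show "(norm (W t))\<^sup>2 \<le> C * exp (- c * 1\<^sup>2 * t) * (norm (W 0))\<^sup>2"
        using 1(4)[unfolded eventually_principal, THEN bspec, OF mem] by blast
    qed
  qed
  define C where "C = C0 + C1 + C2 + C3 + C4"
  define c where "c = min (min c1 c2) (min c3 c4)"
  have C: "C > 0" "C0 \<le> C" "C1 \<le> C" "C2 \<le> C" "C3 \<le> C" "C4 \<le> C" and c: "c > 0" "c \<le> c1" "c \<le> c2" "c \<le> c3" "c \<le> c4"
    unfolding C_def c_def using 1(1,2) 2(1,2) 3(1,2) 4(1,2) C0(1)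
    by (simp_all add: min.coboundedI1 min.coboundedI2)
  have mono: "x \<le> C * exp (- c * r' * t) * y" if "x \<le> C' * exp (- c' * r * t) * y" "C' \<le> C" "c \<le> c'" "0 \<le> r'" "r' \<le> r" "0 \<le> t" "0 \<le> y"
    for x C' c' r r' t y :: real
  proof -
    have "c * r' \<le> c' * r" using that c by (intro mult_mono) auto
    then have "c * r' * t \<le> c' * r * t" using that by (intro mult_right_mono) auto
    then have "C' * exp (- c' * r * t) \<le> C * exp (- c * r' * t)" using that C
      by (intro mult_mono) auto
    from order_trans[OF that(1) mult_right_mono[OF this that(7)]] show ?thesis .
  qed
  have e4: "\<xi>^4 = (\<xi>\<^sup>2)\<^sup>2" "1/\<xi>^4 = (1/\<xi>\<^sup>2)\<^sup>2" for \<xi> :: real by (auto simp: power_divide)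
  show thesis
  proof (rule that[OF C(1) c(1)])
    fix \<xi> W and t :: real assume W: "ode \<xi> W" "t \<ge> 0"
    { assume x: "\<bar>\<xi>\<bar> \<le> 1"
      then have x4: "\<xi>^4 \<le> 1" using power_le_one[of "\<bar>\<xi>\<bar>" 4] by simp
      consider "\<xi> = 0" | "\<xi> \<noteq> 0" "\<bar>\<xi>\<bar> < d" | "d \<le> \<bar>\<xi>\<bar>" "\<bar>\<xi>\<bar> \<le> Q" | "Q \<le> \<bar>\<xi>\<bar>" by linarith
      then show "(norm (W t))\<^sup>2 \<le> C * exp (- c * \<xi>^4 * t) * (norm (W 0))\<^sup>2"
      proof cases
        case 1
        then show ?thesis using C0(2)[OF W] mult_right_mono[OF C(2), of "(norm (W 0))\<^sup>2"] by simp
      next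
        case 2
        show ?thesis unfolding e4(1) by (rule mono[OF d(2)[OF 2 W] C(3) c(2)]) (use W in auto)
      next
        case 3
        show ?thesis by (rule mono[OF 4(3)[OF 3 W] C(6) c(5)]) (use W x4 in auto)
      next
        case 4
        then have "Q \<le> \<bar>\<xi>\<bar>" "R \<le> \<bar>\<xi>\<bar>" by (auto simp: Q_def)
        show ?thesis
        \<comment> \<open>The threshold \<open>Q\<close> may be non-positive, so this case can still
          contain the frequency 0, where the reciprocal rate would be meaningless.\<close>
        proof (cases "\<xi> = 0")
          case True
          then show ?thesis using C0(2)[OF W] mult_right_mono[OF C(2), of "(norm (W 0))\<^sup>2"] by simp
        next
          case False
          then have "1 \<le> 1 / \<xi>^4" using x4 by simp
          then have "\<xi>^4 \<le> (1/\<xi>\<^sup>2)\<^sup>2" using x4 unfolding e4(2)[symmetric] by linarith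
          then show ?thesis by (intro mono[OF R[OF \<open>R \<le> \<bar>\<xi>\<bar>\<close> W] C(4) c(3)]) (use W in auto)
        qed
      qed }
    { assume x: "1 \<le> \<bar>\<xi>\<bar>"
      then have x4: "1 \<le> \<xi>^4" "\<xi> \<noteq> 0" using one_le_power[of "\<bar>\<xi>\<bar>" 4] by auto
      then have x4': "1 / \<xi>^4 \<le> 1" by simp
      have le: "1 / \<xi>^4 \<le> (\<xi>\<^sup>2)\<^sup>2" using order_trans[OF x4' x4(1)] unfolding e4(1)[symmetric] .
      consider "\<xi> \<noteq> 0" "\<bar>\<xi>\<bar> < d" | "d \<le> \<bar>\<xi>\<bar>" "\<bar>\<xi>\<bar> \<le> Q" | "Q \<le> \<bar>\<xi>\<bar>" using x by linarith
      then show "(norm (W t))\<^sup>2 \<le> C * exp (- c * (1 / \<xi>^4) * t) * (norm (W 0))\<^sup>2"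
      proof cases
        case 1
        show ?thesis by (rule mono[OF d(2)[OF 1 W] C(3) c(2)]) (use W le in auto)
      next
        case 2
        show ?thesis by (rule mono[OF 4(3)[OF 2 W] C(6) c(5)]) (use W x4' in auto)
      next
        case 3
        then have "R \<le> \<bar>\<xi>\<bar>" by (auto simp: Q_def)
        then show ?thesis unfolding e4(2) by (intro mono[OF R[OF _ W] C(4) c(3)]) (use W in auto)
      qed }
    { assume x: "1 \<le> \<bar>\<xi>\<bar>" and eq: "k1 = k2" "k2 = k3"
      then have x4: "1 \<le> (\<xi>\<^sup>2)\<^sup>2" "\<xi> \<noteq> 0"
        unfolding e4(1)[symmetric] using one_le_power[of "\<bar>\<xi>\<bar>" 4] by auto
      consider "\<xi> \<noteq> 0" "\<bar>\<xi>\<bar> < d" | "d \<le> \<bar>\<xi>\<bar>" "\<bar>\<xi>\<bar> \<le> Q" | "Q \<le> \<bar>\<xi>\<bar>" using x by linarith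
      then have "(norm (W t))\<^sup>2 \<le> C * exp (- c * 1 * t) * (norm (W 0))\<^sup>2"
      proof cases
        case 1
        show ?thesis by (rule mono[OF d(2)[OF 1 W] C(3) c(2)]) (use W x4 in auto)
      next
        case 2
        show ?thesis by (rule mono[OF 4(3)[OF 2 W] C(6) c(5)]) (use W in auto)
      next
        case 3
        then have "R' \<le> \<bar>\<xi>\<bar>" by (auto simp: Q_def)
        then show ?thesis by (intro mono[OF R'[OF eq _ W] C(5) c(4)]) (use W in auto)
      qed
      then show "(norm (W t))\<^sup>2 \<le> C * exp (- c * t) * (norm (W 0))\<^sup>2" by simp }
  qed
qed

end

section \<open>The Fourier transform of scalar functions\<close>

text \<open>Extended non-negative integrals: inequalities can be stated without integrability
  hypotheses, and finiteness is read off from them afterwards.\<close>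

abbreviation sqint :: "(real \<Rightarrow> 'a::real_normed_vector) \<Rightarrow> ennreal" where
  "sqint f \<equiv> \<integral>\<^sup>+x. ennreal ((norm (f x))\<^sup>2) \<partial>lborel"

abbreviation wsqint :: "nat \<Rightarrow> (real \<Rightarrow> 'a::real_normed_vector) \<Rightarrow> ennreal" where
  "wsqint n f \<equiv> \<integral>\<^sup>+\<xi>. ennreal ((\<bar>\<xi>\<bar> ^ n * norm (f \<xi>))\<^sup>2) \<partial>lborel"

text \<open>The unnormalised scalar transform, in agreement with the components of
  \<open>fourier\<close>; this normalisation is the source of every factor \<open>2 * pi\<close>
  below.\<close>

definition ft :: "(real \<Rightarrow> complex) \<Rightarrow> real \<Rightarrow> complex" where
  "ft f \<xi> = (LINT x|lborel. cis (- (\<xi> * x)) * f x)"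

lemma measurable_cis [measurable]: "cis \<in> borel_measurable borel"
  unfolding cis_conv_exp by measurable

lemma integrable_cis_mult:
  assumes "integrable lborel f" "g \<in> borel_measurable borel"
  shows "integrable lborel (\<lambda>x::real. cis (g x) * f x)"
  by (rule Bochner_Integration.integrable_bound[OF assms(1)])
     (use assms in \<open>auto simp: norm_mult\<close>)

lemma norm_ft_le: "norm (ft f \<xi>) \<le> (LINT x|lborel. norm (f x))"
proof -
  have "norm (ft f \<xi>) \<le> (LINT x|lborel. norm (cis (- (\<xi> * x)) * f x))"
    unfolding ft_def by (rule integral_norm_bound)
  then show ?thesis by (simp add: norm_mult)
qed

lemma ft_tendsto:
  assumes f: "integrable lborel f" and X: "X \<longlonglongrightarrow> l"
  shows "(\<lambda>n. ft f (X n)) \<longlonglongrightarrow> ft f l"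
  unfolding ft_def
proof (rule integral_dominated_convergence[where w = "\<lambda>x. norm (f x)"])
  show "AE x in lborel. (\<lambda>n. cis (- (X n * x)) * f x) \<longlonglongrightarrow> cis (- (l * x)) * f x"
    unfolding cis_conv_exp using X by (intro AE_I2 tendsto_intros)
qed (use f in \<open>auto simp: norm_mult\<close>)

lemma measurable_ft [measurable]:
  assumes [measurable]: "f \<in> borel_measurable borel"
  shows "ft f \<in> borel_measurable borel"
proof -
  have "(\<lambda>\<xi>. LINT x|lborel. cis (- (\<xi> * x)) * f x) \<in> borel_measurable borel"
    by measurable
  then show ?thesis by (simp add: ft_def[abs_def])
qed

lemma integrable_ft_mult:
  assumes "integrable lborel f" "integrable lborel g"
  shows "integrable lborel (\<lambda>\<xi>. ft f \<xi> * g \<xi>)"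
proof (rule Bochner_Integration.integrable_bound)
  show "integrable lborel (\<lambda>\<xi>. (LINT x|lborel. norm (f x)) *\<^sub>R g \<xi>)" using assms by auto
  have [measurable]: "f \<in> borel_measurable borel" "g \<in> borel_measurable borel" using assms by auto
  show "(\<lambda>\<xi>. ft f \<xi> * g \<xi>) \<in> borel_measurable lborel" by measurable
  show "AE \<xi> in lborel. norm (ft f \<xi> * g \<xi>) \<le> norm ((LINT x|lborel. norm (f x)) *\<^sub>R g \<xi>)"
    by (intro AE_I2) (auto simp: norm_mult intro!: mult_right_mono norm_ft_le)
qed

text \<open>Fubini's theorem for the absolutely integrable kernel
  \<open>cis (- (\<xi> * x)) * f x * g \<xi>\<close>. Both the Plancherel inequality and the
  inversion formula arise from it by inserting Gaussians.\<close>

lemma ft_multiplication: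
  assumes f: "integrable lborel f" and g: "integrable lborel g"
  shows "(LINT \<xi>|lborel. ft f \<xi> * g \<xi>) = (LINT x|lborel. f x * ft g x)"
proof -
  have [measurable]: "f \<in> borel_measurable borel" "g \<in> borel_measurable borel" using f g by auto
  have int: "integrable (lborel \<Otimes>\<^sub>M lborel) (\<lambda>(x, \<xi>). cis (- (\<xi> * x)) * f x * g \<xi>)"
  proof (rule lborel_pair.Fubini_integrable)
    show "(\<lambda>(x, \<xi>). cis (- (\<xi> * x)) * f x * g \<xi>) \<in> borel_measurable (lborel \<Otimes>\<^sub>M lborel)" by measurable
    show "integrable lborel (\<lambda>x. LINT \<xi>|lborel. norm (case (x, \<xi>) of (x, \<xi>) \<Rightarrow> cis (- (\<xi> * x)) * f x * g \<xi>))"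
      using f by (simp add: norm_mult)
    show "AE x in lborel. integrable lborel (\<lambda>\<xi>. case (x, \<xi>) of (x, \<xi>) \<Rightarrow> cis (- (\<xi> * x)) * f x * g \<xi>)"
      using integrable_cis_mult[OF g] by (auto simp: mult.assoc mult.left_commute intro!: integrable_mult_right)
  qed
  have "(LINT \<xi>|lborel. ft f \<xi> * g \<xi>) = (LINT \<xi>|lborel. LINT x|lborel. cis (- (\<xi> * x)) * f x * g \<xi>)"
    by (simp add: ft_def)
  also have "\<dots> = (LINT x|lborel. LINT \<xi>|lborel. cis (- (\<xi> * x)) * f x * g \<xi>)"
    by (rule lborel_pair.Fubini_integral) (use int in simp)
  also have "\<dots> = (LINT x|lborel. f x * ft g x)"
    unfolding ft_def by (auto simp: mult_ac simp flip: Bochner_Integration.integral_mult_right_zero intro!: Bochner_Integration.integral_cong)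
  finally show ?thesis .
qed

section \<open>Gaussian regularisation and the Plancherel inequality\<close>

definition gauss :: "real \<Rightarrow> real \<Rightarrow> real" where
  "gauss \<sigma> x = exp (- (x / \<sigma>)\<^sup>2 / 2)"

text \<open>The transform of \<open>gauss \<sigma>\<close>, equal to \<open>2 * pi\<close> times the
  normal density with standard deviation \<open>1/\<sigma>\<close>. It has constant mass
  \<open>2 * pi\<close> and concentrates at 0 as \<open>\<sigma>\<close> grows.\<close>

definition heat :: "real \<Rightarrow> real \<Rightarrow> real" where
  "heat \<sigma> x = \<sigma> * (sqrt (2 * pi) * exp (- (\<sigma> * x)\<^sup>2 / 2))"

lemma gauss_bounds: "0 \<le> gauss \<sigma> x" "gauss \<sigma> x \<le> 1"
  by (auto simp: gauss_def)

lemma heat_nonneg: "0 \<le> \<sigma> \<Longrightarrow> 0 \<le> heat \<sigma> x"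
  by (auto simp: heat_def)

lemma measurable_gauss [measurable]: "gauss \<sigma> \<in> borel_measurable borel"
  unfolding gauss_def by measurable

lemma measurable_heat [measurable]: "heat \<sigma> \<in> borel_measurable borel"
  unfolding heat_def by measurable

lemma gauss_1: "gauss 1 x = sqrt (2 * pi) * std_normal_density x"
  by (simp add: gauss_def normal_density_def)

lemma integrable_gauss: "\<sigma> > 0 \<Longrightarrow> integrable lborel (gauss \<sigma>)"
proof -
  assume s: "\<sigma> > 0"
  have "integrable lborel (\<lambda>x. gauss 1 (0 + (1 / \<sigma>) * x))"
    by (rule lborel_integrable_real_affine)
       (use s in \<open>simp_all add: gauss_1[abs_def] integrable_normal_density\<close>)
  then show ?thesis by (simp add: gauss_def[abs_def])
qed

text \<open>The characteristic function of the standard normal distribution, rescaled by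
  \<open>\<sigma>\<close>.\<close>

lemma ft_gauss: "\<sigma> > 0 \<Longrightarrow> ft (\<lambda>x. of_real (gauss \<sigma> x)) \<xi> = of_real (heat \<sigma> \<xi>)"
proof -
  assume s: "\<sigma> > 0"
  have 1: "(LINT x|lborel. std_normal_density x *\<^sub>R iexp (t * x)) = complex_of_real (exp (- t\<^sup>2 / 2))" for t
    using char_std_normal_distribution[THEN fun_cong, of t] unfolding char_def
    by (subst (asm) integral_density) (auto simp: mult.commute)
  have "ft (\<lambda>x. of_real (gauss \<sigma> x)) \<xi> = \<bar>\<sigma>\<bar> *\<^sub>R (LINT x|lborel. cis (- (\<xi> * (0 + \<sigma> * x))) * of_real (gauss \<sigma> (0 + \<sigma> * x)))"
    unfolding ft_def using s by (intro lborel_integral_real_affine) auto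
  also have "(\<lambda>x. cis (- (\<xi> * (0 + \<sigma> * x))) * of_real (gauss \<sigma> (0 + \<sigma> * x)))
     = (\<lambda>x. sqrt (2 * pi) *\<^sub>R (std_normal_density x *\<^sub>R iexp ((- (\<xi> * \<sigma>)) * x)))"
  proof
    fix x
    have "gauss \<sigma> (0 + \<sigma> * x) = sqrt (2 * pi) * std_normal_density x"
      using s gauss_1[of x] by (simp add: gauss_def)
    then show "cis (- (\<xi> * (0 + \<sigma> * x))) * of_real (gauss \<sigma> (0 + \<sigma> * x))
      = sqrt (2 * pi) *\<^sub>R (std_normal_density x *\<^sub>R iexp ((- (\<xi> * \<sigma>)) * x))"
      by (simp add: cis_conv_exp scaleR_conv_of_real mult_ac)
  qed
  also have "(LINT x|lborel. sqrt (2 * pi) *\<^sub>R (std_normal_density x *\<^sub>R iexp ((- (\<xi> * \<sigma>)) * x)))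
     = sqrt (2 * pi) *\<^sub>R complex_of_real (exp (- (- (\<xi> * \<sigma>))\<^sup>2 / 2))"
    unfolding integral_scaleR_right 1 ..
  finally show ?thesis using s
    by (simp add: heat_def scaleR_conv_of_real mult_ac)
qed

lemma integrable_heat: "\<sigma> > 0 \<Longrightarrow> integrable lborel (heat \<sigma>)"
proof -
  assume s: "\<sigma> > 0"
  have "heat \<sigma> = (\<lambda>x. \<sigma> * (sqrt (2 * pi) * gauss (1 / \<sigma>) x))"
    by (auto simp: heat_def gauss_def mult.commute)
  then show ?thesis using integrable_gauss[of "1/\<sigma>"] s by simp
qed

lemma nn_integral_heat:
  assumes s: "\<sigma> > 0"
  shows "(\<integral>\<^sup>+x. ennreal (heat \<sigma> x) \<partial>lborel) = ennreal (2 * pi)"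
proof -
  have "(\<integral>\<^sup>+x. ennreal (std_normal_density x) \<partial>lborel) = ennreal \<bar>\<sigma>\<bar> * (\<integral>\<^sup>+x. ennreal (std_normal_density (0 + \<sigma> * x)) \<partial>lborel)"
    using s by (intro nn_integral_real_affine) auto
  also have "\<dots> = (\<integral>\<^sup>+x. ennreal \<sigma> * ennreal (std_normal_density (\<sigma> * x)) \<partial>lborel)"
    using s by (subst nn_integral_cmult) simp_all
  finally have "(\<integral>\<^sup>+x. ennreal (std_normal_density x) \<partial>lborel)
    = (\<integral>\<^sup>+x. ennreal \<sigma> * ennreal (std_normal_density (\<sigma> * x)) \<partial>lborel)" .
  moreover have "(\<integral>\<^sup>+x. ennreal (std_normal_density x) \<partial>lborel) = ennreal (LINT x|lborel. std_normal_density x)"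
    by (rule nn_integral_eq_integral) (simp_all add: integrable_normal_density)
  ultimately have 1: "(\<integral>\<^sup>+x. ennreal \<sigma> * ennreal (std_normal_density (\<sigma> * x)) \<partial>lborel) = 1"
    by (simp only: integral_normal_density zero_less_one ennreal_1)
  have "(\<integral>\<^sup>+x. ennreal (heat \<sigma> x) \<partial>lborel)
      = (\<integral>\<^sup>+x. ennreal (2 * pi) * (ennreal \<sigma> * ennreal (std_normal_density (\<sigma> * x))) \<partial>lborel)"
  proof (rule nn_integral_cong)
    fix x
    have "heat \<sigma> x = (2 * pi) * (\<sigma> * std_normal_density (\<sigma> * x))"
      using gauss_1[of "\<sigma> * x"] by (simp add: heat_def gauss_def flip: mult.assoc)
    then show "ennreal (heat \<sigma> x) = ennreal (2 * pi) * (ennreal \<sigma> * ennreal (std_normal_density (\<sigma> * x)))"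
      using s by (simp only: ennreal_mult mult_nonneg_nonneg normal_density_nonneg pi_ge_zero zero_le_numeral less_imp_le)
  qed
  also have "\<dots> = ennreal (2 * pi)" by (subst nn_integral_cmult) (simp_all add: 1)
  finally show ?thesis .
qed

lemma gauss_tendsto_1: "(\<lambda>n. gauss (real (Suc n)) x) \<longlonglongrightarrow> 1"
proof -
  have "(\<lambda>n. x / real (Suc n)) \<longlonglongrightarrow> 0"
    by (rule LIMSEQ_Suc[OF lim_const_over_n])
  then have "(\<lambda>n. exp (- (x / real (Suc n))\<^sup>2 / 2)) \<longlonglongrightarrow> exp (- 0\<^sup>2 / 2)"
    by (intro tendsto_exp tendsto_divide tendsto_minus tendsto_power tendsto_const) simp_all
  then show ?thesis unfolding gauss_def by simp
qed

lemma ft_cnj_reflect: "ft (\<lambda>y. cnj (f (- y))) \<xi> = cnj (ft f \<xi>)"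
proof -
  have "ft (\<lambda>y. cnj (f (- y))) \<xi> = \<bar>-1\<bar> *\<^sub>R (LINT x|lborel. cis (- (\<xi> * (0 + - 1 * x))) * cnj (f (- (0 + - 1 * x))))"
    unfolding ft_def by (rule lborel_integral_real_affine) simp
  also have "\<dots> = (LINT x|lborel. cnj (cis (- (\<xi> * x)) * f x))" by (simp add: cis_cnj)
  also have "\<dots> = cnj (ft f \<xi>)" unfolding ft_def by (rule Bochner_Integration.integral_cnj)
  finally show ?thesis .
qed

lemma ft_modulate: "ft (\<lambda>\<xi>. cis (- (\<xi> * x)) * g \<xi>) y = ft g (x + y)"
proof -
  have "cis (- (y * t)) * cis (- (t * x)) = cis (- ((x + y) * t))" for t
    by (simp add: cis_mult algebra_simps)
  then show ?thesis unfolding ft_def mult.assoc[symmetric] by simp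
qed

text \<open>One half of Plancherel's theorem, from the identity
  \<open>\<integral> |ft f|\<^sup>2 gauss = \<integral>\<integral> f(x) cnj (f(y)) heat(x - y)\<close> and Young's inequality.\<close>

lemma ft_gauss_le:
  assumes f: "integrable lborel f" and s: "\<sigma> > 0"
  shows "(\<integral>\<^sup>+\<xi>. ennreal (gauss \<sigma> \<xi> * (norm (ft f \<xi>))\<^sup>2) \<partial>lborel)
    \<le> ennreal (2 * pi) * sqint f"
proof -
  have [measurable]: "f \<in> borel_measurable borel" using f by auto
  \<comment> \<open>The transform of \<open>g\<close> is the conjugate of that of \<open>f\<close>,
    which makes \<open>|ft f|^2\<close> a product of two transforms. The reflection is the reason
    why the kernel appears as \<open>heat \<sigma> (x + y)\<close>.\<close>
  define g where "g y = cnj (f (- y))" for y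
  have g: "integrable lborel g"
    unfolding g_def using lborel_integrable_real_affine[OF f, of "-1" 0] by simp
  have [measurable]: "g \<in> borel_measurable borel" using g by auto
  have ig: "integrable lborel (\<lambda>\<xi>. complex_of_real (gauss \<sigma> \<xi>))" using integrable_gauss[OF s] by simp
  define H where "H \<xi> = ft g \<xi> * of_real (gauss \<sigma> \<xi>)" for \<xi>
  have H: "integrable lborel H" unfolding H_def by (rule integrable_ft_mult[OF g ig])
  have ftH: "ft H x = (LINT y|lborel. g y * of_real (heat \<sigma> (x + y)))" for x
  proof -
    have "ft H x = (LINT \<xi>|lborel. ft g \<xi> * (cis (- (\<xi> * x)) * of_real (gauss \<sigma> \<xi>)))"
      unfolding ft_def[of H] H_def by (intro Bochner_Integration.integral_cong) (auto simp: mult_ac)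
    also have "\<dots> = (LINT y|lborel. g y * ft (\<lambda>\<xi>. cis (- (\<xi> * x)) * of_real (gauss \<sigma> \<xi>)) y)"
      by (intro ft_multiplication g integrable_cis_mult ig) measurable
    finally show ?thesis by (simp add: ft_modulate ft_gauss[OF s])
  qed
  have sq: "complex_of_real (gauss \<sigma> \<xi> * (norm (ft f \<xi>))\<^sup>2) = ft f \<xi> * H \<xi>" for \<xi>
    unfolding H_def g_def ft_cnj_reflect of_real_mult complex_norm_square by (simp add: mult_ac)
  have int: "integrable lborel (\<lambda>\<xi>. gauss \<sigma> \<xi> * (norm (ft f \<xi>))\<^sup>2)"
    using integrable_ft_mult[OF f H] unfolding sq[symmetric] complex_of_real_integrable_eq .
  have "(\<integral>\<^sup>+\<xi>. ennreal (gauss \<sigma> \<xi> * (norm (ft f \<xi>))\<^sup>2) \<partial>lborel)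
      = ennreal (LINT \<xi>|lborel. gauss \<sigma> \<xi> * (norm (ft f \<xi>))\<^sup>2)"
    by (intro nn_integral_eq_integral int) (auto simp: gauss_bounds)
  also have "(LINT \<xi>|lborel. gauss \<sigma> \<xi> * (norm (ft f \<xi>))\<^sup>2)
      = norm (LINT \<xi>|lborel. complex_of_real (gauss \<sigma> \<xi> * (norm (ft f \<xi>))\<^sup>2))"
    unfolding integral_complex_of_real norm_of_real
    by (subst abs_of_nonneg) (auto intro!: integral_nonneg_AE simp: gauss_bounds)
  also have "(LINT \<xi>|lborel. complex_of_real (gauss \<sigma> \<xi> * (norm (ft f \<xi>))\<^sup>2)) = (LINT x|lborel. f x * ft H x)"
    unfolding sq by (rule ft_multiplication[OF f H])
  also have "ennreal (norm \<dots>) \<le> (\<integral>\<^sup>+x. ennreal (norm (f x * ft H x)) \<partial>lborel)"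
    by (intro integral_norm_bound_ennreal) (use integrable_ft_mult[OF H f] in \<open>simp add: mult.commute\<close>)
  also have "\<dots> \<le> (\<integral>\<^sup>+x. \<integral>\<^sup>+y. (ennreal ((norm (f x))\<^sup>2) * ennreal (heat \<sigma> (x + y)) +
      ennreal ((norm (g y))\<^sup>2) * ennreal (heat \<sigma> (x + y))) / 2 \<partial>lborel \<partial>lborel)"
  proof (rule nn_integral_mono)
    fix x
    have int2: "integrable lborel (\<lambda>y. g y * of_real (heat \<sigma> (x + y)))"
    proof (rule Bochner_Integration.integrable_bound)
      show "integrable lborel (\<lambda>y. \<sigma> * sqrt (2 * pi) * norm (g y))" using g by simp
      show "AE y in lborel. norm (g y * complex_of_real (heat \<sigma> (x + y))) \<le> norm (\<sigma> * sqrt (2 * pi) * norm (g y))"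
      proof (intro AE_I2)
        fix y
        have "exp (- (\<sigma> * (x + y))\<^sup>2 / 2) \<le> 1" by simp
        then have "norm (g y) * (\<sigma> * sqrt (2 * pi)) * exp (- (\<sigma> * (x + y))\<^sup>2 / 2) \<le> norm (g y) * (\<sigma> * sqrt (2 * pi)) * 1"
          using s by (intro mult_left_mono) auto
        then show "norm (g y * complex_of_real (heat \<sigma> (x + y))) \<le> norm (\<sigma> * sqrt (2 * pi) * norm (g y))"
          using s by (simp add: norm_mult heat_def abs_mult mult_ac)
      qed
    qed measurable
    have "ennreal (norm (f x * ft H x)) = ennreal (norm (f x)) * ennreal (norm (ft H x))"
      by (simp add: norm_mult ennreal_mult)
    also have "\<dots> \<le> ennreal (norm (f x)) * (\<integral>\<^sup>+y. ennreal (norm (g y * of_real (heat \<sigma> (x + y)))) \<partial>lborel)"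
      unfolding ftH by (intro mult_left_mono integral_norm_bound_ennreal int2) simp
    also have "\<dots> = (\<integral>\<^sup>+y. ennreal (norm (f x)) * ennreal (norm (g y * of_real (heat \<sigma> (x + y)))) \<partial>lborel)"
      by (subst nn_integral_cmult) auto
    also have "\<dots> \<le> (\<integral>\<^sup>+y. (ennreal ((norm (f x))\<^sup>2) * ennreal (heat \<sigma> (x + y)) +
      ennreal ((norm (g y))\<^sup>2) * ennreal (heat \<sigma> (x + y))) / 2 \<partial>lborel)"
    proof (rule nn_integral_mono)
      fix y
      let ?h = "heat \<sigma> (x + y)"
      have h: "?h \<ge> 0" using s by (intro heat_nonneg) simp
      \<comment> \<open>The arithmetic-geometric inequality separates the two functions; each half
        is then integrated against a kernel of mass \<open>2 * pi\<close> in the other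
        variable.\<close>
      have "norm (f x) * norm (g y) * ?h \<le> (((norm (f x))\<^sup>2 + (norm (g y))\<^sup>2) / 2) * ?h"
        by (intro mult_right_mono h) (use sum_squares_bound[of "norm (f x)" "norm (g y)"] in simp)
      then have "norm (f x) * norm (g y * of_real ?h) \<le> ((norm (f x))\<^sup>2 * ?h + (norm (g y))\<^sup>2 * ?h) / 2"
        using h by (simp add: norm_mult algebra_simps add_divide_distrib)
      then have "ennreal (norm (f x) * norm (g y * of_real ?h)) \<le> ennreal (((norm (f x))\<^sup>2 * ?h + (norm (g y))\<^sup>2 * ?h) / 2)"
        by (rule ennreal_leI)
      also have "\<dots> = (ennreal ((norm (f x))\<^sup>2) * ennreal ?h + ennreal ((norm (g y))\<^sup>2) * ennreal ?h) / 2"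
        using h by (subst ennreal_divide_numeral[symmetric]) (simp_all add: ennreal_mult)
      finally show "ennreal (norm (f x)) * ennreal (norm (g y * of_real ?h))
         \<le> (ennreal ((norm (f x))\<^sup>2) * ennreal ?h + ennreal ((norm (g y))\<^sup>2) * ennreal ?h) / 2"
        by (simp add: ennreal_mult)
    qed
    finally show "ennreal (norm (f x * ft H x)) \<le> (\<integral>\<^sup>+y. (ennreal ((norm (f x))\<^sup>2) * ennreal (heat \<sigma> (x + y)) +
      ennreal ((norm (g y))\<^sup>2) * ennreal (heat \<sigma> (x + y))) / 2 \<partial>lborel)" .
  qed
  also have "\<dots> = ((\<integral>\<^sup>+x. \<integral>\<^sup>+y. ennreal ((norm (f x))\<^sup>2) * ennreal (heat \<sigma> (x + y)) \<partial>lborel \<partial>lborel)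
      + (\<integral>\<^sup>+x. \<integral>\<^sup>+y. ennreal ((norm (g y))\<^sup>2) * ennreal (heat \<sigma> (x + y)) \<partial>lborel \<partial>lborel)) / 2"
    by (subst nn_integral_divide, measurable, subst nn_integral_divide, measurable,
        subst nn_integral_add, measurable, subst nn_integral_add, measurable)
  also have "(\<integral>\<^sup>+x. \<integral>\<^sup>+y. ennreal ((norm (g y))\<^sup>2) * ennreal (heat \<sigma> (x + y)) \<partial>lborel \<partial>lborel)
     = (\<integral>\<^sup>+y. \<integral>\<^sup>+x. ennreal ((norm (g y))\<^sup>2) * ennreal (heat \<sigma> (x + y)) \<partial>lborel \<partial>lborel)"
    by (rule lborel_pair.Fubini') measurable
  also have "(\<integral>\<^sup>+y. \<integral>\<^sup>+x. ennreal ((norm (g y))\<^sup>2) * ennreal (heat \<sigma> (x + y)) \<partial>lborel \<partial>lborel)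
     = (\<integral>\<^sup>+y. ennreal ((norm (g y))\<^sup>2) * ennreal (2 * pi) \<partial>lborel)"
  proof (rule nn_integral_cong)
    fix y
    have "(\<integral>\<^sup>+x. ennreal (heat \<sigma> (x + y)) \<partial>lborel) = (\<integral>\<^sup>+x. ennreal (heat \<sigma> x) \<partial>lborel)"
      using nn_integral_real_affine[of "\<lambda>x. ennreal (heat \<sigma> x)" 1 y] by (simp add: add.commute)
    then show "(\<integral>\<^sup>+x. ennreal ((norm (g y))\<^sup>2) * ennreal (heat \<sigma> (x + y)) \<partial>lborel) = ennreal ((norm (g y))\<^sup>2) * ennreal (2 * pi)"
      by (simp add: nn_integral_cmult nn_integral_heat[OF s])
  qed
  also have "\<dots> = sqint (\<lambda>y. f (- y)) * ennreal (2 * pi)"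
    by (simp add: nn_integral_multc g_def)
  also have "sqint (\<lambda>y. f (- y)) = sqint f"
    by (subst (2) nn_integral_real_affine[where c = "-1" and t = 0]) simp_all
  also have "(\<integral>\<^sup>+x. \<integral>\<^sup>+y. ennreal ((norm (f x))\<^sup>2) * ennreal (heat \<sigma> (x + y)) \<partial>lborel \<partial>lborel)
     = (\<integral>\<^sup>+x. ennreal ((norm (f x))\<^sup>2) * ennreal (2 * pi) \<partial>lborel)"
  proof (rule nn_integral_cong)
    fix x
    have "(\<integral>\<^sup>+y. ennreal (heat \<sigma> (x + y)) \<partial>lborel) = (\<integral>\<^sup>+x. ennreal (heat \<sigma> x) \<partial>lborel)"
      using nn_integral_real_affine[of "\<lambda>x. ennreal (heat \<sigma> x)" 1 x] by simp
    then show "(\<integral>\<^sup>+y. ennreal ((norm (f x))\<^sup>2) * ennreal (heat \<sigma> (x + y)) \<partial>lborel) = ennreal ((norm (f x))\<^sup>2) * ennreal (2 * pi)"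
      by (simp add: nn_integral_cmult nn_integral_heat[OF s])
  qed
  also have "\<dots> = sqint f * ennreal (2 * pi)"
    by (simp add: nn_integral_multc)
  also have "(\<dots> + sqint f * ennreal (2 * pi)) / 2 = sqint f * ennreal (2 * pi)"
    unfolding mult_2[symmetric] mult.commute[of 2] by (rule ennreal_mult_divide_eq) simp_all
  finally show ?thesis by (simp add: mult.commute)
qed

text \<open>The square of the transform is not known to be integrable beforehand, so the Gaussian
  weight is removed by Fatou's lemma.\<close>

lemma Plancherel_le:
  assumes f: "integrable lborel f"
  shows "sqint (ft f)
    \<le> ennreal (2 * pi) * sqint f"
proof -
  have [measurable]: "f \<in> borel_measurable borel" using f by auto
  have lim: "(\<lambda>n. ennreal (gauss (Suc n) \<xi> * (norm (ft f \<xi>))\<^sup>2)) \<longlonglongrightarrow> ennreal ((norm (ft f \<xi>))\<^sup>2)" for \<xi>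
    using tendsto_mult_right[OF gauss_tendsto_1[of \<xi>], of "(norm (ft f \<xi>))\<^sup>2"] by (intro tendsto_ennrealI) simp
  have "sqint (ft f)
     = (\<integral>\<^sup>+\<xi>. liminf (\<lambda>n. ennreal (gauss (Suc n) \<xi> * (norm (ft f \<xi>))\<^sup>2)) \<partial>lborel)"
    by (intro nn_integral_cong lim_imp_Liminf[symmetric] lim) simp
  also have "\<dots> \<le> liminf (\<lambda>n. \<integral>\<^sup>+\<xi>. ennreal (gauss (Suc n) \<xi> * (norm (ft f \<xi>))\<^sup>2) \<partial>lborel)"
    by (rule nn_integral_liminf) measurable
  also have "\<dots> \<le> liminf (\<lambda>n. ennreal (2 * pi) * sqint f)"
    by (intro Liminf_mono always_eventually allI ft_gauss_le f) simp
  finally show ?thesis by (simp add: Liminf_const)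
qed

section \<open>Test functions\<close>

definition smooth :: "(real \<Rightarrow> real) \<Rightarrow> bool" where
  "smooth f \<longleftrightarrow> (\<forall>n x. (deriv ^^ n) f field_differentiable (at x))"

text \<open>A class of functions closed under differentiation consists of smooth functions. This
  replaces explicit formulas for higher derivatives.\<close>

lemma smooth_coinduct:
  assumes "f \<in> S" and step: "\<And>f. f \<in> S \<Longrightarrow> \<exists>f'\<in>S. \<forall>x. (f has_real_derivative f' x) (at x)"
  shows "smooth f"
proof -
  have S: "(deriv ^^ n) f \<in> S" for n
  proof (induction n)
    case (Suc n)
    then obtain f' where f': "f' \<in> S" "\<And>x. ((deriv ^^ n) f has_real_derivative f' x) (at x)"
      using step by blast
    then have "deriv ((deriv ^^ n) f) = f'" by (intro ext DERIV_imp_deriv)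
    with f' show ?case by simp
  qed (use assms in auto)
  show ?thesis unfolding smooth_def
    using step[OF S] by (auto simp: field_differentiable_def)
qed

lemma smooth_deriv: "smooth f \<Longrightarrow> smooth (deriv f)"
  unfolding smooth_def
proof (intro allI)
  fix n x assume "\<forall>n x. (deriv ^^ n) f field_differentiable (at x)"
  then have "(deriv ^^ Suc n) f field_differentiable (at x)" by blast
  then show "(deriv ^^ n) (deriv f) field_differentiable (at x)" by (simp add: funpow_swap1)
qed

lemma smooth_has_deriv: "smooth f \<Longrightarrow> (f has_real_derivative deriv f x) (at x)"
  unfolding smooth_def by (metis DERIV_deriv_iff_field_differentiable funpow_0)

lemma smooth_affine:
  assumes "smooth f"
  shows "smooth (\<lambda>x. c * f (a * x + b))"
proof (rule smooth_coinduct[where S = "{\<lambda>x. c * f (a * x + b) | c f. smooth f}"])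
  fix g assume "g \<in> {\<lambda>x. c * f (a * x + b) | c f. smooth f}"
  then obtain c f where g: "g = (\<lambda>x. c * f (a * x + b))" and f: "smooth f" by auto
  have "(g has_real_derivative (c * a) * deriv f (a * x + b)) (at x)" for x
  proof -
    have "((\<lambda>x. a * x + b) has_real_derivative a) (at x)" by (auto intro!: derivative_eq_intros)
    from DERIV_cmult[OF DERIV_chain2[OF smooth_has_deriv[OF f] this], of c]
    show ?thesis unfolding g by (simp add: mult_ac)
  qed
  then show "\<exists>f'\<in>{\<lambda>x. c * f (a * x + b) | c f. smooth f}. \<forall>x. (g has_real_derivative f' x) (at x)"
    using smooth_deriv[OF f] by (intro bexI[of _ "\<lambda>x. (c * a) * deriv f (a * x + b)"]) auto
qed (use assms in auto)

text \<open>The smallest convenient class containing products of smooth functions and stable under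
  the Leibniz rule.\<close>

inductive_set product_sums :: "(real \<Rightarrow> real) set" where
  prod: "smooth f \<Longrightarrow> smooth g \<Longrightarrow> (\<lambda>x. f x * g x) \<in> product_sums"
| add: "f \<in> product_sums \<Longrightarrow> g \<in> product_sums \<Longrightarrow> (\<lambda>x. f x + g x) \<in> product_sums"

lemma smooth_mult:
  assumes "smooth f" "smooth g"
  shows "smooth (\<lambda>x. f x * g x)"
proof (rule smooth_coinduct[where S = product_sums])
  fix h assume "h \<in> product_sums"
  then show "\<exists>h'\<in>product_sums. \<forall>x. (h has_real_derivative h' x) (at x)"
  proof induction
    case (prod f g)
    have "(\<lambda>x. deriv f x * g x + f x * deriv g x) \<in> product_sums"
      by (intro product_sums.intros smooth_deriv prod)
    moreover have "((\<lambda>x. f x * g x) has_real_derivative deriv f x * g x + f x * deriv g x) (at x)" for x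
      using DERIV_mult[OF smooth_has_deriv[OF prod(1)] smooth_has_deriv[OF prod(2)], of x]
      by (simp add: algebra_simps)
    ultimately show ?case by (intro bexI[of _ "\<lambda>x. deriv f x * g x + f x * deriv g x"]) auto
  next
    case (add f g)
    then obtain f' g' where "f' \<in> product_sums" "g' \<in> product_sums"
      "\<And>x. (f has_real_derivative f' x) (at x)" "\<And>x. (g has_real_derivative g' x) (at x)" by blast
    then show ?case
      by (intro bexI[of _ "\<lambda>x. f' x + g' x"]) (auto intro: product_sums.intros DERIV_add)
  qed
qed (use assms in \<open>auto intro: product_sums.intros\<close>)

section \<open>Smooth functions of compact support\<close>

definition flat :: "real poly \<Rightarrow> real \<Rightarrow> real" where
  "flat p x = (if x > 0 then poly p (1 / x) * exp (- (1 / x)) else 0)"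

lemma poly_exp_tendsto_0: "((\<lambda>s. poly p s * exp (- s)) \<longlongrightarrow> (0::real)) at_top"
proof -
  have "((\<lambda>s. \<Sum>i\<le>degree p. coeff p i * (s ^ i / exp s)) \<longlongrightarrow> (\<Sum>i\<le>degree p. coeff p i * 0)) at_top"
    by (intro tendsto_sum tendsto_mult_left tendsto_power_div_exp_0)
  then show ?thesis
    by (simp add: poly_altdef exp_minus sum_distrib_left sum_distrib_right divide_inverse mult_ac)
qed

text \<open>With \<open>s = 1/x\<close> the chain rule contributes \<open>- s^2\<close>, so
  \<open>p(s) exp(-s)\<close> becomes \<open>s^2 (p - p')(s) exp(-s)\<close>. Carrying the
  polynomial along is what makes the family closed under differentiation.\<close>

lemma flat_has_deriv:
  "(flat p has_real_derivative flat ([:0, 0, 1:] * (p - pderiv p)) x) (at x)"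
proof -
  consider "x > 0" | "x < 0" | "x = 0" by linarith
  then show ?thesis
  proof cases
    case 1
    have "((\<lambda>x. poly p (1 / x) * exp (- (1 / x))) has_real_derivative flat ([:0, 0, 1:] * (p - pderiv p)) x) (at x)"
      using 1 by (auto intro!: derivative_eq_intros DERIV_chain2[where f = "poly p"] poly_DERIV
          simp: flat_def field_simps power2_eq_square)
    then show ?thesis
      by (rule has_field_derivative_transform_within_open[where S = "{0<..}"]) (use 1 in \<open>auto simp: flat_def\<close>)
  next
    case 2
    have "((\<lambda>x. 0) has_real_derivative flat ([:0, 0, 1:] * (p - pderiv p)) x) (at x)"
      using 2 by (simp add: flat_def)
    then show ?thesis
      by (rule has_field_derivative_transform_within_open[where S = "{..<0}"]) (use 2 in \<open>auto simp: flat_def\<close>)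
  next
    case 3
    \<comment> \<open>The polynomial \<open>pCons 0 p\<close> is \<open>s p(s)\<close>: the
      additional \<open>s = 1/h\<close> is the denominator of the difference quotient at 0.\<close>
    have "((\<lambda>h. poly (pCons 0 p) (inverse h) * exp (- inverse h)) \<longlongrightarrow> 0) (at_right 0)"
      by (rule filterlim_compose[OF poly_exp_tendsto_0 filterlim_inverse_at_top_right])
    then have "((\<lambda>h. flat p h / h) \<longlongrightarrow> 0) (at_right 0)"
      by (rule Lim_transform_eventually)
         (auto simp: eventually_at_filter flat_def divide_inverse mult_ac intro!: always_eventually)
    moreover have "((\<lambda>h. flat p h / h) \<longlongrightarrow> 0) (at_left 0)"
      by (rule Lim_transform_eventually[OF tendsto_const])
         (auto simp: eventually_at_filter flat_def intro!: always_eventually)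
    ultimately have "((\<lambda>h. flat p h / h) \<longlongrightarrow> 0) (at 0)"
      by (simp add: filterlim_at_split)
    then show ?thesis unfolding 3 DERIV_def by (simp add: flat_def)
  qed
qed

lemma smooth_flat: "smooth (flat p)"
  by (rule smooth_coinduct[where S = "range flat"]) (use flat_has_deriv in blast)+

text \<open>The parameter \<open>n\<close> steepens the edges without moving the support, so that
  the functions stay below 1 and tend pointwise to the indicator of the open interval.\<close>

definition bump :: "real \<Rightarrow> real \<Rightarrow> real \<Rightarrow> real \<Rightarrow> real" where
  "bump n a b x = flat 1 (n * (x - a)) * flat 1 (n * (b - x))"

lemma bump_bounds: "0 \<le> bump n a b x" "bump n a b x \<le> 1"
  by (auto simp: bump_def flat_def intro!: mult_nonneg_nonneg mult_le_one)

lemma bump_eq_0: "n > 0 \<Longrightarrow> x \<notin> {a<..<b} \<Longrightarrow> bump n a b x = 0"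
  by (auto simp: bump_def flat_def zero_less_mult_iff)

lemma bump_pos: "n > 0 \<Longrightarrow> x \<in> {a<..<b} \<Longrightarrow> bump n a b x > 0"
  by (auto simp: bump_def flat_def)

lemma test_function_bump: "n > 0 \<Longrightarrow> test_function (bump n a b)"
  unfolding test_function_def smooth_def[symmetric]
proof
  assume n: "n > 0"
  have "smooth (\<lambda>x. (1 * flat 1 (n * x + (- n * a))) * (1 * flat 1 ((- n) * x + n * b)))"
    by (intro smooth_mult smooth_affine smooth_flat)
  then show "smooth (bump n a b)" by (simp add: bump_def[abs_def] algebra_simps)
  show "\<exists>R. \<forall>x. R < \<bar>x\<bar> \<longrightarrow> bump n a b x = 0"
    by (rule exI[of _ "\<bar>a\<bar> + \<bar>b\<bar>"]) (auto intro!: bump_eq_0 n)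
qed

lemma bump_tendsto_indicator: "(\<lambda>n. bump (real (Suc n)) a b x) \<longlonglongrightarrow> indicator {a<..<b} x"
proof (cases "x \<in> {a<..<b}")
  case True
  have e: "(\<lambda>n. exp (- (c / real (Suc n)))) \<longlonglongrightarrow> 1" for c
    using tendsto_exp[OF tendsto_minus[OF LIMSEQ_Suc[OF lim_const_over_n[of c]]]] by simp
  have "(\<lambda>n. exp (- ((1 / (x - a)) / real (Suc n))) * exp (- ((1 / (b - x)) / real (Suc n)))) \<longlonglongrightarrow> 1 * 1"
    by (intro tendsto_mult e)
  moreover have "bump (real (Suc n)) a b x = exp (- ((1 / (x - a)) / real (Suc n))) * exp (- ((1 / (b - x)) / real (Suc n)))" for n
    using True by (simp add: bump_def flat_def zero_less_mult_iff mult.commute)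
  ultimately show ?thesis using True by simp
next
  case False
  then show ?thesis by (simp add: bump_eq_0)
qed

lemma test_function_smooth: "test_function \<phi> \<Longrightarrow> smooth \<phi>"
  by (simp add: test_function_def smooth_def)

lemma test_function_deriv:
  assumes "test_function \<phi>" shows "test_function (deriv \<phi>)"
proof -
  obtain R where R: "\<And>x. R < \<bar>x\<bar> \<Longrightarrow> \<phi> x = 0" using assms unfolding test_function_def by blast
  have "deriv \<phi> x = 0" if "R < \<bar>x\<bar>" for x
  proof (rule DERIV_imp_deriv, rule has_field_derivative_transform_within_open)
    show "((\<lambda>x. 0) has_real_derivative 0) (at x)" by simp
    show "open {x. R < \<bar>x\<bar>}" by (intro open_Collect_less continuous_intros)
  qed (use that R in auto)
  then show ?thesis
    using smooth_deriv[OF test_function_smooth[OF assms]] unfolding test_function_def smooth_def by blast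
qed

lemma test_function_higher_deriv: "test_function \<phi> \<Longrightarrow> test_function ((deriv ^^ n) \<phi>)"
  by (induction n) (auto intro: test_function_deriv)

lemma continuous_on_test_function: "test_function \<phi> \<Longrightarrow> continuous_on S \<phi>"
  using smooth_has_deriv[OF test_function_smooth]
  by (meson DERIV_isCont continuous_at_imp_continuous_on)

lemma measurable_test_function: "test_function \<phi> \<Longrightarrow> \<phi> \<in> borel_measurable borel"
  by (intro borel_measurable_continuous_onI continuous_on_test_function)

lemma integrable_compact_support:
  fixes f :: "real \<Rightarrow> 'a::euclidean_space"
  assumes "continuous_on UNIV f" "\<And>x. R < \<bar>x\<bar> \<Longrightarrow> f x = 0"
  shows "integrable lborel f"
proof -
  have "set_integrable lborel {-R..R} f"
    by (rule borel_integrable_atLeastAtMost') (rule continuous_on_subset[OF assms(1)], simp)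
  moreover have "(\<lambda>x. indicator {-R..R} x *\<^sub>R f x) = f"
    using assms(2) by (auto simp: fun_eq_iff indicator_def abs_le_iff not_le)
  ultimately show ?thesis by (simp add: set_integrable_def)
qed

lemma integral_deriv_compact_support:
  fixes F :: "real \<Rightarrow> complex"
  assumes F: "\<And>x. (F has_vector_derivative f x) (at x)" "\<And>x. R < \<bar>x\<bar> \<Longrightarrow> F x = 0" "\<And>x. R < \<bar>x\<bar> \<Longrightarrow> f x = 0"
    and f: "continuous_on UNIV f"
  shows "(LINT x|lborel. f x) = 0"
proof -
  \<comment> \<open>The added 1 places both end points strictly outside the region where
    \<open>F\<close> may be non-zero, also if \<open>R\<close> is negative.\<close>
  define r where "r = \<bar>R\<bar> + 1"
  have "(LINT x|lborel. indicator {-r..r} x *\<^sub>R f x) = F r - F (- r)"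
    by (rule integral_FTC_atLeastAtMost)
       (auto simp: r_def intro: has_vector_derivative_at_within F continuous_on_subset[OF f])
  moreover have "(\<lambda>x. indicator {-r..r} x *\<^sub>R f x) = f"
    using F(3) by (auto simp: fun_eq_iff indicator_def abs_le_iff not_le r_def)
  moreover have "F r = 0" "F (- r) = 0" by (auto intro!: F(2) simp: r_def)
  ultimately show ?thesis by simp
qed

lemma integrable_test_function: "test_function \<phi> \<Longrightarrow> integrable lborel \<phi>"
  using integrable_compact_support[OF continuous_on_test_function] unfolding test_function_def by blast

lemma bounded_test_function:
  assumes "test_function \<phi>" obtains B where "\<And>x. \<bar>\<phi> x\<bar> \<le> B"
proof -
  obtain R where R: "\<And>x. R < \<bar>x\<bar> \<Longrightarrow> \<phi> x = 0" using assms unfolding test_function_def by blast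
  have "compact (\<phi> ` {-R..R})" by (intro compact_continuous_image continuous_on_test_function assms compact_Icc)
  then obtain B where B: "\<And>x. x \<in> {-R..R} \<Longrightarrow> \<bar>\<phi> x\<bar> \<le> B"
    using compact_imp_bounded bounded_iff by (metis imageI real_norm_def)
  have "\<bar>\<phi> x\<bar> \<le> max B 0" for x
  proof (cases "R < \<bar>x\<bar>")
    case False
    then have "x \<in> {-R..R}" by auto
    then show ?thesis using B by (simp add: le_max_iff_disj)
  qed (simp add: R)
  then show thesis by (rule that)
qed

section \<open>Transforms of test functions\<close>

abbreviation "ftr \<phi> \<equiv> ft (\<lambda>x. complex_of_real (\<phi> x))"

lemma ft_deriv:
  assumes "test_function \<phi>"
  shows "ftr (deriv \<phi>) \<xi> = \<i> * \<xi> * ftr \<phi> \<xi>"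
proof -
  obtain R where R: "\<And>x. R < \<bar>x\<bar> \<Longrightarrow> \<phi> x = 0" using assms unfolding test_function_def by blast
  obtain R' where R': "\<And>x. R' < \<bar>x\<bar> \<Longrightarrow> deriv \<phi> x = 0"
    using test_function_deriv[OF assms] unfolding test_function_def by blast
  let ?e = "\<lambda>x. cis (- (\<xi> * x))"
  have e: "(?e has_vector_derivative - (\<i> * \<xi>) * ?e x) (at x)" for x
  proof -
    have "((\<lambda>z. exp (- (\<i> * \<xi>) * z)) has_field_derivative - (\<i> * \<xi>) * exp (- (\<i> * \<xi>) * of_real x)) (at (of_real x))"
      by (auto intro!: derivative_eq_intros)
    from has_vector_derivative_real_field[OF this, of UNIV] show ?thesis
      by (simp add: cis_conv_exp mult.assoc)
  qed
  have p: "((\<lambda>x. complex_of_real (\<phi> x)) has_vector_derivative complex_of_real (deriv \<phi> x)) (at x)" for x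
    using smooth_has_deriv[OF test_function_smooth[OF assms], of x]
    by (simp add: has_real_derivative_iff_has_vector_derivative has_vector_derivative_of_real)
  have c: "continuous_on UNIV ?e" unfolding cis_conv_exp by (intro continuous_intros)
  have c1: "continuous_on UNIV \<phi>" "continuous_on UNIV (deriv \<phi>)"
    by (intro continuous_on_test_function assms test_function_deriv)+
  have "(LINT x|lborel. ?e x * deriv \<phi> x + (- (\<i> * \<xi>) * ?e x) * \<phi> x) = 0"
  proof (rule integral_deriv_compact_support[where F = "\<lambda>x. ?e x * \<phi> x" and R = "max R R'"])
    show "((\<lambda>x. ?e x * \<phi> x) has_vector_derivative ?e x * deriv \<phi> x + (- (\<i> * \<xi>) * ?e x) * \<phi> x) (at x)" for x
      by (rule has_vector_derivative_mult[OF e p])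
    show "continuous_on UNIV (\<lambda>x. ?e x * deriv \<phi> x + (- (\<i> * \<xi>) * ?e x) * \<phi> x)"
      by (intro continuous_intros c c1)
  qed (use R R' in auto)
  moreover have "integrable lborel (\<lambda>x. ?e x * deriv \<phi> x)" "integrable lborel (\<lambda>x. ?e x * \<phi> x)"
    by (intro integrable_cis_mult integrable_of_real integrable_test_function test_function_deriv assms; measurable)+
  ultimately have "(LINT x|lborel. ?e x * deriv \<phi> x) + (- (\<i> * \<xi>)) * (LINT x|lborel. ?e x * \<phi> x) = 0"
    by (simp add: mult.assoc)
  then show ?thesis unfolding ft_def by simp
qed

lemma ft_higher_deriv:
  "test_function \<phi> \<Longrightarrow> ftr ((deriv ^^ n) \<phi>) \<xi> = (\<i> * \<xi>) ^ n * ftr \<phi> \<xi>"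
  by (induction n) (simp_all add: ft_deriv test_function_higher_deriv)

lemma integrable_inverse_square: "integrable lborel (\<lambda>x::real. inverse (1 + x\<^sup>2))"
  using integrable_inverse_1_plus_square by (simp add: set_integrable_def)

text \<open>Two derivatives of the test function gain a factor \<open>\<xi>^2\<close>, just enough
  for an integrable majorant.\<close>

lemma ft_test_function_decay:
  assumes "test_function \<phi>"
  obtains C where "\<And>\<xi>. norm (ftr \<phi> \<xi>) \<le> C * inverse (1 + \<xi>\<^sup>2)"
proof -
  let ?I = "\<lambda>\<phi>. LINT x|lborel. norm (complex_of_real (\<phi> x))"
  have "norm (ftr \<phi> \<xi>) \<le> (?I \<phi> + ?I ((deriv ^^ 2) \<phi>)) * inverse (1 + \<xi>\<^sup>2)" for \<xi>
  proof -
    have "norm (ftr \<phi> \<xi>) \<le> ?I \<phi>" by (rule norm_ft_le)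
    moreover have "\<xi>\<^sup>2 * norm (ftr \<phi> \<xi>) \<le> ?I ((deriv ^^ 2) \<phi>)"
      using norm_ft_le[of "\<lambda>x. complex_of_real ((deriv ^^ 2) \<phi> x)" \<xi>]
      unfolding ft_higher_deriv[OF assms] by (simp add: norm_mult norm_power)
    ultimately have "(1 + \<xi>\<^sup>2) * norm (ftr \<phi> \<xi>) \<le> ?I \<phi> + ?I ((deriv ^^ 2) \<phi>)" by (simp add: distrib_right)
    then show ?thesis by (simp add: field_simps add_pos_nonneg)
  qed
  then show thesis by (rule that)
qed

lemma integrable_ft_test_function:
  assumes "test_function \<phi>" shows "integrable lborel (ftr \<phi>)"
proof -
  obtain C where C: "\<And>\<xi>. norm (ftr \<phi> \<xi>) \<le> C * inverse (1 + \<xi>\<^sup>2)" using ft_test_function_decay[OF assms] by blast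
  have [measurable]: "\<phi> \<in> borel_measurable borel" by (rule measurable_test_function[OF assms])
  show ?thesis
    by (rule Bochner_Integration.integrable_bound[OF integrable_mult_right[OF integrable_inverse_square, of C]])
       (auto intro!: AE_I2 order_trans[OF C])
qed

lemma nn_integral_square_ft_test_function:
  assumes "test_function \<phi>"
  shows "sqint (\<lambda>\<xi>. ftr \<phi> \<xi>) < \<infinity>"
proof -
  have c: "continuous_on UNIV (\<lambda>x. (\<phi> x)\<^sup>2)" by (intro continuous_intros continuous_on_test_function assms)
  obtain R where R: "\<And>x. R < \<bar>x\<bar> \<Longrightarrow> \<phi> x = 0" using assms unfolding test_function_def by blast
  have i: "integrable lborel (\<lambda>x. (\<phi> x)\<^sup>2)" by (rule integrable_compact_support[OF c, of R]) (simp add: R)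
  have "sqint (\<lambda>x. complex_of_real (\<phi> x)) = ennreal (LINT x|lborel. (\<phi> x)\<^sup>2)"
    using i by (subst nn_integral_eq_integral[symmetric]) auto
  then have "ennreal (2 * pi) * sqint (\<lambda>x. complex_of_real (\<phi> x)) < \<infinity>"
    by (simp add: ennreal_mult_less_top)
  with Plancherel_le[OF integrable_of_real[OF integrable_test_function[OF assms]]] show ?thesis
    by (rule le_less_trans)
qed

text \<open>A Gaussian factor is inserted under the integral and the multiplication formula moves
  the transform onto it. After rescaling, the test function is evaluated at
  \<open>x + u/(n+1)\<close> against a fixed Gaussian in \<open>u\<close> of mass
  \<open>2 * pi\<close>; dominated convergence on both sides gives the formula.\<close>

lemma ft_inversion:
  assumes "test_function \<phi>"
  shows "(LINT \<xi>|lborel. cis (\<xi> * x) * ftr \<phi> \<xi>) = 2 * pi * \<phi> x"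
proof -
  have [measurable]: "\<phi> \<in> borel_measurable borel" by (rule measurable_test_function[OF assms])
  obtain B where B: "\<And>x. \<bar>\<phi> x\<bar> \<le> B" using bounded_test_function[OF assms] by blast
  have i: "integrable lborel (\<lambda>x. complex_of_real (\<phi> x))" using integrable_test_function[OF assms] by simp
  let ?g = "\<lambda>n. gauss (real (Suc n))"
  let ?K = "\<lambda>u. sqrt (2 * pi) * exp (- u\<^sup>2 / 2)"
  have K: "heat 1 = ?K" by (auto simp: heat_def)
  have lim1: "(\<lambda>n. LINT \<xi>|lborel. ftr \<phi> \<xi> * (cis (- (\<xi> * - x)) * of_real (?g n \<xi>))) \<longlonglongrightarrow>
      (LINT \<xi>|lborel. ftr \<phi> \<xi> * (cis (- (\<xi> * - x)) * of_real 1))"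
  proof (rule integral_dominated_convergence[where w = "\<lambda>\<xi>. norm (ftr \<phi> \<xi>)"])
    show "AE \<xi> in lborel. (\<lambda>n. ftr \<phi> \<xi> * (cis (- (\<xi> * - x)) * of_real (?g n \<xi>))) \<longlonglongrightarrow> ftr \<phi> \<xi> * (cis (- (\<xi> * - x)) * of_real 1)"
      by (intro AE_I2 tendsto_mult_left tendsto_of_real gauss_tendsto_1)
    show "integrable lborel (\<lambda>\<xi>. norm (ftr \<phi> \<xi>))" using integrable_ft_test_function[OF assms] by simp
    show "AE \<xi> in lborel. norm (ftr \<phi> \<xi> * (cis (- (\<xi> * - x)) * of_real (?g n \<xi>))) \<le> norm (ftr \<phi> \<xi>)" for n
      using gauss_bounds by (intro AE_I2) (simp add: norm_mult mult_left_le)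
  qed measurable
  have eq: "(LINT \<xi>|lborel. ftr \<phi> \<xi> * (cis (- (\<xi> * - x)) * of_real (?g n \<xi>)))
      = of_real (LINT u|lborel. \<phi> (x + (1 / real (Suc n)) * u) * ?K u)" for n
  proof -
    let ?\<sigma> = "real (Suc n)"
    have ig: "integrable lborel (\<lambda>\<xi>. complex_of_real (gauss ?\<sigma> \<xi>))" using integrable_gauss[of ?\<sigma>] by simp
    have "(LINT \<xi>|lborel. ftr \<phi> \<xi> * (cis (- (\<xi> * - x)) * of_real (gauss ?\<sigma> \<xi>)))
       = (LINT y|lborel. of_real (\<phi> y) * ft (\<lambda>\<xi>. cis (- (\<xi> * - x)) * of_real (gauss ?\<sigma> \<xi>)) y)"
      by (intro ft_multiplication i integrable_cis_mult ig) measurable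
    also have "\<dots> = (LINT y|lborel. of_real (\<phi> y * heat ?\<sigma> (- x + y)))"
      unfolding ft_modulate by (simp add: ft_gauss del: of_nat_Suc)
    also have "\<dots> = of_real (LINT y|lborel. \<phi> y * heat ?\<sigma> (- x + y))" by (rule integral_complex_of_real)
    also have "(LINT y|lborel. \<phi> y * heat ?\<sigma> (- x + y))
        = \<bar>1 / ?\<sigma>\<bar> *\<^sub>R (LINT u|lborel. \<phi> (x + (1 / ?\<sigma>) * u) * heat ?\<sigma> (- x + (x + (1 / ?\<sigma>) * u)))"
      by (rule lborel_integral_real_affine) simp
    also have "\<dots> = (LINT u|lborel. \<bar>1 / ?\<sigma>\<bar> *\<^sub>R (\<phi> (x + (1 / ?\<sigma>) * u) * heat ?\<sigma> (- x + (x + (1 / ?\<sigma>) * u))))"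
      by (rule integral_scaleR_right[symmetric])
    also have "\<dots> = (LINT u|lborel. \<phi> (x + (1 / ?\<sigma>) * u) * ?K u)"
      by (intro Bochner_Integration.integral_cong) (simp_all add: heat_def del: of_nat_Suc)
    finally show ?thesis .
  qed
  have "(\<lambda>n. LINT u|lborel. \<phi> (x + (1 / real (Suc n)) * u) * ?K u) \<longlonglongrightarrow> (LINT u|lborel. \<phi> (x + 0 * u) * ?K u)"
  proof (rule integral_dominated_convergence[where w = "\<lambda>u. B * ?K u"])
    show "integrable lborel (\<lambda>u. B * ?K u)" using integrable_heat[of 1] unfolding K by simp
    have "(\<lambda>n. 1 / real (Suc n)) \<longlonglongrightarrow> 0" by (rule LIMSEQ_Suc[OF lim_const_over_n])
    then have *: "(\<lambda>n. x + (1 / real (Suc n)) * u) \<longlonglongrightarrow> x + 0 * u" for u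
      by (intro tendsto_intros)
    have "isCont \<phi> y" for y
      using continuous_on_test_function[OF assms, of UNIV] by (simp add: continuous_on_eq_continuous_at)
    then show "AE u in lborel. (\<lambda>n. \<phi> (x + (1 / real (Suc n)) * u) * ?K u) \<longlonglongrightarrow> \<phi> (x + 0 * u) * ?K u"
      by (intro AE_I2 tendsto_mult_right isCont_tendsto_compose[OF _ *])
    show "AE u in lborel. norm (\<phi> (x + (1 / real (Suc n)) * u) * ?K u) \<le> B * ?K u" for n
      unfolding norm_mult by (intro AE_I2 mult_mono) (auto intro: B order_trans[OF abs_ge_zero B])
  qed measurable
  then have lim2: "(\<lambda>n. LINT \<xi>|lborel. ftr \<phi> \<xi> * (cis (- (\<xi> * - x)) * of_real (?g n \<xi>))) \<longlonglongrightarrow>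
      of_real (LINT u|lborel. \<phi> (x + 0 * u) * ?K u)"
    unfolding eq by (rule tendsto_of_real)
  have "ennreal (LINT u|lborel. ?K u) = ennreal (2 * pi)"
    using nn_integral_heat[of 1] integrable_heat[of 1] unfolding K
    by (subst nn_integral_eq_integral[symmetric]) auto
  then have "(LINT u|lborel. ?K u) = 2 * pi" by (subst (asm) ennreal_inj) (auto intro!: integral_nonneg_AE)
  then have X: "(LINT u|lborel. \<phi> (x + 0 * u) * ?K u) = 2 * pi * \<phi> x" by simp
  show ?thesis using LIMSEQ_unique[OF lim1 lim2] unfolding X by (simp add: mult.commute)
qed

section \<open>Weak derivatives and square-integrable functions\<close>

lemma locally_integrable_measurable:
  assumes "locally_integrable f" shows "f \<in> borel_measurable borel"
proof (rule borel_measurable_LIMSEQ_metric)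
  show "(\<lambda>x. indicator {- real n..real n} x *\<^sub>R f x) \<in> borel_measurable borel" for n
    using assms[unfolded locally_integrable_def set_integrable_def, rule_format, THEN borel_measurable_integrable, of "real n"]
    by simp
  show "(\<lambda>n. indicator {- real n..real n} x *\<^sub>R f x) \<longlonglongrightarrow> f x" for x
  proof (rule tendsto_eventually)
    obtain N where "\<bar>x\<bar> \<le> real N" using real_arch_simple by blast
    then show "\<forall>\<^sub>F n in sequentially. indicator {- real n..real n} x *\<^sub>R f x = f x"
      by (intro eventually_sequentiallyI[of N]) (auto simp: indicator_def)
  qed
qed

lemma locally_integrable_bounded_mult:
  fixes f :: "real \<Rightarrow> 'a::euclidean_space"
  assumes f: "locally_integrable f" and c: "c \<in> borel_measurable borel" "\<And>x. \<bar>c x\<bar> \<le> B" "\<And>x. R < \<bar>x\<bar> \<Longrightarrow> c x = 0"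
  shows "integrable lborel (\<lambda>x. c x *\<^sub>R f x)"
proof (rule Bochner_Integration.integrable_bound)
  show "integrable lborel (\<lambda>x. B *\<^sub>R (indicator {-R..R} x *\<^sub>R f x))"
    using f unfolding locally_integrable_def set_integrable_def by (intro integrable_scaleR_right) blast
  show "(\<lambda>x. c x *\<^sub>R f x) \<in> borel_measurable lborel"
    using c locally_integrable_measurable[OF f] by auto
  show "AE x in lborel. norm (c x *\<^sub>R f x) \<le> norm (B *\<^sub>R (indicator {-R..R} x *\<^sub>R f x))"
  proof (intro AE_I2)
    fix x
    show "norm (c x *\<^sub>R f x) \<le> norm (B *\<^sub>R (indicator {-R..R} x *\<^sub>R f x))"
    proof (cases "R < \<bar>x\<bar>")
      case False
      then have "x \<in> {-R..R}" by auto
      then show ?thesis using c(2)[of x] by (auto intro!: mult_right_mono order_trans[OF _ abs_ge_self])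
    qed (simp add: c)
  qed
qed

lemma integrable_test_function_mult:
  fixes f :: "real \<Rightarrow> 'a::euclidean_space"
  assumes "locally_integrable f" "test_function \<phi>"
  shows "integrable lborel (\<lambda>x. \<phi> x *\<^sub>R f x)"
proof -
  obtain R where R: "\<And>x. R < \<bar>x\<bar> \<Longrightarrow> \<phi> x = 0" using assms(2) unfolding test_function_def by blast
  obtain B where B: "\<And>x. \<bar>\<phi> x\<bar> \<le> B" using bounded_test_function[OF assms(2)] by blast
  show ?thesis by (rule locally_integrable_bounded_mult[OF assms(1) measurable_test_function[OF assms(2)] B R])
qed

lemma locally_integrable_L2:
  fixes f :: "real \<Rightarrow> 'a::euclidean_space"
  assumes [measurable]: "f \<in> borel_measurable borel" and f: "integrable lborel (\<lambda>x. (norm (f x))\<^sup>2)"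
  shows "locally_integrable f"
  unfolding locally_integrable_def set_integrable_def
proof
  fix R :: real
  show "integrable lborel (\<lambda>x. indicator {-R..R} x *\<^sub>R f x)"
  proof (rule Bochner_Integration.integrable_bound)
    show "integrable lborel (\<lambda>x. indicator {-R..R} x + (norm (f x))\<^sup>2 :: real)"
      using f by (intro Bochner_Integration.integrable_add) (auto simp: emeasure_lborel_Icc_eq)
    have "t \<le> 1 + t\<^sup>2" for t :: real
      using zero_le_power2[of "t - 1/2"] by (simp add: power2_diff power_divide)
    then show "AE x in lborel. norm (indicator {-R..R} x *\<^sub>R f x) \<le> norm (indicator {-R..R} x + (norm (f x))\<^sup>2 :: real)"
      by (intro AE_I2) (auto simp: indicator_def)
  qed measurable
qed

text \<open>Open intervals form an intersection-stable generator of the Borel sets. The sets on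
  which the integral vanishes are closed under disjoint countable unions, and the vanishing total
  integral provides complements.\<close>

lemma AE_zero_of_interval_integrals:
  fixes k :: "real \<Rightarrow> real"
  assumes k: "integrable lborel k" and 0: "\<And>a b. (LINT x:{a<..<b}|lborel. k x) = 0" and 1: "(LINT x|lborel. k x) = 0"
  shows "AE x in lborel. k x = 0"
proof (rule density_unique_real)
  have si: "set_integrable lborel A k" if "A \<in> sets borel" for A
    unfolding set_integrable_def using that k by (intro integrable_mult_indicator) auto
  fix A assume "A \<in> sets (lborel :: real measure)"
  then have "A \<in> sigma_sets UNIV (range (\<lambda>(a, b). {a<..<b::real}))"
    using arg_cong[OF borel_eq_box[where 'a = real], of sets] by (simp add: box_real)
  then show "(LINT x:A|lborel. k x) = (LINT x:A|lborel. 0)"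
  proof -
    assume A: "A \<in> sigma_sets UNIV (range (\<lambda>(a, b). {a<..<b::real}))"
    have stable: "Int_stable (range (\<lambda>(a, b). {a<..<b::real}))"
      by (force simp: Int_stable_def Int_greaterThanLessThan)
    have "(LINT x:A|lborel. k x) = 0 \<and> A \<in> sets borel"
      using stable subset_UNIV[of "range (\<lambda>(a, b). {a<..<b::real})", folded Pow_UNIV] A
  proof (induction rule: sigma_sets_induct_disjoint)
    case (basic A)
    then show ?case using 0 by auto
  next
    case empty
    then show ?case by (simp add: set_lebesgue_integral_def)
  next
    case (compl A)
    then have [measurable]: "A \<in> sets borel" by auto
    have "(LINT x:UNIV - A|lborel. k x) + (LINT x:A|lborel. k x) = (LINT x:(UNIV - A) \<union> A|lborel. k x)"
      by (rule set_integral_Un[symmetric]) (auto intro: si)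
    then show ?case using compl 1 by (simp add: set_lebesgue_integral_def)
  next
    case (union A)
    then have [measurable]: "\<And>i. A i \<in> sets borel" by auto
    have "(LINT x:(\<Union>i. A i)|lborel. k x) = (\<Sum>i. LINT x:A i|lborel. k x)"
      by (rule lebesgue_integral_countable_add) (use union(1) in \<open>auto intro: si simp: disjoint_family_on_def\<close>)
    then show ?case using union by auto
  qed
  then show ?thesis by simp
  qed
qed (use k in auto)

text \<open>Bumps increase the class of admissible multipliers to indicators of intervals, by
  dominated convergence. Integrability is only local, so each component is first cut off to a
  bounded interval.\<close>

lemma fundamental_lemma:
  fixes h :: "real \<Rightarrow> 'a::euclidean_space"
  assumes h: "locally_integrable h" and 0: "\<And>\<phi>. test_function \<phi> \<Longrightarrow> (LINT x|lborel. \<phi> x *\<^sub>R h x) = 0"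
  shows "AE x in lborel. h x = 0"
proof -
  have interval: "(LINT x|lborel. indicator {a<..<b} x *\<^sub>R h x) = 0" for a b
  proof (rule LIMSEQ_unique)
    have [measurable]: "h \<in> borel_measurable borel" by (rule locally_integrable_measurable[OF h])
    show "(\<lambda>n. LINT x|lborel. bump (real (Suc n)) a b x *\<^sub>R h x) \<longlonglongrightarrow> (LINT x|lborel. indicator {a<..<b} x *\<^sub>R h x)"
    proof (rule integral_dominated_convergence[where w = "\<lambda>x. norm (indicator {a<..<b} x *\<^sub>R h x)"])
      show "integrable lborel (\<lambda>x. norm (indicator {a<..<b} x *\<^sub>R h x))"
        by (intro integrable_norm locally_integrable_bounded_mult[OF h, of _ 1 "\<bar>a\<bar> + \<bar>b\<bar>"]) (auto simp: indicator_def)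
      show "AE x in lborel. (\<lambda>n. bump (real (Suc n)) a b x *\<^sub>R h x) \<longlonglongrightarrow> indicator {a<..<b} x *\<^sub>R h x"
        by (intro AE_I2 tendsto_scaleR bump_tendsto_indicator tendsto_const)
      show "(\<lambda>x. bump (real (Suc n)) a b x *\<^sub>R h x) \<in> borel_measurable lborel" for n
        using measurable_test_function[OF test_function_bump, of "real (Suc n)" a b] by simp
      show "AE x in lborel. norm (bump (real (Suc n)) a b x *\<^sub>R h x) \<le> norm (indicator {a<..<b} x *\<^sub>R h x)" for n
      proof (intro AE_I2)
        fix x show "norm (bump (real (Suc n)) a b x *\<^sub>R h x) \<le> norm (indicator {a<..<b} x *\<^sub>R h x)"
          using bump_bounds[of "real (Suc n)" a b x] bump_eq_0[of "real (Suc n)" x a b]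
          by (cases "x \<in> {a<..<b}") (simp_all add: mult_left_le_one_le del: of_nat_Suc)
      qed
    qed measurable
    show "(\<lambda>n. LINT x|lborel. bump (real (Suc n)) a b x *\<^sub>R h x) \<longlonglongrightarrow> 0"
      using 0[OF test_function_bump] by simp
  qed
  have ae: "AE x in lborel. indicator {- real n<..<real n} x * (h x \<bullet> b) = 0" for b and n :: nat
  proof (rule AE_zero_of_interval_integrals)
    have int: "integrable lborel (\<lambda>x. indicator {c<..<d} x *\<^sub>R h x)" for c d
      by (intro locally_integrable_bounded_mult[OF h, of _ 1 "\<bar>c\<bar> + \<bar>d\<bar>"]) (auto simp: indicator_def)
    have i0: "(LINT x|lborel. indicator {c<..<d} x * (h x \<bullet> b)) = 0" for c d
      using integral_inner_left[OF int[of c d], of b] by (simp add: interval)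
    show "integrable lborel (\<lambda>x. indicator {- real n<..<real n} x * (h x \<bullet> b))"
      using integrable_inner_left[OF int[of "- real n" "real n"], of b] by simp
    show "(LINT x|lborel. indicator {- real n<..<real n} x * (h x \<bullet> b)) = 0" by (rule i0)
    fix c d
    have "(\<lambda>x. indicator {c<..<d} x *\<^sub>R (indicator {- real n<..<real n} x * (h x \<bullet> b)))
       = (\<lambda>x. indicator {max c (- real n)<..<min d (real n)} x * (h x \<bullet> b))"
      by (auto simp: fun_eq_iff indicator_def)
    then show "(LINT x:{c<..<d}|lborel. indicator {- real n<..<real n} x * (h x \<bullet> b)) = 0"
      unfolding set_lebesgue_integral_def by (simp add: i0)
  qed
  have "AE x in lborel. \<forall>n::nat. \<forall>b\<in>Basis. indicator {- real n<..<real n} x * (h x \<bullet> b) = 0"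
    by (intro AE_all_countable[THEN iffD2] allI AE_finite_allI ae finite_Basis)
  then show ?thesis
  proof eventually_elim
    case (elim x)
    obtain n :: nat where "\<bar>x\<bar> < real n" using reals_Archimedean2 by blast
    then have "x \<in> {- real n<..<real n}" by auto
    with elim have "\<forall>b\<in>Basis. h x \<bullet> b = 0" by (metis indicator_simps(1) mult_1)
    then show ?case by (simp add: euclidean_all_zero_iff)
  qed
qed

lemma locally_integrable_diff:
  "locally_integrable f \<Longrightarrow> locally_integrable g \<Longrightarrow> locally_integrable (\<lambda>x. f x - g x)"
  unfolding locally_integrable_def by (auto intro: set_integral_diff)

lemma weak_deriv_unique:
  assumes g: "is_weak_deriv n f g" "is_weak_deriv n f g'"
  shows "AE x in lborel. g x = g' x"
proof -
  have l: "locally_integrable g" "locally_integrable g'" using g unfolding is_weak_deriv_def by auto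
  have "AE x in lborel. g x - g' x = 0"
  proof (rule fundamental_lemma[OF locally_integrable_diff[OF l]])
    fix \<phi> :: "real \<Rightarrow> real" assume t: "test_function \<phi>"
    then have "(- 1 :: real) ^ n *\<^sub>R (LINT x|lborel. \<phi> x *\<^sub>R g x) = (- 1) ^ n *\<^sub>R (LINT x|lborel. \<phi> x *\<^sub>R g' x)"
      using g unfolding is_weak_deriv_def by metis
    then have "(LINT x|lborel. \<phi> x *\<^sub>R g x) = (LINT x|lborel. \<phi> x *\<^sub>R g' x)" by simp
    then show "(LINT x|lborel. \<phi> x *\<^sub>R (g x - g' x)) = 0"
      by (simp add: scaleR_diff_right integrable_test_function_mult[OF _ t] l)
  qed
  then show ?thesis by simp
qed

text \<open>Carries estimates from a weak derivative constructed by hand over to the representative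
  picked by the choice operator.\<close>

lemma weak_deriv_L2:
  assumes "is_weak_deriv n f g" "in_L2 g"
  shows "is_weak_deriv n f (weak_deriv n f)" "in_L2 (weak_deriv n f)" "L2_norm (weak_deriv n f) = L2_norm g"
proof -
  show w: "is_weak_deriv n f (weak_deriv n f)" unfolding weak_deriv_def by (rule someI[where P = "is_weak_deriv n f", OF assms(1)])
  then have [measurable]: "weak_deriv n f \<in> borel_measurable borel"
    unfolding is_weak_deriv_def by (auto intro: locally_integrable_measurable)
  have [measurable]: "g \<in> borel_measurable borel" using assms unfolding in_L2_def by auto
  have ae: "AE x in lborel. (norm (weak_deriv n f x))\<^sup>2 = (norm (g x))\<^sup>2"
    using weak_deriv_unique[OF w assms(1)] by eventually_elim simp
  show "in_L2 (weak_deriv n f)"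
    using assms(2) integrable_cong_AE[OF _ _ ae] unfolding in_L2_def by simp
  show "L2_norm (weak_deriv n f) = L2_norm g"
    unfolding L2_norm_def using integral_cong_AE[OF _ _ ae] by simp
qed

section \<open>Pairings and completeness in the square-integrable functions\<close>

lemma L2_mult:
  fixes a b :: "real \<Rightarrow> complex"
  assumes [measurable]: "a \<in> borel_measurable borel" "b \<in> borel_measurable borel"
    and fin: "sqint a < \<infinity>" "sqint b < \<infinity>"
  shows "integrable lborel (\<lambda>x. a x * b x)"
    and "(ennreal (norm (LINT x|lborel. a x * b x)))\<^sup>2
      \<le> sqint a * sqint b"
proof -
  have "(\<integral>\<^sup>+x. ennreal (norm (a x * b x)) \<partial>lborel)\<^sup>2 = (\<integral>\<^sup>+x. ennreal (norm (a x)) * ennreal (norm (b x)) \<partial>lborel)\<^sup>2"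
    by (simp add: norm_mult ennreal_mult)
  also have "\<dots> \<le> (\<integral>\<^sup>+x. (ennreal (norm (a x)))\<^sup>2 \<partial>lborel) * (\<integral>\<^sup>+x. (ennreal (norm (b x)))\<^sup>2 \<partial>lborel)"
    by (rule Cauchy_Schwarz_nn_integral) measurable
  finally have CS: "(\<integral>\<^sup>+x. ennreal (norm (a x * b x)) \<partial>lborel)\<^sup>2
      \<le> sqint a * sqint b"
    by (simp add: ennreal_power)
  also have "\<dots> < \<infinity>" using fin by (simp add: ennreal_mult_less_top)
  finally have "(\<integral>\<^sup>+x. ennreal (norm (a x * b x)) \<partial>lborel) < \<infinity>"
    by (simp add: power_less_top_ennreal)
  then show i: "integrable lborel (\<lambda>x. a x * b x)" by (intro integrableI_bounded) auto
  have "(ennreal (norm (LINT x|lborel. a x * b x)))\<^sup>2 \<le> (\<integral>\<^sup>+x. ennreal (norm (a x * b x)) \<partial>lborel)\<^sup>2"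
    by (intro power_mono integral_norm_bound_ennreal i) simp
  with CS show "(ennreal (norm (LINT x|lborel. a x * b x)))\<^sup>2
      \<le> sqint a * sqint b"
    by (rule order_trans[rotated])
qed

lemma nn_integral_norm_diff_le:
  fixes a b :: "real \<Rightarrow> complex"
  assumes [measurable]: "a \<in> borel_measurable borel" "b \<in> borel_measurable borel"
  shows "sqint (\<lambda>x. a x - b x)
    \<le> 2 * sqint a + 2 * sqint b"
proof -
  have "sqint (\<lambda>x. a x - b x) \<le> (\<integral>\<^sup>+x. 2 * ennreal ((norm (a x))\<^sup>2) + 2 * ennreal ((norm (b x))\<^sup>2) \<partial>lborel)"
  proof (rule nn_integral_mono)
    fix x
    have "(norm (a x - b x))\<^sup>2 \<le> (norm (a x) + norm (b x))\<^sup>2" by (intro power_mono norm_triangle_ineq4) simp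
    also have "\<dots> \<le> 2 * (norm (a x))\<^sup>2 + 2 * (norm (b x))\<^sup>2"
      using sum_squares_bound[of "norm (a x)" "norm (b x)"] by (simp add: power2_sum)
    finally have "ennreal ((norm (a x - b x))\<^sup>2) \<le> ennreal (2 * (norm (a x))\<^sup>2 + 2 * (norm (b x))\<^sup>2)" by (rule ennreal_leI)
    then show "ennreal ((norm (a x - b x))\<^sup>2) \<le> 2 * ennreal ((norm (a x))\<^sup>2) + 2 * ennreal ((norm (b x))\<^sup>2)"
      by (simp add: ennreal_plus ennreal_mult)
  qed
  then show ?thesis by (simp add: nn_integral_add nn_integral_cmult)
qed

lemma L2_pairing_tendsto:
  fixes a b :: "real \<Rightarrow> complex"
  assumes [measurable]: "a \<in> borel_measurable borel" "b \<in> borel_measurable borel" "\<And>n. B n \<in> borel_measurable borel"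
    and fin: "sqint a < \<infinity>" "sqint b < \<infinity>"
    and lim: "(\<lambda>n. sqint (\<lambda>x. b x - B n x)) \<longlonglongrightarrow> 0"
  shows "(\<lambda>n. LINT x|lborel. a x * B n x) \<longlonglongrightarrow> (LINT x|lborel. a x * b x)"
proof -
  let ?A = "sqint a"
  let ?d = "\<lambda>n. sqint (\<lambda>x. b x - B n x)"
  \<comment> \<open>The distances are extended reals; the finitely many indices for which they may
    be infinite have to be discarded before the pairings can be subtracted.\<close>
  have ev: "\<forall>\<^sub>F n in sequentially. ?d n < 1" using lim by (rule order_tendstoD) simp
  have bound: "\<forall>\<^sub>F n in sequentially. (ennreal (norm ((LINT x|lborel. a x * b x) - (LINT x|lborel. a x * B n x))))\<^sup>2 \<le> ?A * ?d n"
    using ev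
  proof eventually_elim
    case (elim n)
    then have d: "?d n < \<infinity>" by (metis ennreal_one_less_top infinity_ennreal_def less_trans)
    note m = L2_mult(2)[OF _ _ fin(1) d] 
    have "integrable lborel (\<lambda>x. a x * (b x - B n x))" by (rule L2_mult(1)[OF _ _ fin(1) d]) measurable
    moreover have ab: "integrable lborel (\<lambda>x. a x * b x)" by (rule L2_mult(1)[OF _ _ fin]) measurable
    ultimately have aB: "integrable lborel (\<lambda>x. a x * B n x)"
      using Bochner_Integration.integrable_diff[of lborel "\<lambda>x. a x * b x" "\<lambda>x. a x * (b x - B n x)"]
      by (simp add: algebra_simps)
    have "(LINT x|lborel. a x * (b x - B n x)) = (LINT x|lborel. a x * b x) - (LINT x|lborel. a x * B n x)"
      using Bochner_Integration.integral_diff[OF ab aB] by (simp add: algebra_simps)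
    then show ?case using m by simp
  qed
  have "(\<lambda>n. ?A * ?d n) \<longlonglongrightarrow> ?A * 0"
    using fin(1) by (intro ennreal_tendsto_cmult lim) simp
  then have "(\<lambda>n. (ennreal (norm ((LINT x|lborel. a x * b x) - (LINT x|lborel. a x * B n x))))\<^sup>2) \<longlonglongrightarrow> 0"
    by (intro tendsto_sandwich[OF _ bound tendsto_const]) (auto intro: always_eventually)
  then have "(\<lambda>n. ennreal ((norm ((LINT x|lborel. a x * b x) - (LINT x|lborel. a x * B n x)))\<^sup>2)) \<longlonglongrightarrow> ennreal 0"
    by (simp add: ennreal_power)
  then have "(\<lambda>n. (norm ((LINT x|lborel. a x * b x) - (LINT x|lborel. a x * B n x)))\<^sup>2) \<longlonglongrightarrow> 0"
    by (rule tendsto_ennrealD) auto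
  then have "(\<lambda>n. sqrt ((norm ((LINT x|lborel. a x * b x) - (LINT x|lborel. a x * B n x)))\<^sup>2)) \<longlonglongrightarrow> sqrt 0"
    by (rule tendsto_real_sqrt)
  then have "(\<lambda>n. norm ((LINT x|lborel. a x * B n x) - (LINT x|lborel. a x * b x))) \<longlonglongrightarrow> 0"
    by (simp add: norm_minus_commute)
  then show ?thesis by (metis LIM_zero_cancel tendsto_norm_zero_cancel)
qed

text \<open>The rate \<open>4^-n\<close> leaves room for the weight \<open>2^n\<close>: the weighted
  squared increments have finite total integral, hence are summable almost everywhere. Since
  \<open>t \<le> 2^-n + 2^n t^2\<close>, the increments themselves are summable. Fatou's lemma gives
  the distance to the limit.\<close>

lemma L2_complete:
  fixes F :: "nat \<Rightarrow> real \<Rightarrow> complex"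
  assumes [measurable]: "\<And>n. F n \<in> borel_measurable borel"
    and c: "c < \<infinity>" "\<And>m n. m \<le> n \<Longrightarrow> (sqint (\<lambda>x. F m x - F n x)) \<le> c * ennreal ((1/4) ^ m)"
  obtains G where "G \<in> borel_measurable borel" "AE x in lborel. (\<lambda>n. F n x) \<longlonglongrightarrow> G x"
    "\<And>m. sqint (\<lambda>x. G x - F m x) \<le> c * ennreal ((1/4) ^ m)"
proof -
  let ?d = "\<lambda>n x. ennreal (2 ^ n * (norm (F n x - F (Suc n) x))\<^sup>2)"
  have "(\<integral>\<^sup>+x. (\<Sum>n. ?d n x) \<partial>lborel) = (\<Sum>n. \<integral>\<^sup>+x. ?d n x \<partial>lborel)"
    by (rule nn_integral_suminf) measurable
  also have "\<dots> \<le> (\<Sum>n. c * ennreal ((1/2) ^ n))"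
  proof (intro suminf_le summableI)
    fix n
    have "(\<integral>\<^sup>+x. ?d n x \<partial>lborel) = ennreal (2 ^ n) * sqint (\<lambda>x. F n x - F (Suc n) x)"
      by (subst nn_integral_cmult[symmetric]) (auto simp: ennreal_mult)
    also have "\<dots> \<le> ennreal (2 ^ n) * (c * ennreal ((1/4) ^ n))" by (intro mult_left_mono c(2)) auto
    also have "\<dots> = c * ennreal (2 ^ n * (1/4) ^ n)" by (simp add: ennreal_mult mult_ac)
    also have "2 ^ n * (1/4) ^ n = (1/2 :: real) ^ n" by (simp flip: power_mult_distrib)
    finally show "(\<integral>\<^sup>+x. ?d n x \<partial>lborel) \<le> c * ennreal ((1/2) ^ n)" .
  qed
  also have "\<dots> = c * ennreal (\<Sum>n. (1/2) ^ n)"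
    by (subst ennreal_suminf_cmult) (simp add: suminf_ennreal2)
  also have "\<dots> < \<infinity>" using c(1) by (simp add: ennreal_mult_less_top)
  finally have "AE x in lborel. (\<Sum>n. ?d n x) \<noteq> \<infinity>"
    by (intro nn_integral_PInf_AE) auto
  then have conv: "AE x in lborel. convergent (\<lambda>n. F n x)"
  proof eventually_elim
    case (elim x)
    have s: "summable (\<lambda>n. 2 ^ n * (norm (F n x - F (Suc n) x))\<^sup>2)"
      by (rule summable_suminf_not_top) (use elim in auto)
    have "summable (\<lambda>n. F (Suc n) x - F n x)"
    proof (rule summable_comparison_test)
      show "summable (\<lambda>n. (1/2) ^ n + 2 ^ n * (norm (F n x - F (Suc n) x))\<^sup>2)"
        by (intro summable_add s summable_geometric) simp
      have "norm (F (Suc n) x - F n x) \<le> (1/2) ^ n + 2 ^ n * (norm (F n x - F (Suc n) x))\<^sup>2" for n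
      proof -
        let ?t = "norm (F n x - F (Suc n) x)"
        have "0 \<le> 2 ^ n * (?t - (1/2) ^ n)\<^sup>2 + ?t" by simp
        also have "\<dots> = 2 ^ n * ?t\<^sup>2 + (1/2) ^ n - ?t"
          by (simp add: power2_diff power2_eq_square power_one_over field_simps)
        finally show ?thesis by (simp add: norm_minus_commute)
      qed
      then show "\<exists>N. \<forall>n\<ge>N. norm (F (Suc n) x - F n x) \<le> (1/2) ^ n + 2 ^ n * (norm (F n x - F (Suc n) x))\<^sup>2" by blast
    qed
    then have "convergent (\<lambda>n. \<Sum>i<n. F (Suc i) x - F i x)" by (simp add: summable_iff_convergent)
    then have "convergent (\<lambda>n. (F n x - F 0 x) + F 0 x)"
      unfolding sum_lessThan_telescope[of "\<lambda>n. F n x"] by (rule convergent_add) (rule convergent_const)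
    then show ?case by simp
  qed
  define G where "G x = lim (\<lambda>n. F n x)" for x
  have [measurable]: "G \<in> borel_measurable borel" unfolding G_def by measurable
  have lim: "AE x in lborel. (\<lambda>n. F n x) \<longlonglongrightarrow> G x"
    using conv by eventually_elim (simp add: G_def convergent_LIMSEQ_iff)
  have "sqint (\<lambda>x. G x - F m x) \<le> c * ennreal ((1/4) ^ m)" for m
  proof -
    have "AE x in lborel. ennreal ((norm (G x - F m x))\<^sup>2) = liminf (\<lambda>n. ennreal ((norm (F m x - F n x))\<^sup>2))"
      using lim
    proof eventually_elim
      case (elim x)
      have "(\<lambda>n. ennreal ((norm (F m x - F n x))\<^sup>2)) \<longlonglongrightarrow> ennreal ((norm (F m x - G x))\<^sup>2)"
        by (intro tendsto_ennrealI tendsto_intros elim)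
      from lim_imp_Liminf[OF _ this] show ?case by (simp add: norm_minus_commute)
    qed
    then have "sqint (\<lambda>x. G x - F m x) = (\<integral>\<^sup>+x. liminf (\<lambda>n. ennreal ((norm (F m x - F n x))\<^sup>2)) \<partial>lborel)"
      by (rule nn_integral_cong_AE)
    also have "\<dots> \<le> liminf (\<lambda>n. sqint (\<lambda>x. F m x - F n x))"
      by (rule nn_integral_liminf) measurable
    also have "\<dots> \<le> liminf (\<lambda>n. c * ennreal ((1/4) ^ m))"
      by (intro Liminf_mono eventually_sequentiallyI[of m] c(2))
    finally show ?thesis by (simp add: Liminf_const)
  qed
  then show thesis by (intro that[of G] lim) auto
qed

section \<open>Mollification and the transform of a weak derivative\<close>

lemma higher_deriv_affine:
  assumes "smooth f"
  shows "(deriv ^^ n) (\<lambda>x. f (a * x + b)) = (\<lambda>x. a ^ n * (deriv ^^ n) f (a * x + b))"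
  using assms
proof (induction n arbitrary: f)
  case (Suc n)
  have "deriv (\<lambda>x. f (a * x + b)) = (\<lambda>x. a * deriv f (a * x + b))"
  proof (rule ext, rule DERIV_imp_deriv)
    fix x
    have "((\<lambda>x. a * x + b) has_real_derivative a) (at x)" by (auto intro!: derivative_eq_intros)
    from DERIV_chain2[OF smooth_has_deriv[OF Suc.prems] this]
    show "((\<lambda>x. f (a * x + b)) has_real_derivative a * deriv f (a * x + b)) (at x)" by (simp add: mult.commute)
  qed
  moreover have "(deriv ^^ n) (\<lambda>x. a * g x) = (\<lambda>x. a * (deriv ^^ n) g x)" if "smooth g" for g
    using that
  proof (induction n arbitrary: g)
    case (Suc n)
    have "deriv (\<lambda>x. a * g x) = (\<lambda>x. a * deriv g x)"
      by (rule ext, rule DERIV_imp_deriv, rule DERIV_cmult, rule smooth_has_deriv[OF Suc.prems])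
    then show ?case using Suc.IH[OF smooth_deriv[OF Suc.prems]] by (simp add: funpow_swap1)
  qed simp
  moreover have "smooth (\<lambda>x. deriv f (a * x + b))"
    using smooth_affine[OF smooth_deriv[OF Suc.prems], of 1] by simp
  ultimately show ?case using Suc.IH[OF smooth_deriv[OF Suc.prems]]
    by (simp add: funpow_swap1 mult_ac)
qed simp

lemma test_function_affine:
  assumes "test_function \<phi>" "a \<noteq> 0"
  shows "test_function (\<lambda>x. c * \<phi> (a * x + b))"
proof -
  obtain R where R: "\<And>x. R < \<bar>x\<bar> \<Longrightarrow> \<phi> x = 0" using assms unfolding test_function_def by blast
  have "\<phi> (a * x + b) = 0" if "(\<bar>R\<bar> + \<bar>b\<bar>) / \<bar>a\<bar> < \<bar>x\<bar>" for x
  proof (rule R)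
    have "\<bar>R\<bar> + \<bar>b\<bar> < \<bar>a * x\<bar>" using that assms(2) by (simp add: field_simps abs_mult)
    then show "R < \<bar>a * x + b\<bar>" by linarith
  qed
  then show ?thesis
    using smooth_affine[OF test_function_smooth[OF assms(1)], of c a b]
    unfolding test_function_def smooth_def by (intro conjI) auto
qed

lemma mollifier_exists:
  obtains \<rho> where "test_function \<rho>" "\<And>x. 0 \<le> \<rho> x" "(LINT x|lborel. \<rho> x) = 1"
proof -
  let ?b = "bump 1 (-1) 1"
  have t: "test_function ?b" by (rule test_function_bump) simp
  have i: "integrable lborel ?b" by (rule integrable_test_function[OF t])
  have "(LINT x|lborel. ?b x) \<noteq> 0"
  proof
    assume "(LINT x|lborel. ?b x) = 0"
    then have "AE x in lborel. ?b x = 0"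
      using i by (subst (asm) integral_nonneg_eq_0_iff_AE) (auto simp: bump_bounds)
    then have "AE x in lborel. x \<notin> {-1<..<1::real}"
    proof eventually_elim
      case (elim x)
      then show ?case using bump_pos[of 1 x "-1" 1] by auto
    qed
    then have "emeasure lborel {-1<..<1::real} = 0"
      by (subst (asm) AE_iff_measurable[of "{-1<..<1}"]) auto
    then show False by simp
  qed
  moreover have "(LINT x|lborel. ?b x) \<ge> 0" by (intro integral_nonneg_AE) (simp add: bump_bounds)
  ultimately have c: "(LINT x|lborel. ?b x) > 0" by simp
  let ?c = "1 / (LINT x|lborel. ?b x)"
  have "test_function (\<lambda>x. ?c * ?b x)" using test_function_affine[OF t, of 1 ?c 0] by simp
  then show thesis using c bump_bounds by (intro that[of "\<lambda>x. ?c * ?b x"]) auto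
qed

lemma ft_convolution:
  assumes f: "integrable lborel f" and g: "integrable lborel g"
  shows "integrable lborel (\<lambda>x. LINT y|lborel. g (x - y) * f y)"
    and "ft (\<lambda>x. LINT y|lborel. g (x - y) * f y) \<xi> = ft g \<xi> * ft f \<xi>"
proof -
  let ?h = "\<lambda>x. LINT y|lborel. g (x - y) * f y"
  have [measurable]: "f \<in> borel_measurable borel" "g \<in> borel_measurable borel" using f g by auto
  have shift: "integrable lborel (\<lambda>x. g (x - y))" for y
    using lborel_integrable_real_affine[OF g, of 1 "- y"] by simp
  have norm_shift: "(LINT x|lborel. norm (g (x - y))) = (LINT x|lborel. norm (g x))" for y
    by (subst (2) lborel_integral_real_affine[where c = 1 and t = "- y"]) simp_all
  have int: "integrable (lborel \<Otimes>\<^sub>M lborel) (\<lambda>(y, x). g (x - y) * f y)"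
  proof (rule lborel_pair.Fubini_integrable)
    show "(\<lambda>(y, x). g (x - y) * f y) \<in> borel_measurable (lborel \<Otimes>\<^sub>M lborel)" by measurable
    show "integrable lborel (\<lambda>y. LINT x|lborel. norm (case (y, x) of (y, x) \<Rightarrow> g (x - y) * f y))"
      using f by (simp add: norm_mult norm_shift)
    show "AE y in lborel. integrable lborel (\<lambda>x. case (y, x) of (y, x) \<Rightarrow> g (x - y) * f y)"
      using shift by auto
  qed
  have int': "integrable (lborel \<Otimes>\<^sub>M lborel) (\<lambda>(x, y). g (x - y) * f y)"
    using lborel_pair.integrable_product_swap[OF int] by (simp add: split_def)
  show "integrable lborel ?h" using lborel_pair.integrable_fst[OF int'] by simp
  have int2: "integrable (lborel \<Otimes>\<^sub>M lborel) (\<lambda>(y, x). cis (- (\<xi> * x)) * (g (x - y) * f y))"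
    by (rule Bochner_Integration.integrable_bound[OF int]) (auto simp: norm_mult)
  have "ft ?h \<xi> = (LINT x|lborel. LINT y|lborel. cis (- (\<xi> * x)) * (g (x - y) * f y))"
    unfolding ft_def by simp
  also have "\<dots> = (LINT y|lborel. LINT x|lborel. cis (- (\<xi> * x)) * (g (x - y) * f y))"
    by (rule lborel_pair.Fubini_integral) (use int2 in simp)
  also have "\<dots> = (LINT y|lborel. ft g \<xi> * (cis (- (\<xi> * y)) * f y))"
  proof (rule Bochner_Integration.integral_cong)
    fix y
    have "(LINT x|lborel. cis (- (\<xi> * x)) * (g (x - y) * f y)) = \<bar>1\<bar> *\<^sub>R (LINT x|lborel. cis (- (\<xi> * (y + 1 * x))) * (g (y + 1 * x - y) * f y))"
      by (rule lborel_integral_real_affine) simp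
    also have "\<dots> = (LINT x|lborel. (cis (- (\<xi> * x)) * g x) * (cis (- (\<xi> * y)) * f y))"
    proof -
      have "cis (- (\<xi> * (y + x))) = cis (- (\<xi> * x)) * cis (- (\<xi> * y))" for x
        by (simp add: cis_mult algebra_simps)
      then show ?thesis by (simp add: mult_ac)
    qed
    also have "\<dots> = ft g \<xi> * (cis (- (\<xi> * y)) * f y)" unfolding ft_def by (rule integral_mult_left_zero)
    finally show "(LINT x|lborel. cis (- (\<xi> * x)) * (g (x - y) * f y)) = ft g \<xi> * (cis (- (\<xi> * y)) * f y)" .
  qed simp
  also have "\<dots> = ft g \<xi> * ft f \<xi>" unfolding ft_def[of f] by (rule integral_mult_right_zero)
  finally show "ft ?h \<xi> = ft g \<xi> * ft f \<xi>" .
qed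

text \<open>Splitting the kernel as a product of two square roots and applying Cauchy-Schwarz is
  Jensen's inequality for the probability density \<open>\<rho>\<close>; a change in the order of
  integration then uses the unit mass once more.\<close>

lemma Young_L2:
  fixes G :: "real \<Rightarrow> complex" and \<rho> :: "real \<Rightarrow> real"
  assumes [measurable]: "G \<in> borel_measurable borel" and \<rho>: "integrable lborel \<rho>" "\<And>x. 0 \<le> \<rho> x" "(LINT x|lborel. \<rho> x) = 1"
    and int: "\<And>x. integrable lborel (\<lambda>y. \<rho> (x - y) *\<^sub>R G y)"
  shows "sqint (\<lambda>x. LINT y|lborel. \<rho> (x - y) *\<^sub>R G y) \<le> sqint G"
proof -
  have [measurable]: "\<rho> \<in> borel_measurable borel" using \<rho> by auto
  have one: "(\<integral>\<^sup>+x. ennreal (\<rho> x) \<partial>lborel) = 1" using \<rho> by (subst nn_integral_eq_integral) auto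
  have shift: "(\<integral>\<^sup>+x. ennreal (\<rho> (x - y)) \<partial>lborel) = 1" for y
    unfolding one[symmetric] by (subst (2) nn_integral_real_affine[where c = 1 and t = "- y"]) simp_all
  have shift': "(\<integral>\<^sup>+y. ennreal (\<rho> (x - y)) \<partial>lborel) = 1" for x
    unfolding one[symmetric] by (subst (2) nn_integral_real_affine[where c = "-1" and t = x]) simp_all
  have "sqint (\<lambda>x. LINT y|lborel. \<rho> (x - y) *\<^sub>R G y)
     \<le> (\<integral>\<^sup>+x. \<integral>\<^sup>+y. ennreal (\<rho> (x - y)) * ennreal ((norm (G y))\<^sup>2) \<partial>lborel \<partial>lborel)"
  proof (rule nn_integral_mono)
    fix x
    have "ennreal ((norm (LINT y|lborel. \<rho> (x - y) *\<^sub>R G y))\<^sup>2) = (ennreal (norm (LINT y|lborel. \<rho> (x - y) *\<^sub>R G y)))\<^sup>2"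
      by (simp add: ennreal_power)
    also have "\<dots> \<le> (\<integral>\<^sup>+y. ennreal (norm (\<rho> (x - y) *\<^sub>R G y)) \<partial>lborel)\<^sup>2"
      by (intro power_mono integral_norm_bound_ennreal int) simp
    also have "(\<integral>\<^sup>+y. ennreal (norm (\<rho> (x - y) *\<^sub>R G y)) \<partial>lborel)
       = (\<integral>\<^sup>+y. ennreal (sqrt (\<rho> (x - y))) * ennreal (sqrt (\<rho> (x - y)) * norm (G y)) \<partial>lborel)"
      using \<rho>(2) by (intro nn_integral_cong) (simp add: ennreal_mult[symmetric] flip: mult.assoc)
    also have "\<dots>\<^sup>2 \<le> (\<integral>\<^sup>+y. (ennreal (sqrt (\<rho> (x - y))))\<^sup>2 \<partial>lborel) * (\<integral>\<^sup>+y. (ennreal (sqrt (\<rho> (x - y)) * norm (G y)))\<^sup>2 \<partial>lborel)"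
      by (rule Cauchy_Schwarz_nn_integral) measurable
    also have "(\<integral>\<^sup>+y. (ennreal (sqrt (\<rho> (x - y))))\<^sup>2 \<partial>lborel) = 1"
      using \<rho>(2) shift'[of x] by (simp add: ennreal_power)
    also have "(\<integral>\<^sup>+y. (ennreal (sqrt (\<rho> (x - y)) * norm (G y)))\<^sup>2 \<partial>lborel) = (\<integral>\<^sup>+y. ennreal (\<rho> (x - y)) * ennreal ((norm (G y))\<^sup>2) \<partial>lborel)"
      using \<rho>(2) by (intro nn_integral_cong) (simp add: ennreal_power power_mult_distrib ennreal_mult)
    finally show "ennreal ((norm (LINT y|lborel. \<rho> (x - y) *\<^sub>R G y))\<^sup>2) \<le> (\<integral>\<^sup>+y. ennreal (\<rho> (x - y)) * ennreal ((norm (G y))\<^sup>2) \<partial>lborel)"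
      by simp
  qed
  also have "\<dots> = (\<integral>\<^sup>+y. \<integral>\<^sup>+x. ennreal (\<rho> (x - y)) * ennreal ((norm (G y))\<^sup>2) \<partial>lborel \<partial>lborel)"
    by (rule lborel_pair.Fubini') measurable
  also have "\<dots> = sqint G"
    by (intro nn_integral_cong) (simp add: nn_integral_multc shift)
  finally show ?thesis .
qed

text \<open>Convolve with \<open>n \<rho>(n x)\<close> for a mollifier \<open>\<rho>\<close>. The \<open>m\<close>-th derivative of this convolution has the
  transform \<open>(i\<xi>)\<^sup>m (ft \<rho>)(\<xi>/n) (ft f)(\<xi>)\<close>, and it is the convolution with \<open>G\<close>, to which Young's
  inequality applies. Then let \<open>n\<close> tend to infinity.\<close>

lemma ft_weak_deriv_le:
  fixes f G :: "real \<Rightarrow> complex"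
  assumes f: "integrable lborel f" and G: "locally_integrable G"
    and weak: "\<And>\<phi>. test_function \<phi> \<Longrightarrow> (LINT x|lborel. (deriv ^^ m) \<phi> x *\<^sub>R f x) = (- 1) ^ m *\<^sub>R (LINT x|lborel. \<phi> x *\<^sub>R G x)"
  shows "wsqint m (ft f) \<le> ennreal (2 * pi) * sqint G"
proof -
  have [measurable]: "f \<in> borel_measurable borel" "G \<in> borel_measurable borel"
    using f locally_integrable_measurable[OF G] by auto
  obtain \<rho> where \<rho>: "test_function \<rho>" "\<And>x. 0 \<le> \<rho> x" "(LINT x|lborel. \<rho> x) = 1" using mollifier_exists by blast
  have [measurable]: "\<rho> \<in> borel_measurable borel" by (rule measurable_test_function[OF \<rho>(1)])
  define r where "r n x = real (Suc n) * \<rho> (real (Suc n) * x + 0)" for n x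
  have r: "test_function (r n)" for n unfolding r_def by (rule test_function_affine[OF \<rho>(1)]) simp
  have [measurable]: "r n \<in> borel_measurable borel" for n by (rule measurable_test_function[OF r])
  have r0: "0 \<le> r n x" for n x unfolding r_def using \<rho>(2) by simp
  have r1: "(LINT x|lborel. r n x) = 1" for n
  proof -
    have "(LINT x|lborel. \<rho> x) = \<bar>real (Suc n)\<bar> *\<^sub>R (LINT x|lborel. \<rho> (0 + real (Suc n) * x))"
      by (rule lborel_integral_real_affine) simp
    then show ?thesis unfolding r_def \<rho>(3) by (simp add: add.commute del: of_nat_Suc)
  qed
  have ftr: "ftr (r n) \<xi> = ftr \<rho> (\<xi> / real (Suc n))" for n \<xi>
  proof -
    have "ftr \<rho> (\<xi> / real (Suc n)) = \<bar>real (Suc n)\<bar> *\<^sub>R (LINT x|lborel. cis (- (\<xi> / real (Suc n) * (0 + real (Suc n) * x))) * of_real (\<rho> (0 + real (Suc n) * x)))"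
      unfolding ft_def by (rule lborel_integral_real_affine) simp
    also have "\<dots> = (LINT x|lborel. \<bar>real (Suc n)\<bar> *\<^sub>R (cis (- (\<xi> / real (Suc n) * (0 + real (Suc n) * x))) * of_real (\<rho> (0 + real (Suc n) * x))))"
      by (rule integral_scaleR_right[symmetric])
    also have "\<dots> = ftr (r n) \<xi>"
      unfolding ft_def r_def by (intro Bochner_Integration.integral_cong) (simp_all add: scaleR_conv_of_real del: of_nat_Suc)
    finally show ?thesis by simp
  qed
  define h where "h n x = (LINT y|lborel. of_real ((deriv ^^ m) (r n) (x - y)) * f y)" for n x
  have hG: "h n x = (LINT y|lborel. r n (x - y) *\<^sub>R G y)" for n x
  proof -
    have t: "test_function (\<lambda>y. r n (- 1 * y + x))" using test_function_affine[OF r[of n], where a = "-1" and b = x and c = 1] by simp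
    \<comment> \<open>The reflected variable produces a sign \<open>(- 1) ^ m\<close>, which cancels
      the one in the definition of the weak derivative.\<close>
    have d: "(deriv ^^ m) (\<lambda>y. r n (- 1 * y + x)) y = (- 1) ^ m * (deriv ^^ m) (r n) (x - y)" for y
      unfolding higher_deriv_affine[OF test_function_smooth[OF r]] by (simp add: algebra_simps)
    have "(- 1) ^ m *\<^sub>R h n x = (LINT y|lborel. (- 1) ^ m *\<^sub>R (of_real ((deriv ^^ m) (r n) (x - y)) * f y))"
      unfolding h_def by simp
    also have "\<dots> = (LINT y|lborel. (deriv ^^ m) (\<lambda>y. r n (- 1 * y + x)) y *\<^sub>R f y)"
      unfolding d by (simp add: scaleR_conv_of_real mult_ac)
    also have "\<dots> = (- 1) ^ m *\<^sub>R (LINT y|lborel. r n (- 1 * y + x) *\<^sub>R G y)" by (rule weak[OF t])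
    finally show ?thesis by (simp add: algebra_simps)
  qed
  have le: "(\<integral>\<^sup>+\<xi>. ennreal ((\<bar>\<xi>\<bar> ^ m * norm (ftr \<rho> (\<xi> / real (Suc n))) * norm (ft f \<xi>))\<^sup>2) \<partial>lborel)
      \<le> ennreal (2 * pi) * sqint G" for n
  proof -
    have i: "integrable lborel (\<lambda>x. complex_of_real ((deriv ^^ m) (r n) x))"
      by (intro integrable_of_real integrable_test_function test_function_higher_deriv r)
    have "ft (h n) \<xi> = ftr ((deriv ^^ m) (r n)) \<xi> * ft f \<xi>" for \<xi>
      unfolding h_def by (rule ft_convolution(2)[OF f i])
    then have n: "norm (ft (h n) \<xi>) = \<bar>\<xi>\<bar> ^ m * norm (ftr \<rho> (\<xi> / real (Suc n))) * norm (ft f \<xi>)" for \<xi>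
      by (simp add: ft_higher_deriv[OF r] ftr norm_mult norm_power del: of_nat_Suc)
    have "sqint (\<lambda>\<xi>. ft (h n) \<xi>) \<le> ennreal (2 * pi) * sqint (h n)"
      unfolding h_def by (rule Plancherel_le, rule ft_convolution(1)[OF f i])
    also have "\<dots> \<le> ennreal (2 * pi) * sqint G"
      unfolding hG
    proof (intro mult_left_mono Young_L2 integrable_test_function r r0 r1)
      fix x
      show "integrable lborel (\<lambda>y. r n (x - y) *\<^sub>R G y)"
        using integrable_test_function_mult[OF G test_function_affine[OF r[of n], where a = "-1" and b = x and c = 1]] by (simp add: algebra_simps)
    qed auto
    finally show ?thesis unfolding n .
  qed
  have lim: "(\<lambda>n. ennreal ((\<bar>\<xi>\<bar> ^ m * norm (ftr \<rho> (\<xi> / real (Suc n))) * norm (ft f \<xi>))\<^sup>2)) \<longlonglongrightarrow> ennreal ((\<bar>\<xi>\<bar> ^ m * norm (ft f \<xi>))\<^sup>2)" for \<xi>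
  proof -
    have "(\<lambda>n. ftr \<rho> (\<xi> / real (Suc n))) \<longlonglongrightarrow> ftr \<rho> 0"
      by (intro ft_tendsto integrable_of_real integrable_test_function \<rho> LIMSEQ_Suc[OF lim_const_over_n])
    moreover have "ftr \<rho> 0 = 1"
      unfolding ft_def using \<rho>(3) by (simp flip: cis_zero)
    ultimately have "(\<lambda>n. norm (ftr \<rho> (\<xi> / real (Suc n)))) \<longlonglongrightarrow> 1" using tendsto_norm by fastforce
    then have "(\<lambda>n. (\<bar>\<xi>\<bar> ^ m * norm (ftr \<rho> (\<xi> / real (Suc n))) * norm (ft f \<xi>))\<^sup>2) \<longlonglongrightarrow> (\<bar>\<xi>\<bar> ^ m * 1 * norm (ft f \<xi>))\<^sup>2"
      by (intro tendsto_power tendsto_mult tendsto_const)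
    then show ?thesis by (intro tendsto_ennrealI) simp
  qed
  have "wsqint m (ft f)
     = (\<integral>\<^sup>+\<xi>. liminf (\<lambda>n. ennreal ((\<bar>\<xi>\<bar> ^ m * norm (ftr \<rho> (\<xi> / real (Suc n))) * norm (ft f \<xi>))\<^sup>2)) \<partial>lborel)"
    by (intro nn_integral_cong lim_imp_Liminf[symmetric] lim) simp
  also have "\<dots> \<le> liminf (\<lambda>n. \<integral>\<^sup>+\<xi>. ennreal ((\<bar>\<xi>\<bar> ^ m * norm (ftr \<rho> (\<xi> / real (Suc n))) * norm (ft f \<xi>))\<^sup>2) \<partial>lborel)"
    by (rule nn_integral_liminf) measurable
  also have "\<dots> \<le> liminf (\<lambda>n. ennreal (2 * pi) * sqint G)"
    by (intro Liminf_mono always_eventually allI le)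
  finally show ?thesis by (simp add: Liminf_const)
qed

section \<open>From the transform back to a weak derivative\<close>

lemma nn_integral_reflect:
  fixes f :: "real \<Rightarrow> ennreal"
  assumes "f \<in> borel_measurable borel"
  shows "(\<integral>\<^sup>+x. f (- x) \<partial>lborel) = (\<integral>\<^sup>+x. f x \<partial>lborel)"
  using assms by (subst (2) nn_integral_real_affine[where c = "-1" and t = 0]) simp_all

lemma integral_reflect_lborel:
  fixes f :: "real \<Rightarrow> complex"
  shows "(LINT x|lborel. f (- x)) = (LINT x|lborel. f x)"
  by (subst (2) lborel_integral_real_affine[where c = "-1" and t = 0]) simp_all

lemma integrable_truncation:
  fixes f :: "real \<Rightarrow> complex"
  assumes [measurable]: "f \<in> borel_measurable borel" and "sqint f < \<infinity>"
  shows "integrable lborel (\<lambda>x. indicator {-R..R} x *\<^sub>R f x)"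
proof -
  have "integrable lborel (\<lambda>x. (norm (f x))\<^sup>2)"
    using assms by (intro integrableI_bounded) auto
  then show ?thesis using locally_integrable_L2[of f] unfolding locally_integrable_def set_integrable_def by auto
qed

text \<open>By inversion the function \<open>ftr \<psi> (- \<xi>)\<close> has transform
  \<open>2 * pi * \<psi>\<close>. Once the truncation interval contains the support of
  \<open>\<psi>\<close>, the multiplication formula yields the same value for every
  \<open>k\<close>, so the limit on the frequency side is that value.\<close>

lemma Parseval_test_function:
  fixes f g :: "real \<Rightarrow> complex"
  assumes [measurable]: "f \<in> borel_measurable borel" "g \<in> borel_measurable borel"
    and fin: "sqint f < \<infinity>" "sqint g < \<infinity>"
    and lim: "(\<lambda>k. sqint (\<lambda>\<xi>. g \<xi> - ft (\<lambda>x. indicator {- real k..real k} x *\<^sub>R f x) \<xi>)) \<longlonglongrightarrow> 0"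
    and \<psi>: "test_function \<psi>"
  shows "(LINT \<xi>|lborel. ftr \<psi> (- \<xi>) * g \<xi>) = 2 * pi * (LINT x|lborel. \<psi> x *\<^sub>R f x)"
proof -
  have [measurable]: "\<psi> \<in> borel_measurable borel" by (rule measurable_test_function[OF \<psi>])
  let ?a = "\<lambda>\<xi>. ftr \<psi> (- \<xi>)"
  let ?f = "\<lambda>k x. indicator {- real k..real k} x *\<^sub>R f x"
  have a: "integrable lborel ?a"
    using lborel_integrable_real_affine[OF integrable_ft_test_function[OF \<psi>], of "-1" 0] by simp
  have afin: "sqint ?a < \<infinity>"
    using nn_integral_square_ft_test_function[OF \<psi>] nn_integral_reflect[of "\<lambda>\<xi>. ennreal ((norm (ftr \<psi> \<xi>))\<^sup>2)"] by simp
  have fta: "ft ?a x = 2 * pi * \<psi> x" for x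
    using integral_reflect_lborel[of "\<lambda>\<xi>. cis (\<xi> * x) * ftr \<psi> \<xi>"] ft_inversion[OF \<psi>, of x]
    unfolding ft_def[of ?a] by (simp add: mult.commute[of x])
  have "(\<lambda>k. LINT \<xi>|lborel. ?a \<xi> * ft (?f k) \<xi>) \<longlonglongrightarrow> (LINT \<xi>|lborel. ?a \<xi> * g \<xi>)"
    by (rule L2_pairing_tendsto[OF _ _ _ afin fin(2) lim]) measurable
  moreover have "(\<lambda>k. LINT \<xi>|lborel. ?a \<xi> * ft (?f k) \<xi>) \<longlonglongrightarrow> 2 * pi * (LINT x|lborel. \<psi> x *\<^sub>R f x)"
  proof (rule tendsto_eventually)
    obtain R where R: "\<And>x. R < \<bar>x\<bar> \<Longrightarrow> \<psi> x = 0" using \<psi> unfolding test_function_def by blast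
    obtain N :: nat where N: "R \<le> real N" using real_arch_simple by blast
    show "\<forall>\<^sub>F k in sequentially. (LINT \<xi>|lborel. ?a \<xi> * ft (?f k) \<xi>) = 2 * pi * (LINT x|lborel. \<psi> x *\<^sub>R f x)"
    proof (rule eventually_sequentiallyI[of N])
      fix k assume k: "N \<le> k"
      have "(LINT \<xi>|lborel. ?a \<xi> * ft (?f k) \<xi>) = (LINT \<xi>|lborel. ft (?f k) \<xi> * ?a \<xi>)" by (simp add: mult.commute)
      also have "\<dots> = (LINT x|lborel. ?f k x * ft ?a x)"
        by (rule ft_multiplication[OF integrable_truncation a]) (use fin in auto)
      also have "\<dots> = (LINT x|lborel. (2 * pi) * (\<psi> x *\<^sub>R f x))"
      proof (rule Bochner_Integration.integral_cong)
        fix x show "?f k x * ft ?a x = (2 * pi) * (\<psi> x *\<^sub>R f x)"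
        proof (cases "real k < \<bar>x\<bar>")
          case True
          then have "R < \<bar>x\<bar>" using N k by linarith
          then show ?thesis by (simp add: fta R)
        next
          case False
          then have "x \<in> {- real k..real k}" by auto
          then show ?thesis by (simp add: fta scaleR_conv_of_real)
        qed
      qed simp
      also have "\<dots> = 2 * pi * (LINT x|lborel. \<psi> x *\<^sub>R f x)" by (rule integral_mult_right_zero)
      finally show "(LINT \<xi>|lborel. ?a \<xi> * ft (?f k) \<xi>) = 2 * pi * (LINT x|lborel. \<psi> x *\<^sub>R f x)" .
    qed
  qed
  ultimately show ?thesis by (rule LIMSEQ_unique)
qed

lemma ft_reflect: "ft (\<lambda>x. f (- x)) \<xi> = ft f (- \<xi>)"
  unfolding ft_def using integral_reflect_lborel[of "\<lambda>x. cis (\<xi> * x) * f x"] by simp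

text \<open>The inverse transforms of truncations of \<open>(i\<xi>)\<^sup>n g\<close> form a Cauchy sequence whose limit
  is the weak derivative.\<close>

lemma weak_deriv_of_ft:
  fixes f g :: "real \<Rightarrow> complex"
  assumes [measurable]: "f \<in> borel_measurable borel" "g \<in> borel_measurable borel"
    and fin: "sqint f < \<infinity>" "sqint g < \<infinity>"
    and lim: "(\<lambda>k. sqint (\<lambda>\<xi>. g \<xi> - ft (\<lambda>x. indicator {- real k..real k} x *\<^sub>R f x) \<xi>)) \<longlonglongrightarrow> 0"
    and finn: "wsqint n g < \<infinity>"
  obtains F where "F \<in> borel_measurable borel"
    "sqint F \<le> ennreal (1 / (2 * pi)) * wsqint n g"
    "\<And>\<phi>. test_function \<phi> \<Longrightarrow> (LINT x|lborel. (deriv ^^ n) \<phi> x *\<^sub>R f x) = (- 1) ^ n *\<^sub>R (LINT x|lborel. \<phi> x *\<^sub>R F x)"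
proof -
  define G where "G \<xi> = (\<i> * of_real \<xi>) ^ n * g \<xi>" for \<xi>
  have [measurable]: "G \<in> borel_measurable borel" unfolding G_def by measurable
  have nG: "norm (G \<xi>) = \<bar>\<xi>\<bar> ^ n * norm (g \<xi>)" for \<xi> unfolding G_def by (simp add: norm_mult norm_power)
  have finG: "sqint G < \<infinity>" using finn unfolding nG .
  have "(\<lambda>k. sqint (\<lambda>\<xi>. G \<xi> - indicator {- real k..real k} \<xi> *\<^sub>R G \<xi>)) \<longlonglongrightarrow> (\<integral>\<^sup>+\<xi>. 0 \<partial>(lborel::real measure))"
  proof (rule nn_integral_dominated_convergence[where w = "\<lambda>\<xi>. ennreal ((norm (G \<xi>))\<^sup>2)"])
    show "AE \<xi> in lborel. ennreal ((norm (G \<xi> - indicator {- real k..real k} \<xi> *\<^sub>R G \<xi>))\<^sup>2) \<le> ennreal ((norm (G \<xi>))\<^sup>2)" for k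
      by (intro AE_I2) (auto simp: indicator_def)
    show "AE \<xi> in lborel. (\<lambda>k. ennreal ((norm (G \<xi> - indicator {- real k..real k} \<xi> *\<^sub>R G \<xi>))\<^sup>2)) \<longlonglongrightarrow> 0"
    proof (intro AE_I2 tendsto_eventually)
      fix \<xi>
      obtain N :: nat where N: "\<bar>\<xi>\<bar> \<le> real N" using real_arch_simple by blast
      show "\<forall>\<^sub>F k in sequentially. ennreal ((norm (G \<xi> - indicator {- real k..real k} \<xi> *\<^sub>R G \<xi>))\<^sup>2) = 0"
        using N by (intro eventually_sequentiallyI[of N]) (auto simp: indicator_def)
    qed
    show "sqint G < \<infinity>" by (rule finG)
  qed measurable
  then have tail: "(\<lambda>k. sqint (\<lambda>\<xi>. G \<xi> - indicator {- real k..real k} \<xi> *\<^sub>R G \<xi>)) \<longlonglongrightarrow> 0" by simp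
  \<comment> \<open>Truncation radii are chosen so that the tails decrease like \<open>4^-m\<close>,
    the rate at which completeness is available.\<close>
  have "\<exists>k::nat. sqint (\<lambda>\<xi>. G \<xi> - indicator {- real k..real k} \<xi> *\<^sub>R G \<xi>) < ennreal ((1/4) ^ m)" for m
    using order_tendstoD(2)[OF tail, of "ennreal ((1/4) ^ m)"] by (auto simp: eventually_sequentially)
  then obtain r :: "nat \<Rightarrow> nat" where r: "\<And>m. sqint (\<lambda>\<xi>. G \<xi> - indicator {- real (r m)..real (r m)} \<xi> *\<^sub>R G \<xi>) < ennreal ((1/4) ^ m)"
    by metis
  define T where "T m \<xi> = indicator {- real (r m)..real (r m)} \<xi> *\<^sub>R G \<xi>" for m \<xi>
  have [measurable]: "T m \<in> borel_measurable borel" for m unfolding T_def by measurable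
  have T: "integrable lborel (T m)" for m unfolding T_def by (rule integrable_truncation[OF _ finG]) measurable
  have tailT: "sqint (\<lambda>\<xi>. G \<xi> - T m \<xi>) < ennreal ((1/4) ^ m)" for m
    unfolding T_def by (rule r)
  \<comment> \<open>The inverse transform of the truncation, written as a reflected forward
    transform so that the Plancherel inequality for \<open>ft\<close> applies.\<close>
  define F where "F m x = of_real (1 / (2 * pi)) * ft (T m) (- x)" for m x
  have [measurable]: "F m \<in> borel_measurable borel" for m unfolding F_def by measurable
  have inv: "sqint (\<lambda>x. of_real (1 / (2 * pi)) * ft h (- x)) \<le> ennreal (1 / (2 * pi)) * sqint h"
    if h: "integrable lborel h" for h
  proof -
    have [measurable]: "h \<in> borel_measurable borel" using h by auto
    have "sqint (\<lambda>x. of_real (1 / (2 * pi)) * ft h (- x))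
       = (\<integral>\<^sup>+x. ennreal ((1 / (2 * pi))\<^sup>2) * ennreal ((norm (ft h (- x)))\<^sup>2) \<partial>lborel)"
      by (intro nn_integral_cong) (simp add: norm_mult norm_divide power_mult_distrib power_divide ennreal_mult[symmetric])
    also have "\<dots> = ennreal ((1 / (2 * pi))\<^sup>2) * sqint (ft h)"
      using nn_integral_reflect[of "\<lambda>x. ennreal ((norm (ft h x))\<^sup>2)"] by (subst nn_integral_cmult) simp_all
    also have "\<dots> \<le> ennreal ((1 / (2 * pi))\<^sup>2) * (ennreal (2 * pi) * sqint h)"
      by (intro mult_left_mono Plancherel_le h) simp
    also have "\<dots> = ennreal ((1 / (2 * pi))\<^sup>2 * (2 * pi)) * sqint h"
      by (simp add: ennreal_mult mult.assoc)
    also have "(1 / (2 * pi))\<^sup>2 * (2 * pi) = 1 / (2 * pi)" by (simp add: power2_eq_square)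
    finally show ?thesis .
  qed
  \<comment> \<open>The factor 4 arises from \<open>|a - b|^2 \<le> 2 |a|^2 + 2 |b|^2\<close>, both
    tails being at most \<open>4^-m\<close>.\<close>
  have Cauchy: "sqint (\<lambda>x. F m x - F k x) \<le> ennreal (4 / (2 * pi)) * ennreal ((1/4) ^ m)" if "m \<le> k" for m k
  proof -
    have "F m x - F k x = of_real (1 / (2 * pi)) * ft (\<lambda>\<xi>. T m \<xi> - T k \<xi>) (- x)" for x
    proof -
      have "ft (\<lambda>\<xi>. T m \<xi> - T k \<xi>) y = ft (T m) y - ft (T k) y" for y
        unfolding ft_def right_diff_distrib by (intro Bochner_Integration.integral_diff integrable_cis_mult T) measurable
      then show ?thesis unfolding F_def by (simp add: right_diff_distrib)
    qed
    then have "sqint (\<lambda>x. F m x - F k x) \<le> ennreal (1 / (2 * pi)) * sqint (\<lambda>\<xi>. T m \<xi> - T k \<xi>)"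
      using inv[of "\<lambda>\<xi>. T m \<xi> - T k \<xi>"] T by simp
    also have "sqint (\<lambda>\<xi>. T m \<xi> - T k \<xi>) = sqint (\<lambda>\<xi>. (G \<xi> - T k \<xi>) - (G \<xi> - T m \<xi>))"
      by simp
    also have "\<dots> \<le> 2 * sqint (\<lambda>\<xi>. G \<xi> - T k \<xi>) + 2 * sqint (\<lambda>\<xi>. G \<xi> - T m \<xi>)"
      by (rule nn_integral_norm_diff_le) measurable
    also have "\<dots> \<le> 2 * ennreal ((1/4) ^ m) + 2 * ennreal ((1/4) ^ m)"
    proof (intro add_mono mult_left_mono)
      show "sqint (\<lambda>\<xi>. G \<xi> - T k \<xi>) \<le> ennreal ((1/4) ^ m)"
        using power_decreasing[OF that, of "1/4 :: real"] by (intro order_trans[OF less_imp_le[OF tailT]] ennreal_leI) simp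
    qed (use tailT less_imp_le in auto)
    also have "\<dots> = ennreal (4 * (1/4) ^ m)" by (simp add: ennreal_mult flip: distrib_right)
    also have "ennreal (1 / (2 * pi)) * ennreal (4 * (1/4) ^ m) = ennreal (4 / (2 * pi)) * ennreal ((1/4) ^ m)"
      by (simp flip: ennreal_mult)
    finally show ?thesis by (auto simp: mult_left_mono)
  qed
  obtain F' where F': "F' \<in> borel_measurable borel" "AE x in lborel. (\<lambda>n. F n x) \<longlonglongrightarrow> F' x"
    "\<And>m. sqint (\<lambda>x. F' x - F m x) \<le> ennreal (4 / (2 * pi)) * ennreal ((1/4) ^ m)"
    using L2_complete[of F "ennreal (4 / (2 * pi))", OF _ _ Cauchy] by auto
  note [measurable] = F'(1)
  have bound: "sqint F' \<le> ennreal (1 / (2 * pi)) * sqint G"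
  proof -
    have "AE x in lborel. ennreal ((norm (F' x))\<^sup>2) = liminf (\<lambda>n. ennreal ((norm (F n x))\<^sup>2))"
      using F'(2)
    proof eventually_elim
      case (elim x)
      have "(\<lambda>n. ennreal ((norm (F n x))\<^sup>2)) \<longlonglongrightarrow> ennreal ((norm (F' x))\<^sup>2)"
        by (intro tendsto_ennrealI tendsto_intros elim)
      from lim_imp_Liminf[OF _ this] show ?case by simp
    qed
    then have "sqint F' = (\<integral>\<^sup>+x. liminf (\<lambda>n. ennreal ((norm (F n x))\<^sup>2)) \<partial>lborel)"
      by (rule nn_integral_cong_AE)
    also have "\<dots> \<le> liminf (\<lambda>n. sqint (F n))"
      by (rule nn_integral_liminf) measurable
    also have "\<dots> \<le> liminf (\<lambda>n::nat. ennreal (1 / (2 * pi)) * sqint G)"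
    proof (intro Liminf_mono always_eventually allI)
      fix m
      have "sqint (F m) \<le> ennreal (1 / (2 * pi)) * sqint (T m)"
        unfolding F_def by (rule inv[OF T])
      also have "\<dots> \<le> ennreal (1 / (2 * pi)) * sqint G"
        by (intro mult_left_mono nn_integral_mono) (auto simp: T_def indicator_def)
      finally show "sqint (F m) \<le> ennreal (1 / (2 * pi)) * sqint G" .
    qed
    finally show ?thesis by (simp add: Liminf_const)
  qed
  have finF: "sqint F' < \<infinity>"
    by (rule le_less_trans[OF bound]) (use finG in \<open>simp add: ennreal_mult_less_top\<close>)
  have zero: "(\<lambda>m. c * ennreal ((1/4) ^ m)) \<longlonglongrightarrow> 0" if "c < \<infinity>" for c
  proof -
    have "(\<lambda>m. ennreal ((1/4) ^ m)) \<longlonglongrightarrow> ennreal 0" by (intro tendsto_ennrealI LIMSEQ_power_zero) simp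
    from ennreal_tendsto_cmult[OF _ this, of c] that show ?thesis by simp
  qed
  have weak: "(LINT x|lborel. (deriv ^^ n) \<phi> x *\<^sub>R f x) = (- 1) ^ n *\<^sub>R (LINT x|lborel. \<phi> x *\<^sub>R F' x)" if \<phi>: "test_function \<phi>" for \<phi>
  proof -
    have [measurable]: "\<phi> \<in> borel_measurable borel" by (rule measurable_test_function[OF \<phi>])
    let ?a = "\<lambda>\<xi>. ftr \<phi> (- \<xi>)"
    have afin: "sqint ?a < \<infinity>"
      using nn_integral_square_ft_test_function[OF \<phi>] nn_integral_reflect[of "\<lambda>\<xi>. ennreal ((norm (ftr \<phi> \<xi>))\<^sup>2)"] by simp
    have \<phi>i: "integrable lborel (\<lambda>x. complex_of_real (\<phi> (- x)))"
      using lborel_integrable_real_affine[OF integrable_test_function[OF \<phi>], of "-1" 0] by simp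
    have \<phi>fin: "sqint (\<lambda>x. complex_of_real (\<phi> x)) < \<infinity>"
    proof -
      obtain R where R: "\<And>x. R < \<bar>x\<bar> \<Longrightarrow> \<phi> x = 0" using \<phi> unfolding test_function_def by blast
      have "continuous_on UNIV (\<lambda>x. (\<phi> x)\<^sup>2)" by (intro continuous_on_power continuous_on_test_function \<phi>)
      then have "integrable lborel (\<lambda>x. (\<phi> x)\<^sup>2)"
        by (rule integrable_compact_support[of _ R]) (simp add: R)
      then show ?thesis by (subst nn_integral_eq_integral) auto
    qed
    have eq: "(LINT x|lborel. complex_of_real (\<phi> x) * F m x) = of_real (1 / (2 * pi)) * (LINT \<xi>|lborel. ?a \<xi> * T m \<xi>)" for m
    proof -
      have "(LINT x|lborel. complex_of_real (\<phi> x) * F m x) = (LINT x|lborel. complex_of_real (\<phi> (- x)) * F m (- x))"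
        by (rule integral_reflect_lborel[symmetric])
      also have "\<dots> = (LINT x|lborel. of_real (1 / (2 * pi)) * (ft (T m) x * complex_of_real (\<phi> (- x))))"
        unfolding F_def by (simp add: mult_ac)
      also have "\<dots> = of_real (1 / (2 * pi)) * (LINT x|lborel. ft (T m) x * complex_of_real (\<phi> (- x)))" by (rule integral_mult_right_zero)
      also have "(LINT x|lborel. ft (T m) x * complex_of_real (\<phi> (- x))) = (LINT \<xi>|lborel. T m \<xi> * ft (\<lambda>x. complex_of_real (\<phi> (- x))) \<xi>)"
        by (rule ft_multiplication[OF T \<phi>i])
      finally show ?thesis unfolding ft_reflect[of "\<lambda>x. complex_of_real (\<phi> x)"] by (simp add: mult.commute)
    qed
    have "(\<lambda>m. LINT x|lborel. complex_of_real (\<phi> x) * F m x) \<longlonglongrightarrow> (LINT x|lborel. complex_of_real (\<phi> x) * F' x)"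
    proof (rule L2_pairing_tendsto[OF _ _ _ \<phi>fin finF])
      show "(\<lambda>m. sqint (\<lambda>x. F' x - F m x)) \<longlonglongrightarrow> 0"
        by (rule tendsto_sandwich[OF _ _ tendsto_const zero[of "ennreal (4 / (2 * pi))"]])
           (intro always_eventually allI F'(3) zero_le | simp)+
    qed measurable
    moreover have "(\<lambda>m. LINT \<xi>|lborel. ?a \<xi> * T m \<xi>) \<longlonglongrightarrow> (LINT \<xi>|lborel. ?a \<xi> * G \<xi>)"
    proof (rule L2_pairing_tendsto[OF _ _ _ afin finG])
      show "(\<lambda>m. sqint (\<lambda>\<xi>. G \<xi> - T m \<xi>)) \<longlonglongrightarrow> 0"
        by (rule tendsto_sandwich[OF _ _ tendsto_const zero[of 1]])
           (auto intro!: always_eventually less_imp_le[OF tailT])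
    qed measurable
    ultimately have 1: "(LINT x|lborel. complex_of_real (\<phi> x) * F' x) = of_real (1 / (2 * pi)) * (LINT \<xi>|lborel. ?a \<xi> * G \<xi>)"
      unfolding eq using LIMSEQ_unique tendsto_mult_left by blast
    \<comment> \<open>At \<open>- \<xi>\<close> the \<open>n\<close>-th derivative of the test
      function contributes \<open>(- i\<xi>)^n\<close>; comparison with the factor
      \<open>(i\<xi>)^n\<close> in \<open>G\<close> gives the sign required by integration by
      parts.\<close>
    have "?a \<xi> * G \<xi> = (- 1) ^ n * (ftr ((deriv ^^ n) \<phi>) (- \<xi>) * g \<xi>)" for \<xi>
    proof -
      have "(\<i> * complex_of_real \<xi>) ^ n = (- 1) ^ n * (\<i> * complex_of_real (- \<xi>)) ^ n"
        by (simp flip: power_mult_distrib)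
      then show ?thesis unfolding G_def ft_higher_deriv[OF \<phi>] by (simp add: mult_ac)
    qed
    then have "(LINT \<xi>|lborel. ?a \<xi> * G \<xi>) = (- 1) ^ n * (LINT \<xi>|lborel. ftr ((deriv ^^ n) \<phi>) (- \<xi>) * g \<xi>)" by simp
    also have "\<dots> = (- 1) ^ n * (2 * pi * (LINT x|lborel. (deriv ^^ n) \<phi> x *\<^sub>R f x))"
      unfolding Parseval_test_function[OF _ _ fin lim test_function_higher_deriv[OF \<phi>], simplified] by simp
    finally have 2: "(LINT x|lborel. \<phi> x *\<^sub>R F' x) = (- 1) ^ n * (LINT x|lborel. (deriv ^^ n) \<phi> x *\<^sub>R f x)"
      using 1 by (simp add: scaleR_conv_of_real)
    have "(- 1) ^ n *\<^sub>R (LINT x|lborel. \<phi> x *\<^sub>R F' x) = ((- 1) ^ n * (- 1) ^ n) * (LINT x|lborel. (deriv ^^ n) \<phi> x *\<^sub>R f x)"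
      unfolding 2 by (simp add: scaleR_conv_of_real mult.assoc)
    then show ?thesis by (simp flip: power_mult_distrib)
  qed
  show thesis using that[OF F'(1) _ weak] bound unfolding nG by blast
qed

section \<open>Vector-valued functions and the decay estimate\<close>

lemma measurable_vec_nth: "f \<in> borel_measurable M \<Longrightarrow> (\<lambda>x. (f x :: complex ^ 'n) $ i) \<in> borel_measurable M"
  by (rule borel_measurable_continuous_on[of "\<lambda>x. x $ i"]) (intro continuous_intros)

lemma measurable_vec:
  fixes f :: "'a \<Rightarrow> complex ^ 'n"
  assumes "\<And>i. (\<lambda>x. f x $ i) \<in> borel_measurable M"
  shows "f \<in> borel_measurable M"
  by (subst borel_measurable_euclidean_space)
     (auto simp: Basis_vec_def inner_axis intro!: borel_measurable_inner assms)

lemma norm_vec_square: "(norm (x :: complex ^ 'n))\<^sup>2 = (\<Sum>i\<in>UNIV. (norm (x $ i))\<^sup>2)"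
  by (simp add: power2_norm_eq_inner inner_vec_def)

lemma norm_cis_vec: "norm (cis a *s (x :: complex ^ 'n)) = norm x"
proof -
  have "(norm (cis a *s x))\<^sup>2 = (norm x)\<^sup>2" unfolding norm_vec_square by (simp add: norm_mult)
  then show ?thesis by simp
qed

lemma nn_integral_norm_vec:
  fixes f :: "real \<Rightarrow> complex ^ 'n"
  assumes "f \<in> borel_measurable borel" "c \<in> borel_measurable borel"
  shows "(\<integral>\<^sup>+x. ennreal ((c x * norm (f x))\<^sup>2) \<partial>lborel) = (\<Sum>i\<in>UNIV. \<integral>\<^sup>+x. ennreal ((c x * norm (f x $ i))\<^sup>2) \<partial>lborel)"
proof -
  note [measurable] = assms(2) measurable_vec_nth[OF assms(1)]
  have sum: "ennreal ((c x * norm (f x))\<^sup>2) = (\<Sum>i\<in>UNIV. ennreal ((c x * norm (f x $ i))\<^sup>2))" for x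
    by (subst sum_ennreal) (simp_all add: power_mult_distrib norm_vec_square sum_distrib_left)
  show ?thesis unfolding sum by (rule nn_integral_sum) measurable
qed

lemma L2_norm_nn_integral:
  assumes "in_L2 f" shows "sqint f = ennreal ((L2_norm f)\<^sup>2)"
  using assms unfolding in_L2_def L2_norm_def by (subst nn_integral_eq_integral) auto

lemma in_L2I:
  assumes "f \<in> borel_measurable borel" "sqint f < \<infinity>"
  shows "in_L2 f"
  unfolding in_L2_def using assms by (auto intro!: integrableI_bounded)

lemma in_L2_nth:
  assumes "in_L2 f"
  shows "sqint (\<lambda>x. (f x :: complex ^ 'n) $ i) < \<infinity>"
proof -
  have "sqint (\<lambda>x. f x $ i) \<le> sqint f"
    by (intro nn_integral_mono ennreal_leI power_mono Finite_Cartesian_Product.norm_nth_le norm_ge_zero)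
  then show ?thesis unfolding L2_norm_nn_integral[OF assms] by (simp add: le_less_trans)
qed

lemma integrable_vec_nth:
  fixes f :: "real \<Rightarrow> complex ^ 'n"
  shows "integrable lborel f \<Longrightarrow> integrable lborel (\<lambda>x. f x $ i)"
  by (rule integrable_bounded_linear[OF bounded_linear_vec_nth])

lemma integral_vec_nth:
  fixes f :: "real \<Rightarrow> complex ^ 'n"
  shows "integrable lborel f \<Longrightarrow> (LINT x|lborel. f x) $ i = (LINT x|lborel. f x $ i)"
  by (rule integral_bounded_linear[OF bounded_linear_vec_nth, symmetric])

lemma integrable_cis_vec:
  fixes f :: "real \<Rightarrow> complex ^ 'n"
  assumes "integrable lborel f"
  shows "integrable lborel (\<lambda>x. cis (- (\<xi> * x)) *s f x)"
proof (rule Bochner_Integration.integrable_bound[OF assms])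
  note [measurable] = measurable_vec_nth[OF borel_measurable_integrable[OF assms]]
  show "(\<lambda>x. cis (- (\<xi> * x)) *s f x) \<in> borel_measurable lborel"
    by (rule measurable_vec) (simp, measurable)
qed (simp add: norm_cis_vec)

lemma fourier_nth:
  "integrable lborel f \<Longrightarrow> fourier f \<xi> $ i = ft (\<lambda>x. f x $ i) \<xi>"
  unfolding fourier_def ft_def by (subst integral_vec_nth) (simp_all add: integrable_cis_vec)

lemma norm_fourier_le: "norm (fourier f \<xi>) \<le> L1_norm f"
  unfolding fourier_def L1_norm_def by (rule order_trans[OF integral_norm_bound]) (simp add: norm_cis_vec)

lemma measurable_fourier:
  assumes "integrable lborel f" shows "fourier f \<in> borel_measurable borel"
proof (rule measurable_vec)
  fix i
  have "(\<lambda>x. f x $ i) \<in> borel_measurable borel"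
    using measurable_vec_nth[OF borel_measurable_integrable[OF assms]] by simp
  then show "(\<lambda>\<xi>. fourier f \<xi> $ i) \<in> borel_measurable borel"
    unfolding fourier_nth[OF assms] by (rule measurable_ft)
qed

lemma locally_integrable_nth:
  "locally_integrable f \<Longrightarrow> locally_integrable (\<lambda>x. (f x :: complex ^ 'n) $ i)"
  unfolding locally_integrable_def set_integrable_def using integrable_vec_nth by fastforce

lemma fourier_weak_deriv_le:
  fixes f G :: "real \<Rightarrow> complex ^ 'n"
  assumes f: "in_L1 f" and G: "is_weak_deriv m f G" "in_L2 G"
  shows "wsqint m (fourier f) \<le> ennreal (2 * pi * (L2_norm G)\<^sup>2)"
proof -
  have f': "integrable lborel f" using f unfolding in_L1_def .
  have l: "locally_integrable f" "locally_integrable G" using G unfolding is_weak_deriv_def by auto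
  have "wsqint m (fourier f)
     = (\<Sum>i\<in>UNIV. wsqint m (\<lambda>\<xi>. ft (\<lambda>x. f x $ i) \<xi>))"
    unfolding fourier_nth[OF f', symmetric] by (rule nn_integral_norm_vec[OF measurable_fourier[OF f']]) measurable
  also have "\<dots> \<le> (\<Sum>i\<in>UNIV. ennreal (2 * pi) * sqint (\<lambda>x. G x $ i))"
  proof (intro sum_mono ft_weak_deriv_le integrable_vec_nth f' locally_integrable_nth l)
    fix i and \<phi> :: "real \<Rightarrow> real" assume \<phi>: "test_function \<phi>"
    have "(LINT x|lborel. (deriv ^^ m) \<phi> x *\<^sub>R f x) = (- 1) ^ m *\<^sub>R (LINT x|lborel. \<phi> x *\<^sub>R G x)"
      using G \<phi> unfolding is_weak_deriv_def by blast
    then have "(LINT x|lborel. (deriv ^^ m) \<phi> x *\<^sub>R f x) $ i = (- 1) ^ m *\<^sub>R ((LINT x|lborel. \<phi> x *\<^sub>R G x) $ i)" by simp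
    then show "(LINT x|lborel. (deriv ^^ m) \<phi> x *\<^sub>R (f x $ i)) = (- 1) ^ m *\<^sub>R (LINT x|lborel. \<phi> x *\<^sub>R (G x $ i))"
      by (simp add: integral_vec_nth integrable_test_function_mult l \<phi> test_function_higher_deriv)
  qed
  also have "\<dots> = ennreal (2 * pi) * sqint G"
    using nn_integral_norm_vec[of G "\<lambda>_. 1"] G unfolding in_L2_def by (simp add: sum_distrib_left)
  also have "\<dots> = ennreal (2 * pi * (L2_norm G)\<^sup>2)"
    unfolding L2_norm_nn_integral[OF G(2)] by (simp add: ennreal_mult)
  finally show ?thesis .
qed

text \<open>The scalar construction is applied to each component. Squared norms add up over
  components, so the constant does not depend on the dimension.\<close>

lemma weak_deriv_of_fourier:
  fixes f g :: "real \<Rightarrow> complex ^ 'n"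
  assumes fg: "has_L2_fourier f g"
    and fin: "wsqint n g \<le> ennreal B" "B \<ge> 0"
  shows "is_weak_deriv n f (weak_deriv n f)" "in_L2 (weak_deriv n f)"
    "2 * pi * (L2_norm (weak_deriv n f))\<^sup>2 \<le> B"
proof -
  have L2: "in_L2 f" "in_L2 g" using fg unfolding has_L2_fourier_def by auto
  have m: "f \<in> borel_measurable borel" "g \<in> borel_measurable borel" using L2 unfolding in_L2_def by auto
  have lf: "locally_integrable f" using L2 unfolding in_L2_def by (intro locally_integrable_L2) auto
  have trunc: "integrable lborel (\<lambda>x. indicator {-R..R} x *\<^sub>R f x)" for R
    using lf unfolding locally_integrable_def set_integrable_def by blast
  have gi: "wsqint n (\<lambda>\<xi>. g \<xi> $ i) < \<infinity>" for i
  proof -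
    have "wsqint n (\<lambda>\<xi>. g \<xi> $ i) \<le> (wsqint n g)"
      by (intro nn_integral_mono ennreal_leI power_mono mult_left_mono Finite_Cartesian_Product.norm_nth_le) auto
    also have "\<dots> < \<infinity>" by (rule le_less_trans[OF fin(1)]) simp
    finally show ?thesis .
  qed
  have lim: "(\<lambda>k. sqint (\<lambda>\<xi>. g \<xi> $ i - ft (\<lambda>x. indicator {- real k..real k} x *\<^sub>R (f x $ i)) \<xi>)) \<longlonglongrightarrow> 0" for i
  proof (rule tendsto_sandwich[OF _ _ tendsto_const])
    show "(\<lambda>k. sqint (\<lambda>\<xi>. g \<xi> - fourier (\<lambda>x. indicator {- real k..real k} x *\<^sub>R f x) \<xi>)) \<longlonglongrightarrow> 0"
      using fg unfolding has_L2_fourier_def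
      by (elim conjE) (rule filterlim_compose[OF _ filterlim_real_sequentially])
    show "\<forall>\<^sub>F k in sequentially. sqint (\<lambda>\<xi>. g \<xi> $ i - ft (\<lambda>x. indicator {- real k..real k} x *\<^sub>R (f x $ i)) \<xi>)
      \<le> (sqint (\<lambda>\<xi>. g \<xi> - fourier (\<lambda>x. indicator {- real k..real k} x *\<^sub>R f x) \<xi>))"
    proof (intro always_eventually allI nn_integral_mono ennreal_leI power_mono)
      fix k \<xi>
      show "norm (g \<xi> $ i - ft (\<lambda>x. indicator {- real k..real k} x *\<^sub>R (f x $ i)) \<xi>)
         \<le> norm (g \<xi> - fourier (\<lambda>x. indicator {- real k..real k} x *\<^sub>R f x) \<xi>)"
        using Finite_Cartesian_Product.norm_nth_le[of "g \<xi> - fourier (\<lambda>x. indicator {- real k..real k} x *\<^sub>R f x) \<xi>" i]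
          fourier_nth[OF trunc[of "real k"], of \<xi> i] by simp
    qed simp
  qed simp
  define P where "P i F \<longleftrightarrow> F \<in> borel_measurable borel \<and>
   sqint F \<le> ennreal (1 / (2 * pi)) * wsqint n (\<lambda>\<xi>. g \<xi> $ i) \<and>
    (\<forall>\<phi>. test_function \<phi> \<longrightarrow> (LINT x|lborel. (deriv ^^ n) \<phi> x *\<^sub>R (f x $ i)) = (- 1) ^ n *\<^sub>R (LINT x|lborel. \<phi> x *\<^sub>R F x))"
    for i and F :: "real \<Rightarrow> complex"
  have "\<exists>F. P i F" for i
    unfolding P_def
    by (rule weak_deriv_of_ft[OF measurable_vec_nth[OF m(1)] measurable_vec_nth[OF m(2)] in_L2_nth[OF L2(1)] in_L2_nth[OF L2(2)] lim gi[of i]]) blast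
  then have "\<forall>i. \<exists>F. P i F" ..
  then obtain F where PF: "\<And>i. P i (F i)" using choice by blast
  have F: "F i \<in> borel_measurable borel"
    "sqint (F i) \<le> ennreal (1 / (2 * pi)) * wsqint n (\<lambda>\<xi>. g \<xi> $ i)"
    "\<And>\<phi>. test_function \<phi> \<Longrightarrow> (LINT x|lborel. (deriv ^^ n) \<phi> x *\<^sub>R (f x $ i)) = (- 1) ^ n *\<^sub>R (LINT x|lborel. \<phi> x *\<^sub>R F i x)"
    for i using PF[of i] unfolding P_def by blast+
  define G where "G x = (\<chi> i. F i x)" for x
  have Gi: "G x $ i = F i x" for x i by (simp add: G_def)
  have Gm: "G \<in> borel_measurable borel" by (rule measurable_vec) (simp add: G_def F)
  have "sqint G = (\<Sum>i\<in>UNIV. sqint (F i))"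
    using nn_integral_norm_vec[OF Gm, of "\<lambda>_. 1"] by (simp add: G_def)
  also have "\<dots> \<le> (\<Sum>i\<in>UNIV. ennreal (1 / (2 * pi)) * wsqint n (\<lambda>\<xi>. g \<xi> $ i))"
    by (intro sum_mono F)
  also have "\<dots> = ennreal (1 / (2 * pi)) * wsqint n g"
    by (subst nn_integral_norm_vec[OF m(2)]) (simp_all add: sum_distrib_left)
  also have "\<dots> \<le> ennreal (1 / (2 * pi)) * ennreal B" by (intro mult_left_mono fin) simp
  also have "\<dots> = ennreal (B / (2 * pi))" using fin(2) by (simp flip: ennreal_mult)
  finally have nG: "sqint G \<le> ennreal (B / (2 * pi))" .
  have GL2: "in_L2 G" by (rule in_L2I[OF Gm]) (rule le_less_trans[OF nG], simp)
  have lG: "locally_integrable G" using GL2 unfolding in_L2_def by (intro locally_integrable_L2) auto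
  have "is_weak_deriv n f G"
    unfolding is_weak_deriv_def
  proof (intro conjI allI impI lf lG)
    fix \<phi> :: "real \<Rightarrow> real" assume \<phi>: "test_function \<phi>"
    show "(LINT x|lborel. (deriv ^^ n) \<phi> x *\<^sub>R f x) = (- 1) ^ n *\<^sub>R (LINT x|lborel. \<phi> x *\<^sub>R G x)"
      by (simp add: vec_eq_iff integral_vec_nth integrable_test_function_mult lf lG \<phi> test_function_higher_deriv F(3) Gi)
  qed
  note w = weak_deriv_L2[OF this GL2]
  show "is_weak_deriv n f (weak_deriv n f)" "in_L2 (weak_deriv n f)" by (fact w)+
  have "ennreal ((L2_norm G)\<^sup>2) \<le> ennreal (B / (2 * pi))" using nG unfolding L2_norm_nn_integral[OF GL2] .
  then have "(L2_norm G)\<^sup>2 \<le> B / (2 * pi)" using fin(2) by (subst (asm) ennreal_le_iff) auto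
  then show "2 * pi * (L2_norm (weak_deriv n f))\<^sup>2 \<le> B" unfolding w(3) by (simp add: field_simps)
qed

section \<open>Decay in time and the final estimate\<close>

lemma power_exp_bound:
  fixes c y :: real
  assumes "c > 0" "y \<ge> 0"
  shows "y ^ k * exp (- c * y) \<le> (real k / c) ^ k"
proof (cases "k = 0")
  case True
  then show ?thesis using assms by simp
next
  case False
  \<comment> \<open>The inequality \<open>(1 + x/k)^k \<le> exp x\<close> at \<open>x = c y\<close>
    produces the constant \<open>(k/c)^k\<close> without locating the maximum.\<close>
  have "(c * y / real k) ^ k \<le> (1 + c * y / real k) ^ k" using assms by (intro power_mono) auto
  also have "\<dots> \<le> exp (c * y)"
    by (rule exp_ge_one_plus_x_over_n_power_n) (use False assms in \<open>auto intro: order_trans[of _ 0]\<close>)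
  finally have "(real k / c) ^ k * (c * y / real k) ^ k \<le> (real k / c) ^ k * exp (c * y)"
    using assms by (intro mult_left_mono) auto
  moreover have "(real k / c) ^ k * (c * y / real k) ^ k = y ^ k"
    using assms False by (simp flip: power_mult_distrib)
  ultimately show ?thesis by (simp add: exp_minus field_simps)
qed

text \<open>Since \<open>|\<xi>| \<le> 1\<close>, replacing \<open>t\<close> by \<open>1 + t\<close>
  costs only the factor \<open>exp c\<close>, and it removes the singularity at
  \<open>t = 0\<close>. The substitution \<open>x = s \<xi>\<close> with
  \<open>s = (1+t)^(1/4)\<close> then gives \<open>s^-(2j+1)\<close>: \<open>2j\<close> powers from
  the weight and one from the measure.\<close>

lemma low_frequency_integral:
  fixes c :: real
  assumes c: "c > 0"
  obtains K where "K \<ge> 0" "\<And>t. t \<ge> 0 \<Longrightarrow>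
    (\<integral>\<^sup>+\<xi>. ennreal (indicator {-1..1} \<xi> * (\<bar>\<xi>\<bar> ^ (2 * j) * exp (- c * \<xi>^4 * t))) \<partial>lborel)
      \<le> ennreal (K * (1 + t) powr (- (2 * real j + 1) / 4))"
proof -
  define f where "f x = \<bar>x\<bar> ^ (2 * j) * exp (- c * x^4)" for x :: real
  have [measurable]: "f \<in> borel_measurable borel" unfolding f_def by measurable
  define M where "M = 2 * (1 + (real (j + 1) / c) ^ (j + 1))"
  have f_le: "f x \<le> M * inverse (1 + x\<^sup>2)" for x
  proof -
    have "\<bar>x\<bar> ^ (2 * j) * (1 + x\<^sup>2) \<le> 2 * (1 + (x^4) ^ (j + 1))"
    proof (cases "\<bar>x\<bar> \<le> 1")
      case True
      have "\<bar>x\<bar> ^ (2 * j) \<le> 1" "x\<^sup>2 \<le> 1"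
        by (rule power_le_one) (use True in \<open>simp_all add: abs_square_le_1\<close>)
      then have "\<bar>x\<bar> ^ (2 * j) * (1 + x\<^sup>2) \<le> 1 * (1 + 1)"
        by (intro mult_mono add_left_mono) simp_all
      then show ?thesis by (rule order_trans) simp
    next
      case False
      then have "1 \<le> \<bar>x\<bar> ^ 2" by (intro one_le_power) simp
      then have "\<bar>x\<bar> ^ (2 * j) * (1 + x\<^sup>2) \<le> \<bar>x\<bar> ^ (2 * j) * (2 * \<bar>x\<bar> ^ 2)" by (intro mult_left_mono) auto
      also have "\<dots> = 2 * \<bar>x\<bar> ^ (2 * j + 2)" unfolding power_add by simp
      also have "\<dots> \<le> 2 * \<bar>x\<bar> ^ (4 * (j + 1))" using False by (intro mult_left_mono power_increasing) auto
      also have "\<dots> \<le> 2 * (1 + (x^4) ^ (j + 1))" unfolding power_mult[of _ 4] by simp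
      finally show ?thesis .
    qed
    then have "\<bar>x\<bar> ^ (2 * j) * (1 + x\<^sup>2) * exp (- c * x^4) \<le> 2 * (1 + (x^4) ^ (j + 1)) * exp (- c * x^4)"
      by (intro mult_right_mono) auto
    also have "\<dots> = 2 * (exp (- c * x^4) + (x^4) ^ (j + 1) * exp (- c * x^4))" by (simp add: algebra_simps)
    also have "\<dots> \<le> M" unfolding M_def using c power_exp_bound[OF c, of "x^4" "j + 1"]
      by (intro mult_left_mono add_mono) (auto simp: zero_le_mult_iff)
    finally show ?thesis unfolding f_def by (simp add: field_simps add_pos_nonneg)
  qed
  have M: "M \<ge> 0" unfolding M_def using c by simp
  have "(\<integral>\<^sup>+x. ennreal (f x) \<partial>lborel) \<le> (\<integral>\<^sup>+x. ennreal M * ennreal (inverse (1 + x\<^sup>2)) \<partial>lborel)"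
    using f_le M by (intro nn_integral_mono) (simp flip: ennreal_mult)
  also have "\<dots> = ennreal M * (\<integral>\<^sup>+x. ennreal (inverse (1 + x\<^sup>2)) \<partial>lborel)" by (rule nn_integral_cmult) measurable
  also have "\<dots> < \<infinity>"
    by (subst nn_integral_eq_integral[OF integrable_inverse_square]) (auto simp: ennreal_mult_less_top)
  finally obtain K where K: "K \<ge> 0" "(\<integral>\<^sup>+x. ennreal (f x) \<partial>lborel) = ennreal K"
    by (cases "\<integral>\<^sup>+x. ennreal (f x) \<partial>lborel") auto
  show thesis
  proof (rule that[of "exp c * K"])
    fix t :: real assume t: "t \<ge> 0"
    define s where "s = (1 + t) powr (1/4)"
    have s: "s > 0" "s^4 = 1 + t" unfolding s_def using t by (auto simp: powr_power)
    have s2: "inverse (s ^ (2 * j + 1)) = (1 + t) powr (- (2 * real j + 1) / 4)"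
    proof -
      have "s ^ (2 * j + 1) = (1 + t) powr ((2 * real j + 1) / 4)"
        unfolding s_def by (subst powr_power) (use t in \<open>auto simp: field_simps\<close>)
      then show ?thesis by (simp only: powr_minus minus_divide_left[symmetric])
    qed
    have "(\<integral>\<^sup>+\<xi>. ennreal (indicator {-1..1} \<xi> * (\<bar>\<xi>\<bar> ^ (2 * j) * exp (- c * \<xi>^4 * t))) \<partial>lborel)
        \<le> (\<integral>\<^sup>+\<xi>. ennreal (exp c * inverse (s ^ (2 * j))) * ennreal (f (0 + s * \<xi>)) \<partial>lborel)"
    proof (rule nn_integral_mono)
      fix \<xi> :: real
      have "indicator {-1..1} \<xi> * (\<bar>\<xi>\<bar> ^ (2 * j) * exp (- c * \<xi>^4 * t)) \<le> exp c * inverse (s ^ (2 * j)) * f (0 + s * \<xi>)"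
      proof -
        have eq: "inverse (s ^ (2 * j)) * f (0 + s * \<xi>) = \<bar>\<xi>\<bar> ^ (2 * j) * exp (- c * \<xi>^4 * (1 + t))"
          unfolding f_def using s by (simp add: abs_mult power_mult_distrib mult_ac)
        have "exp (- c * \<xi>^4 * t) \<le> exp c * exp (- c * \<xi>^4 * (1 + t))" if "\<bar>\<xi>\<bar> \<le> 1"
        proof -
          have "\<xi>^4 \<le> 1" using power_le_one[of "\<bar>\<xi>\<bar>" 4] that by simp
          then have "c * \<xi>^4 \<le> c" using c by simp
          then show ?thesis unfolding exp_add[symmetric] by (simp add: algebra_simps)
        qed
        then show ?thesis unfolding mult.assoc eq
          by (cases "\<bar>\<xi>\<bar> \<le> 1") (auto simp: indicator_def mult.left_commute[of "exp c"] intro!: mult_left_mono)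
      qed
      then show "ennreal (indicator {-1..1} \<xi> * (\<bar>\<xi>\<bar> ^ (2 * j) * exp (- c * \<xi>^4 * t))) \<le> ennreal (exp c * inverse (s ^ (2 * j))) * ennreal (f (0 + s * \<xi>))"
        using s by (subst ennreal_mult[symmetric]) (auto simp: f_def intro!: ennreal_leI)
    qed
    also have "\<dots> = ennreal (exp c * inverse (s ^ (2 * j))) * (\<integral>\<^sup>+\<xi>. ennreal (f (0 + s * \<xi>)) \<partial>lborel)"
      by (rule nn_integral_cmult) measurable
    also have "(\<integral>\<^sup>+\<xi>. ennreal (f (0 + s * \<xi>)) \<partial>lborel) = ennreal (inverse s * K)"
    proof -
      have "ennreal K = ennreal \<bar>s\<bar> * (\<integral>\<^sup>+\<xi>. ennreal (f (0 + s * \<xi>)) \<partial>lborel)"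
        unfolding K(2)[symmetric] using s by (intro nn_integral_real_affine) auto
      then have "ennreal (inverse s) * ennreal K = (ennreal (inverse s) * ennreal s) * (\<integral>\<^sup>+\<xi>. ennreal (f (0 + s * \<xi>)) \<partial>lborel)"
        using s by (simp add: mult.assoc)
      also have "ennreal (inverse s) * ennreal s = 1" using s by (simp flip: ennreal_mult)
      finally show ?thesis using s K by (simp add: ennreal_mult)
    qed
    also have "ennreal (exp c * inverse (s ^ (2 * j))) * ennreal (inverse s * K) = ennreal (exp c * K * inverse (s ^ (2 * j + 1)))"
      using s K by (simp add: ennreal_mult[symmetric] mult_ac)
    finally show "(\<integral>\<^sup>+\<xi>. ennreal (indicator {-1..1} \<xi> * (\<bar>\<xi>\<bar> ^ (2 * j) * exp (- c * \<xi>^4 * t))) \<partial>lborel)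
      \<le> ennreal (exp c * K * (1 + t) powr (- (2 * real j + 1) / 4))" unfolding s2 .
  qed (use K in simp)
qed

text \<open>With \<open>a = 1/\<xi>^4\<close> one has \<open>1 + t \<le> \<xi>^4 (1 + a t)\<close>,
  and powers of \<open>1 + a t\<close> are absorbed by the exponential. The squared inequality is
  proved, with rate \<open>2c\<close>, so that the exponent \<open>l/2\<close> becomes the natural
  number \<open>l\<close>.\<close>

lemma high_frequency_bound:
  fixes c :: real
  assumes c: "c > 0"
  obtains M where "M \<ge> 0" "\<And>t \<xi>. t \<ge> 0 \<Longrightarrow> 1 \<le> \<bar>\<xi>\<bar> \<Longrightarrow>
    exp (- c * (1 / \<xi>^4) * t) \<le> M * (1 + t) powr (- real l / 2) * \<bar>\<xi>\<bar> ^ (2 * l)"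
proof -
  define B where "B = exp (2 * c) * (real l / (2 * c)) ^ l"
  have B: "B \<ge> 0" unfolding B_def using c by simp
  show thesis
  proof (rule that[of "sqrt B"])
    fix t \<xi> :: real assume t: "t \<ge> 0" and \<xi>: "1 \<le> \<bar>\<xi>\<bar>"
    define a where "a = 1 / \<xi>^4"
    have x4: "1 \<le> \<xi>^4" using one_le_power[OF \<xi>, of 4] by simp
    have a: "a > 0" "\<xi>^4 * a = 1" unfolding a_def using x4 by auto
    have "(1 + t) ^ l \<le> (\<xi>^4 * (1 + a * t)) ^ l"
      using t x4 a by (intro power_mono) (simp_all add: distrib_left flip: mult.assoc)
    also have "\<dots> = (\<xi>^4) ^ l * (1 + a * t) ^ l" by (rule power_mult_distrib)
    also have "(1 + a * t) ^ l \<le> B * exp (2 * c * (a * t))"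
    proof -
      have "(1 + a * t) ^ l * exp (- (2 * c) * (1 + a * t)) \<le> (real l / (2 * c)) ^ l"
        using c a t by (intro power_exp_bound) auto
      then have le: "exp (2 * c) * exp (2 * c * (a * t)) * ((1 + a * t) ^ l * exp (- (2 * c) * (1 + a * t)))
         \<le> exp (2 * c) * exp (2 * c * (a * t)) * (real l / (2 * c)) ^ l" by (intro mult_left_mono) auto
      have one: "exp (2 * c) * exp (2 * c * (a * t)) * exp (- (2 * c) * (1 + a * t)) = 1"
        by (simp add: algebra_simps flip: exp_add)
      have "exp (2 * c) * exp (2 * c * (a * t)) * ((1 + a * t) ^ l * exp (- (2 * c) * (1 + a * t)))
          = (1 + a * t) ^ l * (exp (2 * c) * exp (2 * c * (a * t)) * exp (- (2 * c) * (1 + a * t)))"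
        by (simp only: mult_ac)
      then have "exp (2 * c) * exp (2 * c * (a * t)) * ((1 + a * t) ^ l * exp (- (2 * c) * (1 + a * t))) = (1 + a * t) ^ l"
        unfolding one by simp
      with le show ?thesis unfolding B_def by (simp only: mult_ac)
    qed
    finally have "(1 + t) ^ l \<le> (\<xi>^4) ^ l * (B * exp (2 * c * (a * t)))" by (simp add: mult_left_mono)
    also have "\<dots> = (sqrt B * \<bar>\<xi>\<bar> ^ (2 * l) * exp (c * a * t))\<^sup>2"
    proof -
      have "(\<bar>\<xi>\<bar> ^ (2 * l))\<^sup>2 = (\<xi>^4) ^ l"
      proof -
        have "(\<bar>\<xi>\<bar> ^ (2 * l))\<^sup>2 = \<bar>\<xi>\<bar> ^ (4 * l)" unfolding power_mult[symmetric] by (simp add: mult.commute)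
        then show ?thesis unfolding power_mult[of _ 4] by simp
      qed
      moreover have "(exp (c * a * t))\<^sup>2 = exp (2 * c * (a * t))" by (simp add: power2_eq_square mult_ac flip: exp_add)
      ultimately show ?thesis using B by (simp add: power_mult_distrib)
    qed
    finally have "((1 + t) powr (real l / 2))\<^sup>2 \<le> (sqrt B * \<bar>\<xi>\<bar> ^ (2 * l) * exp (c * a * t))\<^sup>2"
      using t by (simp add: powr_power powr_realpow)
    then have "(1 + t) powr (real l / 2) \<le> sqrt B * \<bar>\<xi>\<bar> ^ (2 * l) * exp (c * a * t)"
      by (rule power2_le_imp_le) (use B in auto)
    then show "exp (- c * (1 / \<xi>^4) * t) \<le> sqrt B * (1 + t) powr (- real l / 2) * \<bar>\<xi>\<bar> ^ (2 * l)"
      unfolding a_def[symmetric] using t by (simp add: exp_minus powr_minus field_simps)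
  qed (use B in simp)
qed

text \<open>The frequencies \<open>|\<xi>| \<le> 1\<close> give the term with \<open>\<parallel>U\<^sub>0\<parallel>\<close> in \<open>L\<^sup>1\<close>, the others the term with
  \<open>\<partial>\<^sub>x\<^sup>j\<^sup>+\<^sup>l U\<^sub>0\<close> in \<open>L\<^sup>2\<close>; \<open>b\<close> is the decay of the latter.\<close>

lemma fourier_estimate:
  fixes g w :: "real \<Rightarrow> complex ^ 'n" and a b A D :: real
  assumes g: "g \<in> borel_measurable borel" "w \<in> borel_measurable borel"
    and low: "\<And>\<xi>. \<bar>\<xi>\<bar> \<le> 1 \<Longrightarrow> (norm (g \<xi>))\<^sup>2 \<le> C * exp (- c * \<xi>^4 * t) * A\<^sup>2"
    and high: "\<And>\<xi>. 1 \<le> \<bar>\<xi>\<bar> \<Longrightarrow> (norm (g \<xi>))\<^sup>2 \<le> C * (b * \<bar>\<xi>\<bar> ^ (2 * l)) * (norm (w \<xi>))\<^sup>2"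
    and a: "(\<integral>\<^sup>+\<xi>. ennreal (indicator {-1..1} \<xi> * (\<bar>\<xi>\<bar> ^ (2 * j) * exp (- c * \<xi>^4 * t))) \<partial>lborel) \<le> ennreal a"
    and D: "wsqint (j + l) w \<le> ennreal D"
    and nonneg: "0 \<le> C" "0 \<le> a" "0 \<le> b" "0 \<le> D"
  shows "wsqint j g \<le> ennreal (C * A\<^sup>2 * a + C * b * D)"
proof -
  let ?L = "\<lambda>\<xi>::real. indicator {-1..1} \<xi> * (\<bar>\<xi>\<bar> ^ (2 * j) * exp (- c * \<xi>^4 * t))"
  let ?H = "\<lambda>\<xi>. (\<bar>\<xi>\<bar> ^ (j + l) * norm (w \<xi>))\<^sup>2"
  have [measurable]: "(\<lambda>\<xi>. norm (w \<xi>)) \<in> borel_measurable borel" using g by measurable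
  have "wsqint j g
     \<le> (\<integral>\<^sup>+\<xi>. ennreal (C * A\<^sup>2) * ennreal (?L \<xi>) + ennreal (C * b) * ennreal (?H \<xi>) \<partial>lborel)"
  proof (rule nn_integral_mono)
    fix \<xi> :: real
    have p: "(\<bar>\<xi>\<bar> ^ j * norm (g \<xi>))\<^sup>2 = \<bar>\<xi>\<bar> ^ (2 * j) * (norm (g \<xi>))\<^sup>2"
      by (simp add: power_mult_distrib power_mult[symmetric] mult.commute)
    have H: "0 \<le> ?H \<xi>" "0 \<le> ?L \<xi>" by (auto simp: indicator_def)
    have "(\<bar>\<xi>\<bar> ^ j * norm (g \<xi>))\<^sup>2 \<le> C * A\<^sup>2 * ?L \<xi> + C * b * ?H \<xi>"
    proof (cases "\<bar>\<xi>\<bar> \<le> 1")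
      case True
      have "\<bar>\<xi>\<bar> ^ (2 * j) * (norm (g \<xi>))\<^sup>2 \<le> \<bar>\<xi>\<bar> ^ (2 * j) * (C * exp (- c * \<xi>^4 * t) * A\<^sup>2)"
        by (intro mult_left_mono low True) simp
      also have "\<dots> = C * A\<^sup>2 * ?L \<xi>" using True by (auto simp: indicator_def)
      finally show ?thesis using nonneg H(1) unfolding p by (meson add_increasing2 mult_nonneg_nonneg)
    next
      case False
      have "\<bar>\<xi>\<bar> ^ (2 * j) * (norm (g \<xi>))\<^sup>2 \<le> \<bar>\<xi>\<bar> ^ (2 * j) * (C * (b * \<bar>\<xi>\<bar> ^ (2 * l)) * (norm (w \<xi>))\<^sup>2)"
        using False by (intro mult_left_mono high) auto
      also have "\<dots> = C * b * ?H \<xi>"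
      proof -
        have "(\<bar>\<xi>\<bar> ^ (j + l))\<^sup>2 = \<bar>\<xi>\<bar> ^ (2 * j) * \<bar>\<xi>\<bar> ^ (2 * l)"
          unfolding power_mult[symmetric] power_add[symmetric] by (simp add: algebra_simps)
        then show ?thesis by (simp only: power_mult_distrib mult_ac)
      qed
      finally show ?thesis using nonneg H(2) unfolding p by (meson add_increasing mult_nonneg_nonneg zero_le_power2)
    qed
    then have "ennreal ((\<bar>\<xi>\<bar> ^ j * norm (g \<xi>))\<^sup>2) \<le> ennreal (C * A\<^sup>2 * ?L \<xi> + C * b * ?H \<xi>)" by (rule ennreal_leI)
    also have "\<dots> = ennreal (C * A\<^sup>2) * ennreal (?L \<xi>) + ennreal (C * b) * ennreal (?H \<xi>)"
      using nonneg H by (subst ennreal_plus) (simp_all add: ennreal_mult del: times_divide_eq_right)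
    finally show "ennreal ((\<bar>\<xi>\<bar> ^ j * norm (g \<xi>))\<^sup>2) \<le> ennreal (C * A\<^sup>2) * ennreal (?L \<xi>) + ennreal (C * b) * ennreal (?H \<xi>)" .
  qed
  also have "\<dots> = ennreal (C * A\<^sup>2) * (\<integral>\<^sup>+\<xi>. ennreal (?L \<xi>) \<partial>lborel) + ennreal (C * b) * (\<integral>\<^sup>+\<xi>. ennreal (?H \<xi>) \<partial>lborel)"
    by (subst nn_integral_add, measurable, subst nn_integral_cmult, measurable, subst nn_integral_cmult, measurable)
  also have "\<dots> \<le> ennreal (C * A\<^sup>2) * ennreal a + ennreal (C * b) * ennreal D"
    by (intro add_mono mult_left_mono a D) simp_all
  also have "\<dots> = ennreal (C * A\<^sup>2 * a + C * b * D)"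
    using nonneg by (simp add: ennreal_mult ennreal_plus)
  finally show ?thesis .
qed

text \<open>The intermediate weights \<open>|\<xi>|^n\<close> are dominated by 1 for small
  frequencies and by \<open>|\<xi>|^j\<close> for large ones.\<close>

lemma sobolev_of_fourier:
  fixes f g :: "real \<Rightarrow> complex ^ 'n"
  assumes fg: "has_L2_fourier f g"
    and B: "wsqint j g \<le> ennreal B" "B \<ge> 0"
  shows "in_sobolev j f"
  unfolding in_sobolev_def
proof (intro conjI allI impI)
  have L2: "in_L2 f" "in_L2 g" using fg unfolding has_L2_fourier_def by auto
  then show "in_L2 f" by simp
  have [measurable]: "(\<lambda>\<xi>. norm (g \<xi>)) \<in> borel_measurable borel" using L2 unfolding in_L2_def by auto
  fix n assume n: "n \<le> j"
  have "wsqint n g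
     \<le> (\<integral>\<^sup>+\<xi>. ennreal ((norm (g \<xi>))\<^sup>2) + ennreal ((\<bar>\<xi>\<bar> ^ j * norm (g \<xi>))\<^sup>2) \<partial>lborel)"
  proof (rule nn_integral_mono)
    fix \<xi> :: real
    have "(\<bar>\<xi>\<bar> ^ n * norm (g \<xi>))\<^sup>2 \<le> (norm (g \<xi>))\<^sup>2 + (\<bar>\<xi>\<bar> ^ j * norm (g \<xi>))\<^sup>2"
    proof (cases "\<bar>\<xi>\<bar> \<le> 1")
      case True
      then have "(\<bar>\<xi>\<bar> ^ n * norm (g \<xi>))\<^sup>2 \<le> (1 * norm (g \<xi>))\<^sup>2"
        by (intro power_mono mult_right_mono power_le_one) simp_all
      then show ?thesis by (simp add: add_increasing2)
    next
      case False
      then have "(\<bar>\<xi>\<bar> ^ n * norm (g \<xi>))\<^sup>2 \<le> (\<bar>\<xi>\<bar> ^ j * norm (g \<xi>))\<^sup>2"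
        by (intro power_mono mult_right_mono power_increasing n) simp_all
      then show ?thesis by (rule add_increasing[OF zero_le_power2])
    qed
    then have "ennreal ((\<bar>\<xi>\<bar> ^ n * norm (g \<xi>))\<^sup>2) \<le> ennreal ((norm (g \<xi>))\<^sup>2 + (\<bar>\<xi>\<bar> ^ j * norm (g \<xi>))\<^sup>2)"
      by (rule ennreal_leI)
    also have "\<dots> = ennreal ((norm (g \<xi>))\<^sup>2) + ennreal ((\<bar>\<xi>\<bar> ^ j * norm (g \<xi>))\<^sup>2)"
      by (rule ennreal_plus) simp_all
    finally show "ennreal ((\<bar>\<xi>\<bar> ^ n * norm (g \<xi>))\<^sup>2) \<le> ennreal ((norm (g \<xi>))\<^sup>2) + ennreal ((\<bar>\<xi>\<bar> ^ j * norm (g \<xi>))\<^sup>2)" .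
  qed
  also have "\<dots> = sqint g + wsqint j g"
    by (rule nn_integral_add) measurable
  also have "\<dots> \<le> ennreal ((L2_norm g)\<^sup>2) + ennreal B"
    unfolding L2_norm_nn_integral[OF L2(2)] by (intro add_left_mono B)
  also have "\<dots> = ennreal ((L2_norm g)\<^sup>2 + B)" using B by simp
  finally have "wsqint n g \<le> ennreal ((L2_norm g)\<^sup>2 + B)" .
  from weak_deriv_of_fourier[OF fg this] B(2)
  show "is_weak_deriv n f (weak_deriv n f)" "in_L2 (weak_deriv n f)" by simp_all
qed

text \<open>Passes from squared norms to norms by subadditivity of the square root; the Plancherel
  factor \<open>2 * pi\<close> on the left is discarded as being at least 1.\<close>

lemma le_sqrt_sum:
  fixes x y z X :: real
  assumes "2 * pi * x\<^sup>2 \<le> p * y\<^sup>2 + q * z\<^sup>2" "0 \<le> p" "0 \<le> q" "0 \<le> y" "0 \<le> z"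
  shows "x \<le> sqrt p * y + sqrt q * z"
proof (rule power2_le_imp_le)
  have "1 * x\<^sup>2 \<le> 2 * pi * x\<^sup>2" using pi_gt3 by (intro mult_right_mono) auto
  also have "\<dots> \<le> p * y\<^sup>2 + q * z\<^sup>2" by fact
  also have "\<dots> = (sqrt p * y)\<^sup>2 + (sqrt q * z)\<^sup>2" using assms by (simp add: power_mult_distrib)
  also have "\<dots> \<le> (sqrt p * y + sqrt q * z)\<^sup>2" using assms by (simp add: power2_sum)
  finally show "x\<^sup>2 \<le> (sqrt p * y + sqrt q * z)\<^sup>2" by simp
qed (use assms in auto)

text \<open>Membership in the Sobolev space belongs to the conclusion because
  \<open>weak_deriv\<close> is a choice operator: the norm on the left has a meaning only once the
  weak derivative is known to exist and to be square integrable.\<close>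

theorem theorem3p5:
  fixes k1 k2 k3 k4 \<gamma> :: real and N l j :: nat
  assumes "k1 > 0" "k2 > 0" "k3 > 0" "k4 > 0" "\<gamma> > 0"
    and "N \<ge> 1" "l \<ge> 1" "l \<le> N" "j \<le> N - l"
  shows "\<exists>c0>0. \<exists>c1>0. \<forall>U0 U.
    in_sobolev N U0 \<longrightarrow> in_L1 U0 \<longrightarrow> laminated_solution k1 k2 k3 k4 \<gamma> U0 U \<longrightarrow>
    (\<forall>t\<ge>0. in_sobolev j (U t) \<and>
      (k1 = k2 \<and> k2 = k3 \<longrightarrow>
        L2_norm (weak_deriv j (U t))
          \<le> c0 * (1 + t) powr (- 1 / 8 - real j / 4) * L1_norm U0
            + c0 * exp (- c1 * t) * L2_norm (weak_deriv (j + l) U0)) \<and>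
      (\<not> (k1 = k2 \<and> k2 = k3) \<longrightarrow>
        L2_norm (weak_deriv j (U t))
          \<le> c0 * (1 + t) powr (- 1 / 8 - real j / 4) * L1_norm U0
            + c0 * (1 + t) powr (- real l / 4) * L2_norm (weak_deriv (j + l) U0)))"
proof -
  interpret laminated k1 k2 k3 k4 \<gamma> by unfold_locales (fact assms)+
  obtain C c where C: "C > 0" and c: "c > 0"
    and low: "\<And>\<xi> W t. laminated_ode k1 k2 k3 k4 \<gamma> \<xi> W \<Longrightarrow> t \<ge> 0 \<Longrightarrow> \<bar>\<xi>\<bar> \<le> 1 \<Longrightarrow>
       (norm (W t))\<^sup>2 \<le> C * exp (- c * \<xi>^4 * t) * (norm (W 0))\<^sup>2"
    and high: "\<And>\<xi> W t. laminated_ode k1 k2 k3 k4 \<gamma> \<xi> W \<Longrightarrow> t \<ge> 0 \<Longrightarrow> 1 \<le> \<bar>\<xi>\<bar> \<Longrightarrow>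
       (norm (W t))\<^sup>2 \<le> C * exp (- c * (1 / \<xi>^4) * t) * (norm (W 0))\<^sup>2"
    and high_eq: "\<And>\<xi> W t. k1 = k2 \<Longrightarrow> k2 = k3 \<Longrightarrow> laminated_ode k1 k2 k3 k4 \<gamma> \<xi> W \<Longrightarrow> t \<ge> 0 \<Longrightarrow> 1 \<le> \<bar>\<xi>\<bar> \<Longrightarrow>
       (norm (W t))\<^sup>2 \<le> C * exp (- c * t) * (norm (W 0))\<^sup>2"
    by (rule fourier_decay) (rule that)
  obtain K where K: "K \<ge> 0" "\<And>t. t \<ge> 0 \<Longrightarrow>
    (\<integral>\<^sup>+\<xi>. ennreal (indicator {-1..1} \<xi> * (\<bar>\<xi>\<bar> ^ (2 * j) * exp (- c * \<xi>^4 * t))) \<partial>lborel)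
      \<le> ennreal (K * (1 + t) powr (- (2 * real j + 1) / 4))"
    using low_frequency_integral[OF c, of j] by blast
  obtain M where M: "M \<ge> 0" "\<And>t \<xi>. t \<ge> 0 \<Longrightarrow> 1 \<le> \<bar>\<xi>\<bar> \<Longrightarrow>
    exp (- c * (1 / \<xi>^4) * t) \<le> M * (1 + t) powr (- real l / 2) * \<bar>\<xi>\<bar> ^ (2 * l)"
    using high_frequency_bound[OF c, of l] by blast
  \<comment> \<open>The summands serve the low frequencies, the high frequencies with equal speeds
    and those with unequal speeds. The middle one is strictly positive, which makes
    \<open>c0\<close> so.\<close>
  define c0 where "c0 = sqrt (C * K) + sqrt (C * (2 * pi)) + sqrt (C * M * (2 * pi))"
  have c0: "c0 > 0" "sqrt (C * K) \<le> c0" "sqrt (C * (2 * pi)) \<le> c0" "sqrt (C * M * (2 * pi)) \<le> c0"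
  proof -
    have "0 \<le> sqrt (C * K)" "0 < sqrt (C * (2 * pi))" "0 \<le> sqrt (C * M * (2 * pi))" using C K(1) M(1) by auto
    then show "c0 > 0" "sqrt (C * K) \<le> c0" "sqrt (C * (2 * pi)) \<le> c0" "sqrt (C * M * (2 * pi)) \<le> c0"
      unfolding c0_def by linarith+
  qed
  show ?thesis
  proof (rule exI[of _ c0], rule conjI[OF c0(1)], rule exI[of _ "c/2"], intro conjI allI impI)
    show "c / 2 > 0" using c by simp
  next
    fix U0 U and t :: real
    assume U0: "in_sobolev N U0" "in_L1 U0" and sol: "laminated_solution k1 k2 k3 k4 \<gamma> U0 U" and t: "t \<ge> 0"
    obtain W where W: "\<And>\<xi>. laminated_ode k1 k2 k3 k4 \<gamma> \<xi> (W \<xi>)" "\<And>\<xi>. W \<xi> 0 = fourier U0 \<xi>"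
      "\<And>t. t \<ge> 0 \<Longrightarrow> has_L2_fourier (U t) (\<lambda>\<xi>. W \<xi> t)"
      using sol unfolding laminated_solution_def by blast
    note fU = W(3)[OF t]
    let ?G = "weak_deriv (j + l) U0"
    let ?A = "L1_norm U0" and ?D = "L2_norm ?G"
    let ?a = "K * (1 + t) powr (- (2 * real j + 1) / 4)"
    have AD: "0 \<le> ?A" "0 \<le> ?D" unfolding L1_norm_def L2_norm_def by auto
    have "j + l \<le> N" using assms by simp
    then have G: "is_weak_deriv (j + l) U0 ?G" "in_L2 ?G" using U0 unfolding in_sobolev_def by auto
    have m: "(\<lambda>\<xi>. W \<xi> t) \<in> borel_measurable borel" "fourier U0 \<in> borel_measurable borel"
      using fU U0(2) unfolding has_L2_fourier_def in_L2_def in_L1_def by (auto intro: measurable_fourier)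
    have lowW: "(norm (W \<xi> t))\<^sup>2 \<le> C * exp (- c * \<xi>^4 * t) * ?A\<^sup>2" if "\<bar>\<xi>\<bar> \<le> 1" for \<xi>
    proof -
      have "(norm (W \<xi> t))\<^sup>2 \<le> C * exp (- c * \<xi>^4 * t) * (norm (W \<xi> 0))\<^sup>2" by (rule low[OF W(1) t that])
      also have "\<dots> \<le> C * exp (- c * \<xi>^4 * t) * ?A\<^sup>2"
        unfolding W(2) using C by (intro mult_left_mono power_mono norm_fourier_le) auto
      finally show ?thesis .
    qed
    \<comment> \<open>The factor \<open>b\<close> stands for the decay of the squared norm at high
      frequency, so that both cases of the theorem share one estimate.\<close>
    have est: "wsqint j (\<lambda>\<xi>. W \<xi> t) \<le> ennreal (C * ?A\<^sup>2 * ?a + C * b * (2 * pi * ?D\<^sup>2))"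
      if "b \<ge> 0" "\<And>\<xi>. 1 \<le> \<bar>\<xi>\<bar> \<Longrightarrow> (norm (W \<xi> t))\<^sup>2 \<le> C * (b * \<bar>\<xi>\<bar> ^ (2 * l)) * (norm (fourier U0 \<xi>))\<^sup>2" for b
      by (rule fourier_estimate[OF m lowW that(2) K(2)[OF t] fourier_weak_deriv_le[OF U0(2) G]])
         (use C K(1) that(1) in auto)
    have "(norm (W \<xi> t))\<^sup>2 \<le> C * ((M * (1 + t) powr (- real l / 2)) * \<bar>\<xi>\<bar> ^ (2 * l)) * (norm (fourier U0 \<xi>))\<^sup>2" if "1 \<le> \<bar>\<xi>\<bar>" for \<xi>
    proof -
      have "C * exp (- c * (1 / \<xi>^4) * t) * (norm (W \<xi> 0))\<^sup>2 \<le> C * (M * (1 + t) powr (- real l / 2) * \<bar>\<xi>\<bar> ^ (2 * l)) * (norm (W \<xi> 0))\<^sup>2"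
        using C by (intro mult_right_mono mult_left_mono M(2) t that) auto
      with high[OF W(1) t that] show ?thesis unfolding W(2) by simp
    qed
    note weak = est[OF _ this]
    let ?b = "M * (1 + t) powr (- real l / 2)"
    have bn: "0 \<le> ?b" using M(1) by simp
    have pj: "((1 + t) powr (- 1 / 8 - real j / 4))\<^sup>2 = (1 + t) powr (- (2 * real j + 1) / 4)"
    proof -
      have e: "(- 1 / 8 - real j / 4) * real 2 = - (2 * real j + 1) / 4" by simp
      show ?thesis unfolding e[symmetric] by (subst powr_power) (use t in \<open>simp_all add: mult.commute\<close>)
    qed
    \<comment> \<open>The weaker high-frequency decay is valid for all speeds and already gives the
      finiteness required here.\<close>
    show "in_sobolev j (U t)"
      by (rule sobolev_of_fourier[OF fU weak[OF bn]]) (use C K(1) bn in auto)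
    \<comment> \<open>The decay of the squared norm is written as \<open>B s^2\<close>, and
      \<open>s\<close> is the decay that appears in the result. This halves the rates:
      \<open>c\<close> becomes \<open>c/2\<close>, and \<open>l/2\<close> becomes
      \<open>l/4\<close>.\<close>
    have final: "L2_norm (weak_deriv j (U t)) \<le> c0 * (1 + t) powr (- 1 / 8 - real j / 4) * ?A + c0 * s * ?D"
      if b: "b = B * s\<^sup>2" "0 \<le> s" "0 \<le> B" "sqrt (C * B * (2 * pi)) \<le> c0"
        and e: "\<And>\<xi>. 1 \<le> \<bar>\<xi>\<bar> \<Longrightarrow> (norm (W \<xi> t))\<^sup>2 \<le> C * (b * \<bar>\<xi>\<bar> ^ (2 * l)) * (norm (fourier U0 \<xi>))\<^sup>2" for b B s
    proof -
      have b0: "b \<ge> 0" using b by simp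
      have "2 * pi * (L2_norm (weak_deriv j (U t)))\<^sup>2 \<le> C * ?A\<^sup>2 * ?a + C * b * (2 * pi * ?D\<^sup>2)"
        by (rule weak_deriv_of_fourier(3)[OF fU est[OF b0 e]]) (use C K(1) b0 in auto)
      also have "\<dots> = (C * K) * ((1 + t) powr (- 1 / 8 - real j / 4) * ?A)\<^sup>2 + (C * B * (2 * pi)) * (s * ?D)\<^sup>2"
        unfolding power_mult_distrib pj b(1) by (simp only: mult_ac)
      finally have "L2_norm (weak_deriv j (U t)) \<le> sqrt (C * K) * ((1 + t) powr (- 1 / 8 - real j / 4) * ?A) + sqrt (C * B * (2 * pi)) * (s * ?D)"
        by (rule le_sqrt_sum) (use C K(1) b AD in auto)
      also have "\<dots> \<le> c0 * ((1 + t) powr (- 1 / 8 - real j / 4) * ?A) + c0 * (s * ?D)"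
        using b c0 AD by (intro add_mono mult_right_mono) auto
      finally show ?thesis by (simp only: mult.assoc)
    qed
    show "L2_norm (weak_deriv j (U t)) \<le> c0 * (1 + t) powr (- 1 / 8 - real j / 4) * ?A + c0 * (1 + t) powr (- real l / 4) * ?D"
    proof (rule final[of _ M])
      show "?b = M * ((1 + t) powr (- real l / 4))\<^sup>2" using t by (simp add: powr_power)
    qed (use M(1) c0 \<open>\<And>\<xi>. 1 \<le> \<bar>\<xi>\<bar> \<Longrightarrow> _\<close> in auto)
    assume eq: "k1 = k2 \<and> k2 = k3"
    show "L2_norm (weak_deriv j (U t)) \<le> c0 * (1 + t) powr (- 1 / 8 - real j / 4) * ?A + c0 * exp (- (c/2) * t) * ?D"
    proof (rule final[of _ 1])
      show "exp (- c * t) = 1 * (exp (- (c/2) * t))\<^sup>2" by (simp add: power2_eq_square flip: exp_add)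
      fix \<xi> :: real assume x: "1 \<le> \<bar>\<xi>\<bar>"
      \<comment> \<open>For equal speeds nothing has to be traded for decay; the factor
        \<open>|\<xi>|^(2l) \<ge> 1\<close> is inserted only to reach the same derivative of the
        initial value as in the other case.\<close>
      have "C * exp (- c * t) * (norm (fourier U0 \<xi>))\<^sup>2 * 1 \<le> C * exp (- c * t) * (norm (fourier U0 \<xi>))\<^sup>2 * \<bar>\<xi>\<bar> ^ (2 * l)"
        using C x by (intro mult_left_mono one_le_power) auto
      then show "(norm (W \<xi> t))\<^sup>2 \<le> C * (exp (- c * t) * \<bar>\<xi>\<bar> ^ (2 * l)) * (norm (fourier U0 \<xi>))\<^sup>2"
        using high_eq[OF _ _ W(1) t x] eq unfolding W(2) by (simp add: mult_ac)
    qed (use c0 in auto)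
  qed
qed

end
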